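(* For every $n\ge1$ there is a unique polynomial $\Phi_n\in\mathbb{Q}[Y_0,Y_1,Y_2]$ such that $C_n(q)=\Phi_n(A_0(q),A_1(q),A_2(q))$ for all $0<q<1$. Moreover, for every $n\ge 2$, \[\Phi_{2n-1}=\frac{6B_{2n}}{n}Y_0-\frac{36B_{2n}}{n}Y_1+\Big(1+\frac{30B_{2n}}{n}\Big)Y_2+(\text{terms of total degree}\ge 2),\] \[\Phi_{2n}=-\frac{6B_{2n}}{n}Y_1+\Big(\frac{6B_{2n}}{n}-1\Big)Y_2+(\text{terms of total degree}\ge 2).\]
   Context: $B_m$ denotes the $m$-th Bernoulli number ($B_0=1$, $B_1=-\tfrac12$, $B_2=\tfrac16$, $B_4=-\tfrac1{30}$). For $m\ge1$ let $\sigma(m)$ be the sum of the positive divisors of $m$, and for $i\ge 0$, $0<q<1$, let $A_i(q)=\sum_{m\ge1}m^i\sigma(m)q^m$. Polynomials $S_i(n)$: let $a_0,a_1,\dots$ be indeterminates, $a(x)=\sum_{i\ge0}a_ix^i$. For a positive integer $j$ set $G(x)=\prod_{i=0}^{j-1}\frac{1+a(x)x^2}{1+ix}$, $H(x)=\prod_{i=1-j}^{-1}\frac{1+ix}{1+a(x)x^2}$, $u=2j-1$, $v=j(j-1)$. For each $n\ge1$ there are unique $S_0(n),\dots,S_n(n)\in\mathbb{Q}[a_0,\dots,a_{n-2}]$ (constants if $n=1$), independent of $j$, such that for every positive integer $j$ the coefficient of $x^{n-1}$ in $\frac{G(x)-H(x)}{x^2}(1+a(x)x^2)$ equals $u\big(a_{n-1}+S_0(n)+\sum_{i=1}^nS_i(n)v^i\big)$.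 Write $S_i(n)(c_1,\dots,c_{n-1})$ for the substitution $a_k=c_{k+1}$. Recursion: with indeterminates $X_0,X_1,\dots$ and the derivation $D$ of $\mathbb{Q}[X_0,X_1,\dots]$ with $D(X_k)=X_{k+1}$, put $P_1=X_0$, $P_{m+1}=D(P_m)-3X_0P_m$, and $\widehat C_m=-S_0(m)(\widehat C_1,\dots,\widehat C_{m-1})+\sum_{i=1}^{m}3\cdot2^iS_i(m)(\widehat C_1,\dots,\widehat C_{m-1})P_i$ for $m\ge1$. Then $C_n(q):=\widehat C_n(A_0(q),A_1(q),\dots)$ (these $C_n(q)$ are the coefficients in the asymptotic expansion $x_k=-kq^{1-k}(1+\sum_{i\le n}C_i(q)k^{-1-i}+o(k^{-1-n}))$ of the zeros $x_1>x_2>\cdots$ of $\sum_{n\ge0}q^{n(n-1)/2}x^n/n!$). *)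

theory Defs
  imports "HOL-Analysis.Analysis" "HOL-Library.Poly_Mapping"
    "HOL-Computational_Algebra.Formal_Power_Series"
begin

section \<open>Bernoulli numbers (B_1 = -1/2 convention)\<close>

fun bernoulli :: "nat \<Rightarrow> rat" where
  "bernoulli 0 = 1"
| "bernoulli (Suc m) = - (1 / of_nat (m + 2)) * (\<Sum>k\<le>m. of_nat ((m + 2) choose k) * bernoulli k)"

definition sigma :: "nat \<Rightarrow> nat" where
  "sigma m = (\<Sum>d\<in>{d. d dvd m}. d)"

definition A :: "nat \<Rightarrow> real \<Rightarrow> real" where
  "A i q = suminf (\<lambda>m. real (Suc m) ^ i * real (sigma (Suc m)) * q ^ (Suc m))"

type_synonym mpoly = "(nat \<Rightarrow>\<^sub>0 nat) \<Rightarrow>\<^sub>0 rat"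

definition Var :: "nat \<Rightarrow> mpoly" where
  "Var k = Poly_Mapping.single (Poly_Mapping.single k 1) 1"

definition mp_const :: "rat \<Rightarrow> mpoly" where
  "mp_const r = Poly_Mapping.single 0 r"

definition mp_vars :: "mpoly \<Rightarrow> nat set" where
  "mp_vars p = (\<Union>m\<in>Poly_Mapping.keys p. Poly_Mapping.keys m)"

definition mp_eval :: "mpoly \<Rightarrow> (nat \<Rightarrow> 'b::field_char_0) \<Rightarrow> 'b" where
  "mp_eval p x = (\<Sum>m\<in>Poly_Mapping.keys p.
      of_rat (Poly_Mapping.lookup p m) * (\<Prod>k\<in>Poly_Mapping.keys m. x k ^ Poly_Mapping.lookup m k))"

definition mp_subst :: "mpoly \<Rightarrow> (nat \<Rightarrow> mpoly) \<Rightarrow> mpoly" where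
  "mp_subst p \<sigma> = (\<Sum>m\<in>Poly_Mapping.keys p.
      mp_const (Poly_Mapping.lookup p m) * (\<Prod>k\<in>Poly_Mapping.keys m. \<sigma> k ^ Poly_Mapping.lookup m k))"

text \<open>The derivation D with D(X_k) = X_(k+1) (Leibniz rule on monomials).\<close>
definition mp_D :: "mpoly \<Rightarrow> mpoly" where
  "mp_D p = (\<Sum>m\<in>Poly_Mapping.keys p. mp_const (Poly_Mapping.lookup p m) *
      (\<Sum>k\<in>Poly_Mapping.keys m. of_nat (Poly_Mapping.lookup m k) *
         (\<Prod>l\<in>Poly_Mapping.keys m. Var l ^ (Poly_Mapping.lookup m l - (if l = k then 1 else 0)))
         * Var (Suc k)))"

definition aF :: "(nat \<Rightarrow> real) \<Rightarrow> real fps" where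
  "aF c = Abs_fps c"

definition Gf :: "(nat \<Rightarrow> real) \<Rightarrow> nat \<Rightarrow> real fps" where
  "Gf c j = (\<Prod>i\<in>{0..<j}. (1 + aF c * fps_X ^ 2) / (1 + of_nat i * fps_X))"

definition Hf :: "(nat \<Rightarrow> real) \<Rightarrow> nat \<Rightarrow> real fps" where
  "Hf c j = (\<Prod>i\<in>{1 - int j..-1}. (1 + of_int i * fps_X) / (1 + aF c * fps_X ^ 2))"

text \<open>The defining identity, evaluated at a real point a_k = c k.\<close>
definition S_rel :: "nat \<Rightarrow> (nat \<Rightarrow> real) \<Rightarrow> (nat \<Rightarrow> real) \<Rightarrow> bool" where
  "S_rel n c s \<longleftrightarrow> (\<forall>j::nat. j \<ge> 1 \<longrightarrow>
     fps_nth ((Gf c j - Hf c j) / fps_X ^ 2 * (1 + aF c * fps_X ^ 2)) (n - 1)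
       = (2 * real j - 1) * (c (n - 1) + s 0 + (\<Sum>i=1..n. s i * (real j * (real j - 1)) ^ i)))"

definition S_poly :: "nat \<Rightarrow> nat \<Rightarrow> mpoly" where
  "S_poly n = (THE S. (\<forall>i>n. S i = 0) \<and> (\<forall>i. mp_vars (S i) \<subseteq> {..<n - 1}) \<and>
      (\<forall>c::nat \<Rightarrow> real. S_rel n c (\<lambda>i. mp_eval (S i) c)))"

primrec Pp :: "nat \<Rightarrow> mpoly" where
  "Pp 0 = Var 0"
| "Pp (Suc m) = mp_D (Pp m) - 3 * Var 0 * Pp m"

definition P :: "nat \<Rightarrow> mpoly" where
  "P m = Pp (m - 1)"

text \<open>Chat_list m = [\<hat>C_1, ..., \<hat>C_m]; substitution a_k := \<hat>C_(k+1).\<close>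
primrec Chat_list :: "nat \<Rightarrow> mpoly list" where
  "Chat_list 0 = []"
| "Chat_list (Suc m) =
     (let cs = Chat_list m;
          \<sigma> = (\<lambda>k. if k < length cs then cs ! k else 0);
          S = S_poly (Suc m)
      in cs @ [- mp_subst (S 0) \<sigma> +
               (\<Sum>i=1..Suc m. mp_const (3 * 2 ^ i) * mp_subst (S i) \<sigma> * P i)])"

definition Chat :: "nat \<Rightarrow> mpoly" where
  "Chat n = Chat_list n ! (n - 1)"

definition C :: "nat \<Rightarrow> real \<Rightarrow> real" where
  "C n q = mp_eval (Chat n) (\<lambda>k. A k q)"

end

theory Submission
  imports Defs "HOL-Complex_Analysis.Complex_Analysis" "HOL-Real_Asymp.Real_Asymp"
begin

text \<open>
  With \<open>\<theta> = q d/dq\<close> we have \<open>\<theta> A\<^sub>i = A\<^sub>i\<^sub>+\<^sub>1\<close>, and Chazy's equation \<open>A\<^sub>3 = A\<^sub>2 - 24 A\<^sub>0 A\<^sub>2 + 36 A\<^sub>1\<^sup>2\<close> (van der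
  Pol's convolution identity for \<open>\<sigma>\<close>) makes every \<open>A\<^sub>k\<close> a polynomial in \<open>A\<^sub>0, A\<^sub>1, A\<^sub>2\<close> that is congruent to
  \<open>A\<^sub>2\<close> modulo terms of degree at least 2 when \<open>k \<ge> 2\<close>. Hence \<open>\<Phi>\<^sub>n\<close> exists. To first order \<open>P\<^sub>i\<close> is \<open>X\<^sub>i\<^sub>-\<^sub>1\<close>
  and \<open>C\<^sub>n\<close> is \<open>\<Sum> 3 \<sqdot> 2\<^sup>i S\<^sub>i(n)(0) P\<^sub>i\<close>, so its linear part is read off the numbers \<open>S\<^sub>1(n)(0)\<close>,
  \<open>S\<^sub>2(n)(0)\<close> and \<open>\<Sum> 2\<^sup>i S\<^sub>i(n)(0)\<close>. The last one is the defining identity at \<open>j = 2\<close>; the first two are Taylor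
  coefficients at \<open>j = 1\<close> of \<open>\<Prod>\<^sub>i\<^sub><\<^sub>j 1 / (1 + i x)\<close>, viewed as a polynomial in \<open>j\<close> in each degree in \<open>x\<close>,
  and Newton's identities express them by derivatives of power sum polynomials, i.e. by Bernoulli numbers.

  Uniqueness is the algebraic independence of \<open>A\<^sub>0, A\<^sub>1, A\<^sub>2\<close>, equivalently of the Eisenstein series
  \<open>P, Q, R\<close> of weights 2, 4, 6. A relation \<open>F(P, Q, R) = 0\<close>, transported by \<open>\<tau> \<mapsto> \<tau> / (c \<tau> + 1)\<close> and by
  translations, becomes \<open>F(j\<^sup>2 P + \<kappa> c j, j\<^sup>4 Q, j\<^sup>6 R) = 0\<close> with \<open>j = c (\<tau> + m) + 1\<close> for all integers \<open>m\<close> and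
  \<open>c \<ge> 1\<close>, hence for arbitrary complex \<open>j\<close> and \<open>c\<close>; as \<open>Q\<^sup>3 / R\<^sup>2\<close> is not constant, \<open>F\<close> vanishes
  everywhere.
\<close>

section \<open>Polynomials over the rationals: evaluation, substitution and linear parts\<close>


text \<open>A modular substitution mixes two quantities that have to become independent: the factor
  j and the inhomogeneous term \<kappa> c j in the law of \<open>P\<close>. Translations move j for
  fixed c, and c then moves the inhomogeneous term for fixed j.

  The lattice sum of weight 2 is not absolutely convergent, so the law of \<open>P\<close> is not
  obtained by permuting lattice points as for \<open>Q\<close> and \<open>R\<close>. It comes from
  differentiating the law of \<open>Q\<close> and inserting Ramanujan's relation 3 \<theta> Q = P Q
  - R. This relation, 12 \<theta> P = P^2 - Q and Chazy's equation are convolution identities for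
  divisor sums, all proved by one involution on the positive solutions of a x + b y = n.

  On the algebraic side, \<open>G\<close> and \<open>H\<close> are, up to a common factor, the
  values at j and 1 - j of one family indexed by all integers, with coefficients polynomial in j.
  Its antisymmetrization is u times a polynomial in v, which produces the S_i(n). The same symmetry
  turns derivatives at j = 1 into the first two of them at a = 0.\<close>

lemma poly_mapping_sum_single:
  "(p :: 'a \<Rightarrow>\<^sub>0 'b::comm_monoid_add) = (\<Sum>m\<in>Poly_Mapping.keys p. Poly_Mapping.single m (Poly_Mapping.lookup p m))"
proof (rule poly_mapping_eqI)
  fix k
  have "(\<Sum>m\<in>Poly_Mapping.keys p. Poly_Mapping.lookup (Poly_Mapping.single m (Poly_Mapping.lookup p m)) k)
      = (\<Sum>m\<in>Poly_Mapping.keys p. if k = m then Poly_Mapping.lookup p m else 0)"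
    by (intro sum.cong) (auto simp: lookup_single when_def)
  also have "\<dots> = Poly_Mapping.lookup p k"
    by (auto simp: in_keys_iff)
  finally show "Poly_Mapping.lookup p k = Poly_Mapping.lookup (\<Sum>m\<in>Poly_Mapping.keys p. Poly_Mapping.single m (Poly_Mapping.lookup p m)) k"
    by (simp add: lookup_sum)
qed

definition mono_eval :: "(nat \<Rightarrow>\<^sub>0 nat) \<Rightarrow> (nat \<Rightarrow> 'b::comm_semiring_1) \<Rightarrow> 'b" where
  "mono_eval m x = (\<Prod>k\<in>Poly_Mapping.keys m. x k ^ Poly_Mapping.lookup m k)"

lemma mono_eval_superset:
  "finite K \<Longrightarrow> Poly_Mapping.keys m \<subseteq> K \<Longrightarrow> mono_eval m x = (\<Prod>k\<in>K. x k ^ Poly_Mapping.lookup m k)"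
  unfolding mono_eval_def by (rule prod.mono_neutral_left) (auto simp: in_keys_iff)

lemma mono_eval_0 [simp]: "mono_eval 0 x = 1"
  by (simp add: mono_eval_def)

lemma mono_eval_single: "mono_eval (Poly_Mapping.single k e) x = x k ^ e"
  by (cases "e = 0") (auto simp: mono_eval_def)

lemma mono_eval_add: "mono_eval (m + m') x = mono_eval m x * mono_eval m' x"
proof -
  let ?K = "Poly_Mapping.keys m \<union> Poly_Mapping.keys m'"
  have "mono_eval (m + m') x = (\<Prod>k\<in>?K. x k ^ Poly_Mapping.lookup (m + m') k)"
    by (rule mono_eval_superset) (use Poly_Mapping.keys_add[of m m'] in auto)
  also have "\<dots> = mono_eval m x * mono_eval m' x"
    by (simp add: mono_eval_superset[of ?K m] mono_eval_superset[of ?K m'] lookup_add power_add prod.distrib)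
  finally show ?thesis .
qed

text \<open>Evaluation at numbers and substitution of polynomials are the same sum with different
  coefficient maps, so the homomorphism laws are proved once for a ring homomorphism out of the
  rationals.\<close>

definition poly_hom :: "(rat \<Rightarrow> 'b) \<Rightarrow> mpoly \<Rightarrow> (nat \<Rightarrow> 'b) \<Rightarrow> 'b::comm_ring_1" where
  "poly_hom \<phi> p x = (\<Sum>m\<in>Poly_Mapping.keys p. \<phi> (Poly_Mapping.lookup p m) * mono_eval m x)"

locale rat_hom =
  fixes \<phi> :: "rat \<Rightarrow> 'b::comm_ring_1"
  assumes hom_add: "\<phi> (a + b) = \<phi> a + \<phi> b" and hom_mult: "\<phi> (a * b) = \<phi> a * \<phi> b"
    and hom_one: "\<phi> 1 = 1"
begin

lemma hom_zero: "\<phi> 0 = 0"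
  using hom_add[of 0 0] by simp

lemma poly_hom_superset:
  "finite K \<Longrightarrow> Poly_Mapping.keys p \<subseteq> K \<Longrightarrow>
    poly_hom \<phi> p x = (\<Sum>m\<in>K. \<phi> (Poly_Mapping.lookup p m) * mono_eval m x)"
  unfolding poly_hom_def by (rule sum.mono_neutral_left) (auto simp: in_keys_iff hom_zero)

lemma poly_hom_0: "poly_hom \<phi> 0 x = 0"
  by (simp add: poly_hom_def)

lemma poly_hom_single: "poly_hom \<phi> (Poly_Mapping.single m c) x = \<phi> c * mono_eval m x"
  by (simp add: poly_hom_def hom_zero)

lemma poly_hom_add: "poly_hom \<phi> (p + q) x = poly_hom \<phi> p x + poly_hom \<phi> q x"
proof -
  let ?K = "Poly_Mapping.keys p \<union> Poly_Mapping.keys q"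
  have "poly_hom \<phi> (p + q) x = (\<Sum>m\<in>?K. \<phi> (Poly_Mapping.lookup (p + q) m) * mono_eval m x)"
    by (rule poly_hom_superset) (use Poly_Mapping.keys_add[of p q] in auto)
  thus ?thesis
    by (simp add: poly_hom_superset[of ?K p] poly_hom_superset[of ?K q] lookup_add hom_add
        algebra_simps sum.distrib)
qed

lemma poly_hom_sum: "poly_hom \<phi> (sum f I) x = (\<Sum>i\<in>I. poly_hom \<phi> (f i) x)"
  by (induction I rule: infinite_finite_induct) (auto simp: poly_hom_0 poly_hom_add)

lemma poly_hom_mult: "poly_hom \<phi> (p * q) x = poly_hom \<phi> p x * poly_hom \<phi> q x"
proof -
  have "p * q = (\<Sum>m\<in>Poly_Mapping.keys p. \<Sum>m'\<in>Poly_Mapping.keys q.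
      Poly_Mapping.single (m + m') (Poly_Mapping.lookup p m * Poly_Mapping.lookup q m'))"
    by (subst poly_mapping_sum_single[of p], subst poly_mapping_sum_single[of q])
       (simp add: sum_product mult_single)
  also have "poly_hom \<phi> \<dots> x = (\<Sum>m\<in>Poly_Mapping.keys p. \<Sum>m'\<in>Poly_Mapping.keys q.
      (\<phi> (Poly_Mapping.lookup p m) * mono_eval m x) * (\<phi> (Poly_Mapping.lookup q m') * mono_eval m' x))"
    by (simp add: poly_hom_sum poly_hom_single hom_mult mono_eval_add algebra_simps)
  finally show ?thesis
    by (simp add: poly_hom_def sum_product)
qed

lemma poly_hom_1: "poly_hom \<phi> 1 x = 1"
  using poly_hom_single[of 0 1 x] by (simp add: hom_one)

lemma poly_hom_uminus: "poly_hom \<phi> (- p) x = - poly_hom \<phi> p x"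
  using poly_hom_add[of p "- p" x] by (simp add: poly_hom_0 eq_neg_iff_add_eq_0 add.commute)

lemma poly_hom_diff: "poly_hom \<phi> (p - q) x = poly_hom \<phi> p x - poly_hom \<phi> q x"
  using poly_hom_add[of p "- q" x] by (simp add: poly_hom_uminus)

lemma poly_hom_power: "poly_hom \<phi> (p ^ n) x = poly_hom \<phi> p x ^ n"
  by (induction n) (auto simp: poly_hom_1 poly_hom_mult)

lemma poly_hom_prod: "poly_hom \<phi> (prod f I) x = (\<Prod>i\<in>I. poly_hom \<phi> (f i) x)"
  by (induction I rule: infinite_finite_induct) (auto simp: poly_hom_1 poly_hom_mult)

lemma poly_hom_const: "poly_hom \<phi> (mp_const c) x = \<phi> c"
  by (simp add: mp_const_def poly_hom_single)

lemma poly_hom_Var: "poly_hom \<phi> (Var k) x = x k"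
  by (simp add: Var_def poly_hom_single hom_one mono_eval_single)

lemma poly_hom_of_nat: "poly_hom \<phi> (of_nat n) x = of_nat n"
  by (induction n) (auto simp: poly_hom_0 poly_hom_1 poly_hom_add)

lemma poly_hom_numeral: "poly_hom \<phi> (numeral n) x = numeral n"
  using poly_hom_of_nat[of "numeral n" x] by simp

end

lemma mp_const_add: "mp_const (a + b) = mp_const a + mp_const b"
  by (simp add: mp_const_def single_add)

lemma mp_const_mult: "mp_const (a * b) = mp_const a * mp_const b"
  by (simp add: mp_const_def mult_single)

lemma mp_const_1: "mp_const 1 = 1"
  by (simp add: mp_const_def)

lemma mp_const_0: "mp_const 0 = 0"
  by (simp add: mp_const_def)

interpretation mp_const: rat_hom mp_const
  by unfold_locales (auto simp: mp_const_add mp_const_mult mp_const_1)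

interpretation of_rat: rat_hom "of_rat :: rat \<Rightarrow> 'b::field_char_0"
  by unfold_locales (auto simp: of_rat_add of_rat_mult)

lemma mp_eval_conv: "mp_eval p x = poly_hom of_rat p x"
  by (simp add: mp_eval_def poly_hom_def mono_eval_def)

lemma mp_subst_conv: "mp_subst p x = poly_hom mp_const p x"
  by (simp add: mp_subst_def poly_hom_def mono_eval_def)

lemmas mp_eval_hom [simp] =
  of_rat.poly_hom_0 [folded mp_eval_conv] of_rat.poly_hom_1 [folded mp_eval_conv]
  of_rat.poly_hom_add [folded mp_eval_conv] of_rat.poly_hom_mult [folded mp_eval_conv]
  of_rat.poly_hom_sum [folded mp_eval_conv] of_rat.poly_hom_prod [folded mp_eval_conv]
  of_rat.poly_hom_power [folded mp_eval_conv] of_rat.poly_hom_uminus [folded mp_eval_conv]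
  of_rat.poly_hom_diff [folded mp_eval_conv] of_rat.poly_hom_const [folded mp_eval_conv]
  of_rat.poly_hom_Var [folded mp_eval_conv] of_rat.poly_hom_of_nat [folded mp_eval_conv]
  of_rat.poly_hom_numeral [folded mp_eval_conv]

lemma mp_eval_mono_eval: "mp_eval (mono_eval m \<sigma>) x = mono_eval m (\<lambda>k. mp_eval (\<sigma> k) x)"
  by (simp add: mono_eval_def)

lemma mp_eval_subst: "mp_eval (mp_subst p \<sigma>) x = mp_eval p (\<lambda>k. mp_eval (\<sigma> k) x)"
  unfolding mp_subst_conv
  by (simp add: poly_hom_def mp_eval_mono_eval) (simp add: mp_eval_conv poly_hom_def)

lemma mono_eval_cong: "(\<And>k. k \<in> Poly_Mapping.keys m \<Longrightarrow> x k = y k) \<Longrightarrow> mono_eval m x = mono_eval m y"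
  by (simp add: mono_eval_def)

lemma mp_eval_cong: "(\<And>k. k \<in> mp_vars p \<Longrightarrow> x k = y k) \<Longrightarrow> mp_eval p x = mp_eval p y"
  unfolding mp_eval_conv poly_hom_def
  by (intro sum.cong refl arg_cong2[where f = "(*)"] mono_eval_cong) (auto simp: mp_vars_def)

lemma mp_vars_0 [simp]: "mp_vars 0 = {}"
  by (simp add: mp_vars_def)

lemma mp_vars_1 [simp]: "mp_vars 1 = {}"
  by (simp add: mp_vars_def)

lemma mp_vars_const [simp]: "mp_vars (mp_const c) = {}"
  by (auto simp: mp_vars_def mp_const_def)

lemma mp_vars_Var [simp]: "mp_vars (Var k) = {k}"
  by (auto simp: mp_vars_def Var_def)

lemma mp_vars_uminus [simp]: "mp_vars (- p) = mp_vars p"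
  by (auto simp: mp_vars_def in_keys_iff)

lemma mp_vars_add: "mp_vars (p + q) \<subseteq> mp_vars p \<union> mp_vars q"
  using Poly_Mapping.keys_add[of p q] by (auto simp: mp_vars_def)

lemma mp_vars_mult: "mp_vars (p * q) \<subseteq> mp_vars p \<union> mp_vars q"
proof
  fix k assume "k \<in> mp_vars (p * q)"
  then obtain m where m: "m \<in> Poly_Mapping.keys (p * q)" "k \<in> Poly_Mapping.keys m"
    by (auto simp: mp_vars_def)
  then obtain a b where "m = a + b" "a \<in> Poly_Mapping.keys p" "b \<in> Poly_Mapping.keys q"
    using keys_mult[of p q] by auto
  with m(2) Poly_Mapping.keys_add[of a b] show "k \<in> mp_vars p \<union> mp_vars q"
    by (auto simp: mp_vars_def)
qed

lemma mp_vars_add_le: "mp_vars p \<subseteq> V \<Longrightarrow> mp_vars q \<subseteq> V \<Longrightarrow> mp_vars (p + q) \<subseteq> V"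
  using mp_vars_add[of p q] by blast

lemma mp_vars_diff_le: "mp_vars p \<subseteq> V \<Longrightarrow> mp_vars q \<subseteq> V \<Longrightarrow> mp_vars (p - q) \<subseteq> V"
  using mp_vars_add[of p "- q"] by auto

lemma mp_vars_mult_le: "mp_vars p \<subseteq> V \<Longrightarrow> mp_vars q \<subseteq> V \<Longrightarrow> mp_vars (p * q) \<subseteq> V"
  using mp_vars_mult[of p q] by blast

lemma mp_vars_sum_le: "(\<And>i. i \<in> I \<Longrightarrow> mp_vars (f i) \<subseteq> V) \<Longrightarrow> mp_vars (sum f I) \<subseteq> V"
  by (induction I rule: infinite_finite_induct) (simp_all add: mp_vars_add_le)

lemma mp_vars_prod_le: "(\<And>i. i \<in> I \<Longrightarrow> mp_vars (f i) \<subseteq> V) \<Longrightarrow> mp_vars (prod f I) \<subseteq> V"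
  by (induction I rule: infinite_finite_induct) (simp_all add: mp_vars_mult_le)

lemma mp_vars_power_le: "mp_vars p \<subseteq> V \<Longrightarrow> mp_vars (p ^ n) \<subseteq> V"
  by (induction n) (simp_all add: mp_vars_mult_le)

lemma mp_vars_of_nat [simp]: "mp_vars (of_nat n) = {}"
proof -
  have "mp_vars (of_nat n) \<subseteq> {}"
    by (induction n) (simp_all only: of_nat_Suc of_nat_0 mp_vars_0 mp_vars_1 mp_vars_add_le subset_refl)
  thus ?thesis by simp
qed

lemma mp_vars_numeral [simp]: "mp_vars (numeral n) = {}"
  using mp_vars_of_nat[of "numeral n"] by simp

lemma mp_varsI: "k \<in> Poly_Mapping.keys m \<Longrightarrow> m \<in> Poly_Mapping.keys p \<Longrightarrow> k \<in> mp_vars p"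
  by (auto simp: mp_vars_def)

lemma mp_vars_subst_le:
  assumes "\<And>k. k \<in> mp_vars p \<Longrightarrow> mp_vars (\<sigma> k) \<subseteq> V"
  shows "mp_vars (mp_subst p \<sigma>) \<subseteq> V"
  unfolding mp_subst_def
  by (intro mp_vars_sum_le mp_vars_mult_le mp_vars_prod_le mp_vars_power_le assms)
     (simp_all add: mp_varsI)

lemma mp_vars_D_le:
  assumes "\<And>k. k \<in> mp_vars p \<Longrightarrow> k \<in> V" "\<And>k. k \<in> mp_vars p \<Longrightarrow> Suc k \<in> V"
  shows "mp_vars (mp_D p) \<subseteq> V"
  unfolding mp_D_def
  by (intro mp_vars_sum_le mp_vars_mult_le mp_vars_prod_le mp_vars_power_le)
     (simp_all add: assms mp_varsI)

text \<open>Reduction mod \<open>B\<close> peels off the lowest digit. This makes the exponents of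
  the Kronecker substitution below distinct.\<close>

lemma base_repr_unique:
  fixes a b :: "nat \<Rightarrow> nat"
  assumes "\<And>k. k < n \<Longrightarrow> a k < B" "\<And>k. k < n \<Longrightarrow> b k < B"
    and "(\<Sum>k<n. a k * B ^ k) = (\<Sum>k<n. b k * B ^ k)" and "k < n"
  shows "a k = b k"
  using assms
proof (induction n arbitrary: a b k)
  case (Suc n)
  have shift: "(\<Sum>k<Suc n. f k * B ^ k) = f 0 + B * (\<Sum>k<n. f (Suc k) * B ^ k)" for f :: "nat \<Rightarrow> nat"
    by (simp add: sum.lessThan_Suc_shift sum_distrib_left algebra_simps del: sum.lessThan_Suc)
  have eq: "a 0 + B * (\<Sum>k<n. a (Suc k) * B ^ k) = b 0 + B * (\<Sum>k<n. b (Suc k) * B ^ k)"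
    using Suc.prems(3) unfolding shift .
  have lt: "a 0 < B" "b 0 < B" using Suc.prems(1,2) by auto
  have 0: "a 0 = b 0"
    using arg_cong[OF eq, of "\<lambda>x. x mod B"] lt by simp
  hence 1: "(\<Sum>k<n. a (Suc k) * B ^ k) = (\<Sum>k<n. b (Suc k) * B ^ k)"
    using eq lt by auto
  show ?case
  proof (cases k)
    case (Suc k')
    have "a (Suc k') = b (Suc k')"
      by (rule Suc.IH[of "\<lambda>k. a (Suc k)" "\<lambda>k. b (Suc k)"]) (use Suc.prems 1 Suc in auto)
    thus ?thesis using Suc by simp
  qed (use 0 in simp)
qed simp

text \<open>Kronecker substitution \<open>X\<^sub>k := t ^ (B ^ k)\<close> turns distinct monomials into distinct powers of \<open>t\<close>.\<close>
lemma mp_eval_eq_0_imp_eq_0: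
  assumes "\<And>x :: nat \<Rightarrow> 'b::field_char_0. mp_eval p x = 0"
  shows "p = 0"
proof (rule ccontr)
  assume "p \<noteq> 0"
  then obtain m0 where m0: "Poly_Mapping.lookup p m0 \<noteq> 0"
    by (metis lookup_zero poly_mapping_eqI)
  define K where "K = Poly_Mapping.keys p"
  have fin: "finite K" by (simp add: K_def)
  have "finite (\<Union>m\<in>K. Poly_Mapping.keys m)" using fin by auto
  then obtain n where n: "(\<Union>m\<in>K. Poly_Mapping.keys m) \<subseteq> {..<n}"
    using finite_nat_iff_bounded by blast
  have "finite (\<Union>m\<in>K. Poly_Mapping.lookup m ` {..<n})" using fin by auto
  then obtain B where B: "(\<Union>m\<in>K. Poly_Mapping.lookup m ` {..<n}) \<subseteq> {..<B}"
    using finite_nat_iff_bounded by blast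
  define \<kappa> where "\<kappa> m = (\<Sum>k<n. Poly_Mapping.lookup m k * B ^ k)" for m
  have inj: "m = m'" if "m \<in> K" "m' \<in> K" "\<kappa> m = \<kappa> m'" for m m'
  proof (rule poly_mapping_eqI)
    fix k
    show "Poly_Mapping.lookup m k = Poly_Mapping.lookup m' k"
    proof (cases "k < n")
      case True
      thus ?thesis
        using base_repr_unique[of n "Poly_Mapping.lookup m" B "Poly_Mapping.lookup m'" k] that B
        unfolding \<kappa>_def by blast
    next
      case False
      thus ?thesis using n that by (metis UN_I in_keys_iff lessThan_iff subsetD)
    qed
  qed
  define f where "f = (\<Sum>m\<in>K. monom (of_rat (Poly_Mapping.lookup p m) :: 'b) (\<kappa> m))"
  have "poly f t = 0" for t
  proof -
    have "poly f t = (\<Sum>m\<in>K. of_rat (Poly_Mapping.lookup p m) * mono_eval m (\<lambda>k. t ^ (B ^ k)))"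
      unfolding f_def poly_sum
    proof (intro sum.cong refl)
      fix m assume "m \<in> K"
      hence "mono_eval m (\<lambda>k. t ^ (B ^ k)) = (\<Prod>k<n. (t ^ (B ^ k)) ^ Poly_Mapping.lookup m k)"
        by (intro mono_eval_superset) (use n in auto)
      also have "\<dots> = t ^ \<kappa> m"
        by (simp add: \<kappa>_def power_sum power_mult [symmetric] mult.commute)
      finally show "poly (monom (of_rat (Poly_Mapping.lookup p m)) (\<kappa> m)) t =
          of_rat (Poly_Mapping.lookup p m) * mono_eval m (\<lambda>k. t ^ (B ^ k))"
        by (simp add: poly_monom)
    qed
    also have "\<dots> = 0"
      using assms[of "\<lambda>k. t ^ (B ^ k)"] by (simp add: mp_eval_conv poly_hom_def K_def)
    finally show ?thesis .
  qed
  hence "f = 0"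
    using poly_all_0_iff_0 by blast
  moreover have "coeff f (\<kappa> m0) = of_rat (Poly_Mapping.lookup p m0)"
  proof -
    have "m0 \<in> K" using m0 by (simp add: K_def in_keys_iff)
    have "coeff f (\<kappa> m0) = (\<Sum>m\<in>K. if m = m0 then of_rat (Poly_Mapping.lookup p m) else 0)"
      unfolding f_def coeff_sum by (intro sum.cong) (use inj \<open>m0 \<in> K\<close> in auto)
    thus ?thesis using \<open>m0 \<in> K\<close> fin by simp
  qed
  ultimately show False using m0 by simp
qed

lemma mp_eval_inject:
  assumes "\<And>x :: nat \<Rightarrow> 'b::field_char_0. mp_eval p x = mp_eval q x"
  shows "p = q"
  using mp_eval_eq_0_imp_eq_0[of "p - q"] assms by (metis eq_iff_diff_eq_0 mp_eval_hom(9))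

section \<open>Constant term and linear coefficients\<close>

definition c0 :: "mpoly \<Rightarrow> rat" where
  "c0 p = Poly_Mapping.lookup p 0"

definition lin :: "nat \<Rightarrow> mpoly \<Rightarrow> rat" where
  "lin k p = Poly_Mapping.lookup p (Poly_Mapping.single k 1)"

text \<open>Presents the constant term as the value at the origin, so that multiplicativity of
  \<open>c0\<close> is inherited from evaluation.\<close>

lemma c0_mp_eval: "mp_eval p (\<lambda>_. 0 :: 'b::field_char_0) = of_rat (c0 p)"
proof -
  have *: "mono_eval m (\<lambda>_. 0 :: 'b) = (if m = 0 then 1 else 0)" for m
  proof (cases "m = 0")
    case False
    then obtain k where "Poly_Mapping.lookup m k \<noteq> 0"
      by (metis lookup_zero poly_mapping_eqI)
    thus ?thesis using False unfolding mono_eval_def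
      by (auto simp: in_keys_iff intro!: bexI[of _ k])
  qed simp
  show ?thesis
    by (simp add: * mp_eval_conv poly_hom_def c0_def if_distrib [of "\<lambda>y. _ * y"] in_keys_iff cong: if_cong)
qed

lemma c0_add [simp]: "c0 (p + q) = c0 p + c0 q"
  by (simp add: c0_def lookup_add)
lemma c0_uminus [simp]: "c0 (- p) = - c0 p"
  by (simp add: c0_def)
lemma c0_diff [simp]: "c0 (p - q) = c0 p - c0 q"
  by (simp add: c0_def lookup_minus)
lemma c0_0 [simp]: "c0 0 = 0"
  by (simp add: c0_def)
lemma c0_1 [simp]: "c0 1 = 1"
  by (simp add: c0_def)
lemma c0_const [simp]: "c0 (mp_const r) = r"
  by (simp add: c0_def mp_const_def)
lemma c0_sum [simp]: "c0 (sum f I) = (\<Sum>i\<in>I. c0 (f i))"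
  by (simp add: c0_def lookup_sum)
lemma c0_mult [simp]: "c0 (p * q) = c0 p * c0 q"
proof -
  have "(of_rat (c0 (p * q)) :: real) = of_rat (c0 p) * of_rat (c0 q)"
    unfolding c0_mp_eval [symmetric] by simp
  thus ?thesis by (simp add: of_rat_mult [symmetric])
qed
lemma c0_power [simp]: "c0 (p ^ n) = c0 p ^ n"
  by (induction n) auto
lemma c0_prod [simp]: "c0 (prod f I) = (\<Prod>i\<in>I. c0 (f i))"
  by (induction I rule: infinite_finite_induct) auto
lemma c0_of_nat [simp]: "c0 (of_nat n) = of_nat n"
  by (induction n) auto
lemma c0_numeral [simp]: "c0 (numeral n) = numeral n"
  using c0_of_nat[of "numeral n"] by simp

lemma lin_add [simp]: "lin k (p + q) = lin k p + lin k q"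
  by (simp add: lin_def lookup_add)
lemma lin_uminus [simp]: "lin k (- p) = - lin k p"
  by (simp add: lin_def)
lemma lin_diff [simp]: "lin k (p - q) = lin k p - lin k q"
  by (simp add: lin_def lookup_minus)
lemma lin_0 [simp]: "lin k 0 = 0"
  by (simp add: lin_def)
lemma lin_sum [simp]: "lin k (sum f I) = (\<Sum>i\<in>I. lin k (f i))"
  by (simp add: lin_def lookup_sum)
lemma single_Suc_0_neq_0 [simp]: "Poly_Mapping.single k (Suc 0) \<noteq> 0" "0 \<noteq> Poly_Mapping.single k (Suc 0)"
  by (metis lookup_single_eq lookup_zero nat.distinct(1))+
lemma single_Suc_0_eq_iff [simp]: "Poly_Mapping.single k (Suc 0) = Poly_Mapping.single l (Suc 0) \<longleftrightarrow> k = l"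
  by (metis lookup_single_eq lookup_single_not_eq nat.distinct(1))
lemma c0_Var [simp]: "c0 (Var k) = 0"
  by (simp add: c0_def Var_def lookup_single)
lemma lin_const [simp]: "lin k (mp_const r) = 0"
  by (simp add: lin_def mp_const_def lookup_single)
lemma lin_1 [simp]: "lin k 1 = 0"
  using lin_const[of k 1] by (simp add: mp_const_1)
lemma lin_Var [simp]: "lin k (Var l) = (if k = l then 1 else 0)"
  by (auto simp: lin_def Var_def lookup_single when_def)

text \<open>\<open>lin k\<close> is a derivation at the origin: a product of two monomials has a
  unit exponent vector only if one of the factors is constant.\<close>

lemma lin_mult [simp]: "lin k (p * q) = c0 p * lin k q + lin k p * c0 q"
proof -
  have single_case: "lin k (Poly_Mapping.single a c * Poly_Mapping.single b d) =
     c0 (Poly_Mapping.single a c) * lin k (Poly_Mapping.single b d) +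
     lin k (Poly_Mapping.single a c) * c0 (Poly_Mapping.single b d)" for a b c d
  proof -
    let ?s = "Poly_Mapping.single k (1::nat)"
    have "a + b = ?s \<longleftrightarrow> (a = 0 \<and> b = ?s) \<or> (a = ?s \<and> b = 0)"
    proof
      assume ab: "a + b = ?s"
      have l: "Poly_Mapping.lookup a i + Poly_Mapping.lookup b i = (if i = k then 1 else 0)" for i
        using arg_cong[OF ab, of "\<lambda>x. Poly_Mapping.lookup x i"]
        by (auto simp: lookup_add lookup_single when_def)
      consider "Poly_Mapping.lookup a k = 0" | "Poly_Mapping.lookup b k = 0"
        using l[of k] by (auto simp: add_eq_if split: if_splits)
      thus "(a = 0 \<and> b = ?s) \<or> (a = ?s \<and> b = 0)"
      proof cases
        case 1
        have "a = 0" by (rule poly_mapping_eqI) (use l 1 in \<open>auto split: if_splits; metis add_eq_0_iff_both_eq_0\<close>)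
        thus ?thesis using ab by simp
      next
        case 2
        have "b = 0" by (rule poly_mapping_eqI) (use l 2 in \<open>auto split: if_splits; metis add_eq_0_iff_both_eq_0\<close>)
        thus ?thesis using ab by simp
      qed
    qed auto
    thus ?thesis
      by (auto simp: mult_single lin_def c0_def lookup_single when_def)
  qed
  have "p * q = (\<Sum>m\<in>Poly_Mapping.keys p. \<Sum>m'\<in>Poly_Mapping.keys q.
      Poly_Mapping.single m (Poly_Mapping.lookup p m) * Poly_Mapping.single m' (Poly_Mapping.lookup q m'))"
    by (subst poly_mapping_sum_single[of p], subst poly_mapping_sum_single[of q])
       (simp add: sum_product)
  hence "lin k (p * q) = 
     (\<Sum>m\<in>Poly_Mapping.keys p. c0 (Poly_Mapping.single m (Poly_Mapping.lookup p m))) * 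
     (\<Sum>m'\<in>Poly_Mapping.keys q. lin k (Poly_Mapping.single m' (Poly_Mapping.lookup q m'))) +
     (\<Sum>m\<in>Poly_Mapping.keys p. lin k (Poly_Mapping.single m (Poly_Mapping.lookup p m))) * 
     (\<Sum>m'\<in>Poly_Mapping.keys q. c0 (Poly_Mapping.single m' (Poly_Mapping.lookup q m')))"
    by (simp add: single_case sum.distrib sum_product)
  thus ?thesis
    by (simp only: c0_sum [symmetric] lin_sum [symmetric] poly_mapping_sum_single [symmetric])
qed

lemma lin_of_nat [simp]: "lin k (of_nat n) = 0"
  by (induction n) auto
lemma lin_numeral [simp]: "lin k (numeral n) = 0"
  using lin_of_nat[of k "numeral n"] by simp

lemma mono_split:
  assumes "m \<noteq> (0 :: nat \<Rightarrow>\<^sub>0 nat)"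
  obtains k m' where "m = Poly_Mapping.single k 1 + m'"
proof -
  obtain k where k: "Poly_Mapping.lookup m k \<noteq> 0"
    using assms by (metis lookup_zero poly_mapping_eqI)
  have "m = Poly_Mapping.single k 1 + (m - Poly_Mapping.single k 1)"
    by (rule poly_mapping_eqI) (use k in \<open>auto simp: lookup_add lookup_minus lookup_single when_def\<close>)
  thus ?thesis by (rule that)
qed

context
  fixes \<sigma> :: "nat \<Rightarrow> mpoly"
  assumes c0_\<sigma>: "\<And>k. c0 (\<sigma> k) = 0"
begin

lemma c0_mono_eval: "c0 (mono_eval m \<sigma>) = (if m = 0 then 1 else 0)"
proof (cases "m = 0")
  case False
  then obtain k m' where "m = Poly_Mapping.single k 1 + m'" by (rule mono_split)
  thus ?thesis using False c0_\<sigma> by (simp add: mono_eval_add mono_eval_single)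
qed simp

lemma c0_subst: "c0 (mp_subst p \<sigma>) = c0 p"
proof -
  have "c0 (mp_subst p \<sigma>) = (\<Sum>m\<in>Poly_Mapping.keys p. if m = 0 then Poly_Mapping.lookup p m else 0)"
    unfolding mp_subst_conv poly_hom_def by (simp add: c0_mono_eval if_distrib [of "\<lambda>y. _ * y"] cong: if_cong)
  thus ?thesis by (auto simp: c0_def in_keys_iff)
qed

text \<open>Chain rule at the origin: as no \<open>\<sigma> k\<close> has a constant term, monomials
  of degree at least 2 contribute nothing of degree 1.\<close>

lemma lin_subst:
  assumes "finite K" "mp_vars p \<subseteq> K"
  shows "lin l (mp_subst p \<sigma>) = (\<Sum>k\<in>K. lin k p * lin l (\<sigma> k))"
proof -
  have mono: "lin l (mono_eval m \<sigma>) = (\<Sum>k\<in>K. if m = Poly_Mapping.single k 1 then lin l (\<sigma> k) else 0)"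
    if "Poly_Mapping.keys m \<subseteq> K" for m
  proof (cases "m = 0")
    case True
    hence "m \<noteq> Poly_Mapping.single k 1" for k by simp
    thus ?thesis using True by simp
  next
    case False
    then obtain k m' where m: "m = Poly_Mapping.single k 1 + m'" by (rule mono_split)
    have kK: "k \<in> K"
      using that m by (auto simp: in_keys_iff lookup_add)
    have *: "lin l (mono_eval m \<sigma>) = (if m' = 0 then lin l (\<sigma> k) else 0)"
      by (simp add: m mono_eval_add mono_eval_single c0_\<sigma> c0_mono_eval)
    show ?thesis
    proof (cases "m' = 0")
      case True
      have "m = Poly_Mapping.single k' 1 \<longleftrightarrow> k' = k" for k'
        using m True by auto
      thus ?thesis using * True kK assms(1) by simp
    next
      case m': False
      have "m \<noteq> Poly_Mapping.single k' 1" for k'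
      proof
        assume eq: "m = Poly_Mapping.single k' 1"
        obtain i where "Poly_Mapping.lookup m' i \<noteq> 0"
          using m' by (metis lookup_zero poly_mapping_eqI)
        thus False
          using arg_cong[OF eq, of "\<lambda>x. Poly_Mapping.lookup x i"] arg_cong[OF eq, of "\<lambda>x. Poly_Mapping.lookup x k"]
          unfolding m by (auto simp: lookup_add lookup_single when_def split: if_splits)
      qed
      thus ?thesis using * m' by simp
    qed
  qed
  have "lin l (mp_subst p \<sigma>) = (\<Sum>m\<in>Poly_Mapping.keys p. Poly_Mapping.lookup p m * 
      (\<Sum>k\<in>K. if m = Poly_Mapping.single k 1 then lin l (\<sigma> k) else 0))"
    unfolding mp_subst_conv poly_hom_def lin_sum lin_mult
  proof (intro sum.cong refl)
    fix m assume "m \<in> Poly_Mapping.keys p"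
    hence "Poly_Mapping.keys m \<subseteq> K" using assms(2) mp_varsI by blast
    from mono[OF this] show "c0 (mp_const (Poly_Mapping.lookup p m)) * lin l (mono_eval m \<sigma>) +
         lin l (mp_const (Poly_Mapping.lookup p m)) * c0 (mono_eval m \<sigma>) =
       Poly_Mapping.lookup p m * (\<Sum>k\<in>K. if m = Poly_Mapping.single k 1 then lin l (\<sigma> k) else 0)"
      by simp
  qed
  also have "\<dots> = (\<Sum>k\<in>K. \<Sum>m\<in>Poly_Mapping.keys p. if m = Poly_Mapping.single k 1 then Poly_Mapping.lookup p m * lin l (\<sigma> k) else 0)"
    by (subst sum.swap) (auto simp: sum_distrib_left intro!: sum.cong)
  also have "\<dots> = (\<Sum>k\<in>K. lin k p * lin l (\<sigma> k))"
    by (intro sum.cong refl) (auto simp: lin_def in_keys_iff)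
  finally show ?thesis .
qed

end


section \<open>The derivation D and the Euler operator\<close>

definition mono_D :: "(nat \<Rightarrow>\<^sub>0 nat) \<Rightarrow> mpoly" where
  "mono_D m = (\<Sum>k\<in>Poly_Mapping.keys m. of_nat (Poly_Mapping.lookup m k) *
         (\<Prod>l\<in>Poly_Mapping.keys m. Var l ^ (Poly_Mapping.lookup m l - (if l = k then 1 else 0)))
         * Var (Suc k))"

lemma mp_D_conv: "mp_D p = (\<Sum>m\<in>Poly_Mapping.keys p. mp_const (Poly_Mapping.lookup p m) * mono_D m)"
  by (simp add: mp_D_def mono_D_def)

text \<open>The division by \<open>x\<close> encodes the Euler operator x d/dx: if it sends each
  \<open>f k\<close> to \<open>f (Suc k)\<close>, then it acts on polynomials in the
  \<open>f k\<close> as \<open>mp_D\<close>.\<close>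

lemma mp_eval_D:
  fixes f :: "nat \<Rightarrow> real \<Rightarrow> real"
  assumes "\<And>k. k \<in> mp_vars p \<Longrightarrow> (f k has_real_derivative f (Suc k) x / x) (at x)" "x \<noteq> 0"
  shows "((\<lambda>x. mp_eval p (\<lambda>k. f k x)) has_real_derivative mp_eval (mp_D p) (\<lambda>k. f k x) / x) (at x)"
proof -
  have mono: "((\<lambda>x. mono_eval m (\<lambda>k. f k x)) has_real_derivative mp_eval (mono_D m) (\<lambda>k. f k x) / x) (at x)"
    if m: "m \<in> Poly_Mapping.keys p" for m
  proof -
    let ?K = "Poly_Mapping.keys m"
    have "((\<lambda>x. mono_eval m (\<lambda>k. f k x)) has_real_derivative
        (\<Sum>k\<in>?K. (of_nat (Poly_Mapping.lookup m k) * ((f (Suc k) x / x) * f k x ^ (Poly_Mapping.lookup m k - Suc 0))) * 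
          (\<Prod>l\<in>?K - {k}. f l x ^ Poly_Mapping.lookup m l))) (at x)"
      unfolding mono_eval_def
      by (rule has_field_derivative_prod, rule DERIV_power, rule assms(1)) (use m mp_varsI in auto)
    also have "(\<Sum>k\<in>?K. (of_nat (Poly_Mapping.lookup m k) * ((f (Suc k) x / x) * f k x ^ (Poly_Mapping.lookup m k - Suc 0))) * 
          (\<Prod>l\<in>?K - {k}. f l x ^ Poly_Mapping.lookup m l)) = mp_eval (mono_D m) (\<lambda>k. f k x) / x"
      unfolding mono_D_def mp_eval_hom sum_divide_distrib
    proof (intro sum.cong refl)
      fix k assume k: "k \<in> ?K"
      show "of_nat (Poly_Mapping.lookup m k) * ((f (Suc k) x / x) * f k x ^ (Poly_Mapping.lookup m k - Suc 0)) * 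
          (\<Prod>l\<in>?K - {k}. f l x ^ Poly_Mapping.lookup m l) =
          of_nat (Poly_Mapping.lookup m k) * (\<Prod>l\<in>?K. f l x ^ (Poly_Mapping.lookup m l - (if l = k then 1 else 0))) * f (Suc k) x / x"
      proof -
        have "(\<Prod>l\<in>?K - {k}. f l x ^ Poly_Mapping.lookup m l) =
            (\<Prod>l\<in>?K - {k}. f l x ^ (Poly_Mapping.lookup m l - (if l = k then 1 else 0)))"
          by (intro prod.cong) auto
        thus ?thesis by (simp add: prod.remove[OF finite_keys k])
      qed
    qed
    finally show ?thesis .
  qed
  have "((\<lambda>x. \<Sum>m\<in>Poly_Mapping.keys p. of_rat (Poly_Mapping.lookup p m) * mono_eval m (\<lambda>k. f k x)) has_real_derivative
      (\<Sum>m\<in>Poly_Mapping.keys p. of_rat (Poly_Mapping.lookup p m) * (mp_eval (mono_D m) (\<lambda>k. f k x) / x))) (at x)"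
    by (intro DERIV_sum DERIV_cmult mono)
  moreover have "mp_eval (mp_D p) (\<lambda>k. f k x) / x =
      (\<Sum>m\<in>Poly_Mapping.keys p. of_rat (Poly_Mapping.lookup p m) * (mp_eval (mono_D m) (\<lambda>k. f k x) / x))"
    unfolding mp_D_conv mp_eval_hom sum_divide_distrib by simp
  ultimately show ?thesis
    unfolding mp_eval_conv[of p] poly_hom_def by simp
qed

lemma c0_D [simp]: "c0 (mp_D p) = 0"
  unfolding mp_D_conv mono_D_def c0_sum c0_mult c0_Var by simp

text \<open>On linear parts the derivation is a shift of variables: it kills constants and preserves
  the degree of every other monomial.\<close>

lemma lin_D: "lin l (mp_D p) = (case l of 0 \<Rightarrow> 0 | Suc k \<Rightarrow> lin k p)"
proof -
  have mono: "lin l (mono_D m) = (case l of 0 \<Rightarrow> 0 | Suc k \<Rightarrow> if m = Poly_Mapping.single k 1 then 1 else 0)" for m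
  proof -
    have *: "of_nat (Poly_Mapping.lookup m k) * (\<Prod>i\<in>Poly_Mapping.keys m. (0::rat) ^ (Poly_Mapping.lookup m i - (if i = k then 1 else 0)))
       = (if m = Poly_Mapping.single k 1 then 1 else 0)" if k: "k \<in> Poly_Mapping.keys m" for k
    proof (cases "m = Poly_Mapping.single k 1")
      case False
      have "\<exists>i\<in>Poly_Mapping.keys m. Poly_Mapping.lookup m i - (if i = k then 1 else 0) \<noteq> 0"
      proof (rule ccontr)
        assume *: "\<not> ?thesis"
        have "m = Poly_Mapping.single k 1"
        proof (rule poly_mapping_eqI)
          fix i
          show "Poly_Mapping.lookup m i = Poly_Mapping.lookup (Poly_Mapping.single k 1) i"
          proof (cases "i \<in> Poly_Mapping.keys m")
            case True
            hence "Poly_Mapping.lookup m i - (if i = k then 1 else 0) = 0" "Poly_Mapping.lookup m i \<noteq> 0"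
              using * by (auto simp: in_keys_iff)
            thus ?thesis by (auto simp: lookup_single when_def split: if_splits)
          next
            case False
            thus ?thesis using k by (auto simp: in_keys_iff lookup_single when_def)
          qed
        qed
        thus False using False by simp
      qed
      then obtain i where "i \<in> Poly_Mapping.keys m" "Poly_Mapping.lookup m i - (if i = k then 1 else 0) \<noteq> 0" by blast
      hence "(\<Prod>i\<in>Poly_Mapping.keys m. (0::rat) ^ (Poly_Mapping.lookup m i - (if i = k then 1 else 0))) = 0"
        by (intro prod_zero) (auto intro!: bexI[of _ i])
      thus ?thesis using False by simp
    qed simp
    have "lin l (mono_D m) = (\<Sum>k\<in>Poly_Mapping.keys m. if l = Suc k then (if m = Poly_Mapping.single k 1 then 1 else 0) else 0)"
      unfolding mono_D_def lin_sum
    proof (intro sum.cong refl)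
      fix k assume "k \<in> Poly_Mapping.keys m"
      from *[OF this] show "lin l (of_nat (Poly_Mapping.lookup m k) *
          (\<Prod>l\<in>Poly_Mapping.keys m. Var l ^ (Poly_Mapping.lookup m l - (if l = k then 1 else 0))) * Var (Suc k)) = 
          (if l = Suc k then (if m = Poly_Mapping.single k 1 then 1 else 0) else 0)"
        by simp
    qed
    thus ?thesis
      by (cases l) (auto simp: in_keys_iff)
  qed
  have "lin l (mp_D p) = (\<Sum>m\<in>Poly_Mapping.keys p. Poly_Mapping.lookup p m *
      (case l of 0 \<Rightarrow> 0 | Suc k \<Rightarrow> if m = Poly_Mapping.single k 1 then 1 else 0))"
    by (simp add: mp_D_conv mono)
  thus ?thesis
    by (cases l) (auto simp: lin_def[of _ p] in_keys_iff if_distrib [of "\<lambda>y. _ * y"] cong: if_cong)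
qed

section \<open>Power sums, Bernoulli numbers and Newton identities\<close>


lemma poly_eq_if_eq_on_nat:
  fixes p q :: "real poly"
  assumes "\<And>n. n \<ge> n0 \<Longrightarrow> poly p (of_nat n) = poly q (of_nat n)"
  shows "p = q"
proof (rule ccontr)
  assume "p \<noteq> q"
  hence "finite {x. poly (p - q) x = 0}"
    using poly_roots_finite[of "p - q"] by simp
  moreover have "of_nat ` {n0..} \<subseteq> {x. poly (p - q) x = 0}"
    using assms by auto
  ultimately have "finite (of_nat ` {n0..} :: real set)"
    using finite_subset by blast
  thus False
    using finite_imageD[of "of_nat :: nat \<Rightarrow> real" "{n0..}"] infinite_Ici[of n0] by (simp add: inj_on_def)
qed

text \<open>The polynomial with value 0^m + ... + (j - 1)^m at j. Its recursion is the telescoped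
  binomial expansion of (z + 1)^(m+1) - z^(m+1) and has the same shape as that of
  \<open>bernoulli\<close>.\<close>

fun power_sum_poly :: "nat \<Rightarrow> real poly" where
  "power_sum_poly m = smult (1 / of_nat (Suc m))
     (monom 1 (Suc m) - (\<Sum>k<m. smult (of_nat (Suc m choose k)) (power_sum_poly k)))"

declare power_sum_poly.simps [simp del]

lemma power_sum_poly_rec:
  "smult (of_nat (Suc m)) (power_sum_poly m) = monom 1 (Suc m) - (\<Sum>k<m. smult (of_nat (Suc m choose k)) (power_sum_poly k))"
  by (subst power_sum_poly.simps) simp

lemma poly_power_sum_poly_rec:
  "of_nat (Suc m) * poly (power_sum_poly m) z = z ^ Suc m - (\<Sum>k<m. of_nat (Suc m choose k) * poly (power_sum_poly k) z)"
  using arg_cong[OF power_sum_poly_rec[of m], of "\<lambda>p. poly p z"] by (simp add: poly_monom poly_sum)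

lemma power_sum_poly_diff: "poly (power_sum_poly m) (z + 1) - poly (power_sum_poly m) z = z ^ m"
proof (induction m rule: less_induct)
  case (less m)
  have "of_nat (Suc m) * (poly (power_sum_poly m) (z + 1) - poly (power_sum_poly m) z) =
     (z + 1) ^ Suc m - z ^ Suc m - (\<Sum>k<m. of_nat (Suc m choose k) * (poly (power_sum_poly k) (z + 1) - poly (power_sum_poly k) z))"
    unfolding right_diff_distrib poly_power_sum_poly_rec sum_subtractf by simp
  also have "(\<Sum>k<m. of_nat (Suc m choose k) * (poly (power_sum_poly k) (z + 1) - poly (power_sum_poly k) z)) =
     (\<Sum>k<m. of_nat (Suc m choose k) * z ^ k)"
    using less by (intro sum.cong) auto
  also have "(z + 1) ^ Suc m = (\<Sum>k\<le>Suc m. of_nat (Suc m choose k) * z ^ k)"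
    by (subst binomial_ring) simp
  also have "{..Suc m} = insert (Suc m) (insert m {..<m})" by auto
  also have "(\<Sum>k\<in>\<dots>. of_nat (Suc m choose k) * z ^ k) = z ^ Suc m + of_nat (Suc m) * z ^ m + (\<Sum>k<m. of_nat (Suc m choose k) * z ^ k)"
    by simp
  finally have "of_nat (Suc m) * (poly (power_sum_poly m) (z + 1) - poly (power_sum_poly m) z) = of_nat (Suc m) * z ^ m"
    by simp
  thus ?case
    by (metis mult_cancel_left of_nat_neq_0)
qed

lemma poly_power_sum_poly_0 [simp]: "poly (power_sum_poly m) 0 = 0"
proof (induction m rule: less_induct)
  case (less m)
  have "of_nat (Suc m) * poly (power_sum_poly m) 0 = 0"
    by (subst poly_power_sum_poly_rec) (use less in simp)
  thus ?case by (metis mult_eq_0_iff of_nat_neq_0)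
qed

lemma poly_power_sum_poly_of_nat: "poly (power_sum_poly m) (of_nat j) = (\<Sum>i<j. of_nat i ^ m)"
proof (induction j)
  case (Suc j)
  thus ?case using power_sum_poly_diff[of m "of_nat j"] by (simp add: add.commute)
qed simp

lemma poly_power_sum_poly_neg: "poly (power_sum_poly m) (- of_nat j) = - (\<Sum>i=1..j. (- of_nat i) ^ m)"
proof (induction j)
  case (Suc j)
  thus ?case using power_sum_poly_diff[of m "- of_nat (Suc j)"] by simp
qed simp

text \<open>At a positive integer j the argument 1 - j is reached by running the difference equation
  backwards from 0. For m \<ge> 1 the term l = 0 vanishes, so both sides involve the same
  powers.\<close>

lemma power_sum_poly_reflect:
  assumes "m \<ge> 1"
  shows "pcompose (power_sum_poly m) [:1, -1:] = smult ((-1) ^ Suc m) (power_sum_poly m)"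
proof (rule poly_eq_if_eq_on_nat)
  fix j :: nat assume "j \<ge> 1"
  then obtain i where j: "j = Suc i" by (cases j) auto
  have "poly (power_sum_poly m) (- of_nat i) = (-1) ^ Suc m * (\<Sum>l=1..i. of_nat l ^ m)"
    unfolding poly_power_sum_poly_neg by (subst power_minus) (simp add: sum_distrib_left sum_negf)
  also have "(\<Sum>l=1..i. of_nat l ^ m) = (\<Sum>l<Suc i. of_nat l ^ m :: real)"
    using assms by (intro sum.mono_neutral_left) auto
  finally show "poly (pcompose (power_sum_poly m) [:1, - 1:]) (of_nat j) = poly (smult ((-1) ^ Suc m) (power_sum_poly m)) (of_nat j)"
    unfolding j by (simp only: poly_power_sum_poly_of_nat [symmetric]) (simp add: poly_pcompose algebra_simps)
qed

lemma pderiv_sum: "pderiv (sum f I) = (\<Sum>i\<in>I. pderiv (f i))"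
  by (induction I rule: infinite_finite_induct) (auto simp: pderiv_add)

text \<open>Differentiation at 0 turns the recursion of \<open>power_sum_poly\<close> into that of
  \<open>bernoulli\<close>; the monomial survives only for m = 0.\<close>

lemma pderiv_power_sum_poly_0: "poly (pderiv (power_sum_poly m)) 0 = of_rat (bernoulli m)"
proof (induction m rule: less_induct)
  case (less m)
  have "of_nat (Suc m) * poly (pderiv (power_sum_poly m)) 0 = poly (pderiv (smult (of_nat (Suc m)) (power_sum_poly m))) 0"
    by (simp add: pderiv_smult)
  also have "\<dots> = (if m = 0 then 1 else 0) - (\<Sum>k<m. of_nat (Suc m choose k) * poly (pderiv (power_sum_poly k)) 0)"
    unfolding power_sum_poly_rec
    by (simp add: pderiv_diff pderiv_monom poly_monom pderiv_sum poly_sum pderiv_smult)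
  also have "(\<Sum>k<m. of_nat (Suc m choose k) * poly (pderiv (power_sum_poly k)) 0) = (\<Sum>k<m. of_nat (Suc m choose k) * of_rat (bernoulli k))"
    using less by (intro sum.cong) auto
  finally have *: "of_nat (Suc m) * poly (pderiv (power_sum_poly m)) 0 = (if m = 0 then 1 else 0) - (\<Sum>k<m. of_nat (Suc m choose k) * (of_rat (bernoulli k) :: real))" .
  show ?case
  proof (cases m)
    case 0
    thus ?thesis using * by simp
  next
    case (Suc n)
    have "of_nat (Suc m) * poly (pderiv (power_sum_poly m)) 0 = of_nat (Suc m) * (of_rat (bernoulli m) :: real)"
      unfolding * by (simp add: Suc of_rat_mult of_rat_sum of_rat_divide of_rat_minus of_rat_add lessThan_Suc_atMost del: binomial_Suc_Suc)
    thus ?thesis by (metis mult_cancel_left of_nat_neq_0)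
  qed
qed

lemma power_sum_poly_shift: "pcompose (power_sum_poly m) [:1, 1:] - power_sum_poly m = monom 1 m"
  by (rule poly_eq_if_eq_on_nat[of 0])
     (use power_sum_poly_diff in \<open>simp add: poly_pcompose poly_monom add.commute[of 1]\<close>)

lemma pderiv_power_sum_poly_shift:
  "pcompose (pderiv (power_sum_poly m)) [:1, 1:] - pderiv (power_sum_poly m) = pderiv (monom 1 m)"
  unfolding power_sum_poly_shift [symmetric]
  by (simp add: pderiv_diff pderiv_pcompose pderiv_pCons)

lemma pderiv_power_sum_poly_1:
  "poly (pderiv (power_sum_poly m)) 1 = of_rat (bernoulli m) + (if m = 1 then 1 else 0)"
  using arg_cong[OF pderiv_power_sum_poly_shift[of m], of "\<lambda>p. poly p 0"]
  by (cases "m = 0") (auto simp: poly_pcompose pderiv_monom poly_monom pderiv_power_sum_poly_0 power_0_left le_Suc_eq)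

lemma pderiv2_power_sum_poly:
  assumes "m \<ge> 3"
  shows "poly (pderiv (pderiv (power_sum_poly m))) 1 = poly (pderiv (pderiv (power_sum_poly m))) 0"
proof -
  have "pcompose (pderiv (pderiv (power_sum_poly m))) [:1, 1:] - pderiv (pderiv (power_sum_poly m)) = pderiv (pderiv (monom 1 m))"
    unfolding pderiv_power_sum_poly_shift [symmetric]
    by (simp add: pderiv_diff pderiv_pcompose pderiv_pCons)
  from arg_cong[OF this, of "\<lambda>p. poly p 0"] show ?thesis
    using assms by (simp add: poly_pcompose pderiv_monom poly_monom power_0_left)
qed

lemma poly_power_sum_poly_1: "m \<ge> 1 \<Longrightarrow> poly (power_sum_poly m) 1 = 0"
  using poly_power_sum_poly_of_nat[of m 1] by simp

text \<open>The differentiated reflection says that the derivatives at 0 and 1 are opposite, the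
  difference equation that they are equal once m is not 1.\<close>

lemma bernoulli_odd_eq_0:
  assumes "odd m" "m \<ge> 3"
  shows "bernoulli m = 0"
proof -
  have "- pcompose (pderiv (power_sum_poly m)) [:1, -1:] = pderiv (power_sum_poly m)"
    using arg_cong[OF power_sum_poly_reflect[of m], of pderiv] assms
    by (simp add: pderiv_pcompose pderiv_pCons)
  from arg_cong[OF this, of "\<lambda>p. poly p 0"] have "(of_rat (bernoulli m) :: real) = 0"
    using assms by (simp add: poly_pcompose pderiv_power_sum_poly_0 pderiv_power_sum_poly_1)
  thus ?thesis by simp
qed

section \<open>Coefficients of the product of 1 / (1 + i x) as polynomials in j\<close>

text \<open>At j this is the complete homogeneous symmetric polynomial of degree n in 0, -1, ..., 1
  - j. Taking Newton's recursion as the definition makes it a polynomial in j, which can be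
  evaluated at 1 - j and differentiated.\<close>

fun rising_poly :: "nat \<Rightarrow> real poly" where
  "rising_poly 0 = 1"
| "rising_poly (Suc n) = smult (1 / of_nat (Suc n))
     (\<Sum>k\<le>n. smult ((-1) ^ Suc k) (power_sum_poly (Suc k) * rising_poly (n - k)))"

declare rising_poly.simps(2) [simp del]

lemma rising_poly_rec:
  "smult (of_nat (Suc n)) (rising_poly (Suc n)) = (\<Sum>k\<le>n. smult ((-1) ^ Suc k) (power_sum_poly (Suc k) * rising_poly (n - k)))"
  by (subst rising_poly.simps) simp

text \<open>Newton's identities for the complete homogeneous symmetric functions, in the form of a
  logarithmic derivative.\<close>
lemma rising_poly_fps_nth:
  fixes F T :: "real fps"
  assumes "fps_nth F 0 = 1" "fps_deriv F = F * T"
    and T: "\<And>k. fps_nth T k = (-1) ^ Suc k * poly (power_sum_poly (Suc k)) z"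
  shows "fps_nth F n = poly (rising_poly n) z"
proof (induction n rule: less_induct)
  case (less n)
  show ?case
  proof (cases n)
    case (Suc m)
    have "of_nat (Suc m) * fps_nth F (Suc m) = fps_nth (fps_deriv F) m" by simp
    also have "\<dots> = fps_nth (T * F) m" using assms(2) by (simp add: mult.commute)
    also have "\<dots> = (\<Sum>k\<le>m. (-1) ^ Suc k * poly (power_sum_poly (Suc k)) z * poly (rising_poly (m - k)) z)"
      unfolding fps_mult_nth using less Suc by (simp add: T atMost_atLeast0)
    also have "\<dots> = of_nat (Suc m) * poly (rising_poly (Suc m)) z"
      using arg_cong[OF rising_poly_rec[of m], of "\<lambda>p. poly p z"] by (simp add: poly_sum mult.assoc)
    finally show ?thesis
      unfolding Suc by (metis mult_cancel_left of_nat_neq_0)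
  qed (use assms in simp)
qed

lemma inverse_linear_fps: "inverse (1 + fps_const c * fps_X) = Abs_fps (\<lambda>k. (- c :: real) ^ k)"
proof -
  let ?A = "Abs_fps (\<lambda>k. (- c :: real) ^ k)"
  have "?A * (1 + fps_const c * fps_X) = ?A + fps_const c * (?A * fps_X)"
    by (simp add: algebra_simps)
  also have "\<dots> = 1"
  proof (rule fps_ext)
    fix n
    show "fps_nth (?A + fps_const c * (?A * fps_X)) n = fps_nth 1 n"
      by (cases n) simp_all
  qed
  finally have "?A * (1 + fps_const c * fps_X) = 1" .
  thus ?thesis by (metis fps_inverse_unique mult.commute)
qed

lemma fps_deriv_inverse_linear:
  "fps_deriv (inverse (1 + fps_const c * fps_X)) =
     inverse (1 + fps_const c * fps_X) * Abs_fps (\<lambda>k. (- c :: real) ^ Suc k)"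
proof (rule fps_ext)
  fix n
  have "(\<Sum>i=0..n. (- c) ^ i * (- c) ^ Suc (n - i)) = (\<Sum>i=0..n. (- c) ^ Suc n)"
    by (intro sum.cong refl) (simp add: power_add [symmetric] del: power_Suc)
  thus "fps_nth (fps_deriv (inverse (1 + fps_const c * fps_X))) n =
      fps_nth (inverse (1 + fps_const c * fps_X) * Abs_fps (\<lambda>k. (- c) ^ Suc k)) n"
    unfolding inverse_linear_fps by (simp add: fps_mult_nth del: power_Suc)
qed

lemma fps_deriv_linear:
  "fps_deriv (1 + fps_const c * fps_X) = (1 + fps_const c * fps_X) * Abs_fps (\<lambda>k. - ((- c :: real) ^ Suc k))"
proof -
  let ?f = "1 + fps_const c * fps_X :: real fps" and ?A = "Abs_fps (\<lambda>k. (- c :: real) ^ Suc k)"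
  have 1: "?f * inverse ?f = 1" by (intro inverse_mult_eq_1') simp
  have "0 = fps_deriv (?f * inverse ?f)" unfolding 1 by simp
  also have "\<dots> = fps_deriv ?f * inverse ?f + ?f * inverse ?f * ?A"
    unfolding fps_deriv_mult fps_deriv_inverse_linear by (simp add: algebra_simps)
  finally have "fps_deriv ?f * inverse ?f = - ?A" unfolding 1 by (simp add: eq_neg_iff_add_eq_0)
  hence "?f * (fps_deriv ?f * inverse ?f) = ?f * (- ?A)" by (rule arg_cong)
  hence "fps_deriv ?f * (?f * inverse ?f) = ?f * (- ?A)" by (simp only: mult_ac)
  also have "- ?A = Abs_fps (\<lambda>k. - ((- c) ^ Suc k))" by (rule fps_ext) simp
  finally show ?thesis unfolding 1 by simp
qed

lemma fps_deriv_prod_log: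
  assumes "finite I" "\<And>i. i \<in> I \<Longrightarrow> fps_deriv (f i) = f i * (T i :: real fps)"
  shows "fps_deriv (prod f I) = prod f I * sum T I"
  using assms by (induction I rule: finite_induct) (auto simp: algebra_simps)

lemma rising_poly_of_nat:
  "poly (rising_poly n) (of_nat j) = fps_nth (\<Prod>i<j. inverse (1 + fps_const (of_nat i) * fps_X)) n"
proof (rule rising_poly_fps_nth [symmetric])
  show "fps_nth (\<Prod>i<j. inverse (1 + fps_const (real i) * fps_X)) 0 = 1"
    by (induction j) auto
  show "fps_deriv (\<Prod>i<j. inverse (1 + fps_const (real i) * fps_X)) =
      (\<Prod>i<j. inverse (1 + fps_const (real i) * fps_X)) * (\<Sum>i<j. Abs_fps (\<lambda>k. (- real i) ^ Suc k))"
    by (intro fps_deriv_prod_log fps_deriv_inverse_linear) auto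
  show "fps_nth (\<Sum>i<j. Abs_fps (\<lambda>k. (- real i) ^ Suc k)) k = (-1) ^ Suc k * poly (power_sum_poly (Suc k)) (of_nat j)" for k
    unfolding poly_power_sum_poly_of_nat fps_sum_nth
    by (subst power_minus) (simp add: sum_distrib_left)
qed

text \<open>At 1 - j the power sums are minus sums of powers of -i, so the logarithmic derivative is
  that of a product of linear factors instead of inverses. Hence the polynomials that describe
  \<open>G\<close> at j describe \<open>H\<close> at 1 - j.\<close>

lemma rising_poly_1_minus_of_nat:
  assumes "j \<ge> 1"
  shows "poly (rising_poly n) (1 - of_nat j) = fps_nth (\<Prod>i\<in>{1..<j}. (1 + fps_const (- of_nat i) * fps_X)) n"
proof (rule rising_poly_fps_nth [symmetric])
  let ?P = "\<Prod>i\<in>{1..<j}. (1 + fps_const (- real i) * fps_X)"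
  show "fps_nth ?P 0 = 1"
    by (induction rule: dec_induct[OF assms]) (auto simp: atLeastLessThanSuc)
  show "fps_deriv ?P = ?P * (\<Sum>i\<in>{1..<j}. Abs_fps (\<lambda>k. - ((- (- real i)) ^ Suc k)))"
    by (intro fps_deriv_prod_log fps_deriv_linear) auto
  show "fps_nth (\<Sum>i\<in>{1..<j}. Abs_fps (\<lambda>k. - ((- (- real i)) ^ Suc k))) k = (-1) ^ Suc k * poly (power_sum_poly (Suc k)) (1 - of_nat j)" for k
  proof -
    obtain m where m: "j = Suc m" using assms by (cases j) auto
    have "poly (power_sum_poly (Suc k)) (1 - of_nat j) = - (\<Sum>i=1..m. (- of_nat i) ^ Suc k)"
      using poly_power_sum_poly_neg[of "Suc k" m] by (simp add: m)
    also have "(\<Sum>i=1..m. (- real i) ^ Suc k) = (-1) ^ Suc k * (\<Sum>i=1..m. real i ^ Suc k)"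
      by (subst power_minus) (simp add: sum_distrib_left)
    finally have "(-1) ^ Suc k * poly (power_sum_poly (Suc k)) (1 - of_nat j) = - ((-1) ^ Suc k * (-1) ^ Suc k * (\<Sum>i=1..m. real i ^ Suc k))"
      by (simp only: mult.assoc mult_minus_right)
    also have "(-1) ^ Suc k * (-1) ^ Suc k = (1::real)"
      by (simp add: power_mult_distrib [symmetric] del: power_Suc)
    finally show ?thesis
      by (simp add: fps_sum_nth sum_negf m atLeastLessThanSuc_atLeastAtMost)
  qed
qed

section \<open>Derivatives at 0 and 1, the common zeros of the power sums\<close>

context
  fixes z :: real
  assumes z: "\<And>k. k \<ge> 1 \<Longrightarrow> poly (power_sum_poly k) z = 0"
begin

lemma rising_poly_root: "n \<ge> 1 \<Longrightarrow> poly (rising_poly n) z = 0"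
  by (cases n) (simp_all add: rising_poly.simps poly_sum z)

text \<open>In the differentiated recursion every term keeps a vanishing factor except the top one,
  where \<open>rising_poly 0 = 1\<close>.\<close>

lemma pderiv_rising_poly_root:
  assumes "n \<ge> 1"
  shows "of_nat n * poly (pderiv (rising_poly n)) z = (-1) ^ n * poly (pderiv (power_sum_poly n)) z"
proof -
  obtain m where n: "n = Suc m" using assms by (cases n) auto
  have "of_nat n * poly (pderiv (rising_poly n)) z = poly (pderiv (smult (of_nat n) (rising_poly n))) z"
    by (simp add: pderiv_smult)
  also have "\<dots> = (\<Sum>k\<le>m. (-1) ^ Suc k * (poly (pderiv (power_sum_poly (Suc k))) z * poly (rising_poly (m - k)) z))"
    unfolding n rising_poly_rec pderiv_sum pderiv_smult pderiv_mult by (simp add: poly_sum z mult_ac)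
  also have "\<dots> = (\<Sum>k\<le>m. if k = m then (-1) ^ Suc m * poly (pderiv (power_sum_poly (Suc m))) z else 0)"
    by (intro sum.cong) (auto simp: rising_poly_root)
  finally show ?thesis by (simp add: n)
qed

text \<open>In the second derivative the cross terms survive as well; at 0 and 1 they form a
  convolution of Bernoulli numbers.\<close>

lemma pderiv2_rising_poly_root:
  "of_nat (Suc m) * poly (pderiv (pderiv (rising_poly (Suc m)))) z =
     (-1) ^ Suc m * poly (pderiv (pderiv (power_sum_poly (Suc m)))) z +
     2 * (-1) ^ Suc m * (\<Sum>k<m. poly (pderiv (power_sum_poly (Suc k))) z * poly (pderiv (power_sum_poly (m - k))) z / of_nat (m - k))"
proof -
  have "of_nat (Suc m) * poly (pderiv (pderiv (rising_poly (Suc m)))) z = poly (pderiv (pderiv (smult (of_nat (Suc m)) (rising_poly (Suc m))))) z"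
    by (simp add: pderiv_smult)
  also have "\<dots> = (\<Sum>k\<le>m. (-1) ^ Suc k * (poly (pderiv (pderiv (power_sum_poly (Suc k)))) z * poly (rising_poly (m - k)) z +
      2 * (poly (pderiv (power_sum_poly (Suc k))) z * poly (pderiv (rising_poly (m - k))) z)))"
    unfolding rising_poly_rec pderiv_sum pderiv_smult pderiv_mult pderiv_add
    by (simp add: poly_sum z mult_ac add_ac)
  also have "\<dots> = (-1) ^ Suc m * poly (pderiv (pderiv (power_sum_poly (Suc m)))) z + (\<Sum>k<m. (-1) ^ Suc k * (poly (pderiv (pderiv (power_sum_poly (Suc k)))) z * poly (rising_poly (m - k)) z +
      2 * (poly (pderiv (power_sum_poly (Suc k))) z * poly (pderiv (rising_poly (m - k))) z)))"
    by (simp add: lessThan_Suc_atMost [symmetric])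
  also have "(\<Sum>k<m. (-1) ^ Suc k * (poly (pderiv (pderiv (power_sum_poly (Suc k)))) z * poly (rising_poly (m - k)) z +
      2 * (poly (pderiv (power_sum_poly (Suc k))) z * poly (pderiv (rising_poly (m - k))) z))) =
     (\<Sum>k<m. 2 * (-1) ^ Suc m * (poly (pderiv (power_sum_poly (Suc k))) z * poly (pderiv (power_sum_poly (m - k))) z / of_nat (m - k)))"
  proof (intro sum.cong refl)
    fix k assume "k \<in> {..<m}"
    hence k: "k < m" by simp
    have *: "poly (pderiv (rising_poly (m - k))) z = (-1) ^ (m - k) * poly (pderiv (power_sum_poly (m - k))) z / of_nat (m - k)"
      using pderiv_rising_poly_root[of "m - k"] k by (simp add: field_simps)
    have **: "(-1) ^ Suc m = (-1) ^ Suc k * (-1 :: real) ^ (m - k)"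
      using k by (simp add: power_add [symmetric] del: power_Suc)
    show "(-1) ^ Suc k * (poly (pderiv (pderiv (power_sum_poly (Suc k)))) z * poly (rising_poly (m - k)) z +
      2 * (poly (pderiv (power_sum_poly (Suc k))) z * poly (pderiv (rising_poly (m - k))) z)) =
      2 * (-1) ^ Suc m * (poly (pderiv (power_sum_poly (Suc k))) z * poly (pderiv (power_sum_poly (m - k))) z / of_nat (m - k))"
      unfolding * ** using k by (simp add: rising_poly_root)
  qed
  finally show ?thesis by (simp add: sum_distrib_left)
qed

end

lemma rising_poly_pderiv_sum:
  assumes "n \<ge> 2"
  shows "poly (pderiv (rising_poly n)) 1 + poly (pderiv (rising_poly n)) 0 = 2 * (-1) ^ n * of_rat (bernoulli n) / of_nat n"
proof -
  have "of_nat n * (poly (pderiv (rising_poly n)) 1 + poly (pderiv (rising_poly n)) 0) = 2 * (-1) ^ n * of_rat (bernoulli n)"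
    unfolding distrib_left using assms
    by (subst (1 2) pderiv_rising_poly_root) (auto simp: poly_power_sum_poly_1 pderiv_power_sum_poly_0 pderiv_power_sum_poly_1)
  thus ?thesis using assms by (simp add: field_simps)
qed

text \<open>The convolutions at 1 and 0 agree term by term unless an index equals 1, the only index
  where the derivative jumps, from -1/2 to 1/2. So the quadratic Bernoulli sums cancel and a single
  Bernoulli number remains.\<close>

lemma rising_poly_pderiv2_diff:
  assumes "m \<ge> 2"
  shows "poly (pderiv (pderiv (rising_poly (Suc m)))) 1 - poly (pderiv (pderiv (rising_poly (Suc m)))) 0 =
     2 * (-1) ^ Suc m * of_rat (bernoulli m) / of_nat m"
proof -
  let ?b = "\<lambda>k. of_rat (bernoulli k) :: real"
  have "of_nat (Suc m) * (poly (pderiv (pderiv (rising_poly (Suc m)))) 1 - poly (pderiv (pderiv (rising_poly (Suc m)))) 0) =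
    2 * (-1) ^ Suc m * (\<Sum>k<m. (poly (pderiv (power_sum_poly (Suc k))) 1 * poly (pderiv (power_sum_poly (m - k))) 1
       - poly (pderiv (power_sum_poly (Suc k))) 0 * poly (pderiv (power_sum_poly (m - k))) 0) / of_nat (m - k))"
  proof -
    have "of_nat (Suc m) * poly (pderiv (pderiv (rising_poly (Suc m)))) 1 =
       (-1) ^ Suc m * poly (pderiv (pderiv (power_sum_poly (Suc m)))) 1 +
       2 * (-1) ^ Suc m * (\<Sum>k<m. poly (pderiv (power_sum_poly (Suc k))) 1 * poly (pderiv (power_sum_poly (m - k))) 1 / of_nat (m - k))"
      by (rule pderiv2_rising_poly_root) (rule poly_power_sum_poly_1)
    moreover have "of_nat (Suc m) * poly (pderiv (pderiv (rising_poly (Suc m)))) 0 =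
       (-1) ^ Suc m * poly (pderiv (pderiv (power_sum_poly (Suc m)))) 0 +
       2 * (-1) ^ Suc m * (\<Sum>k<m. poly (pderiv (power_sum_poly (Suc k))) 0 * poly (pderiv (power_sum_poly (m - k))) 0 / of_nat (m - k))"
      by (rule pderiv2_rising_poly_root) (rule poly_power_sum_poly_0)
    moreover have "poly (pderiv (pderiv (power_sum_poly (Suc m)))) 1 = poly (pderiv (pderiv (power_sum_poly (Suc m)))) 0"
      by (rule pderiv2_power_sum_poly) (use assms in simp)
    ultimately show ?thesis
      unfolding right_diff_distrib diff_divide_distrib sum_subtractf by simp
  qed
  also have "(\<Sum>k<m. (poly (pderiv (power_sum_poly (Suc k))) 1 * poly (pderiv (power_sum_poly (m - k))) 1
       - poly (pderiv (power_sum_poly (Suc k))) 0 * poly (pderiv (power_sum_poly (m - k))) 0) / of_nat (m - k)) =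
     (\<Sum>k<m. (if k = 0 then ?b m / of_nat m else 0) + (if k = m - 1 then ?b m else 0))"
  proof (intro sum.cong refl)
    fix k assume "k \<in> {..<m}"
    hence k: "k < m" by simp
    consider "k = 0" | "k = m - 1" | "k \<noteq> 0" "k \<noteq> m - 1" by blast
    thus "(poly (pderiv (power_sum_poly (Suc k))) 1 * poly (pderiv (power_sum_poly (m - k))) 1
       - poly (pderiv (power_sum_poly (Suc k))) 0 * poly (pderiv (power_sum_poly (m - k))) 0) / of_nat (m - k) =
       (if k = 0 then ?b m / of_nat m else 0) + (if k = m - 1 then ?b m else 0)"
    proof cases
      case 1
      thus ?thesis using assms by (simp add: pderiv_power_sum_poly_0 pderiv_power_sum_poly_1 algebra_simps)
    next
      case 2
      hence "m - k = 1" "Suc k = m" "k \<noteq> 0" using assms by auto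
      thus ?thesis using 2 assms by (simp add: pderiv_power_sum_poly_0 pderiv_power_sum_poly_1 algebra_simps)
    next
      case 3
      hence "m - k \<noteq> 1" "k \<noteq> 0" using k by auto
      thus ?thesis using 3 k by (simp add: pderiv_power_sum_poly_0 pderiv_power_sum_poly_1)
    qed
  qed
  also have "\<dots> = ?b m / of_nat m + ?b m"
    using assms by (simp add: sum.distrib)
  finally have "of_nat (Suc m) * (poly (pderiv (pderiv (rising_poly (Suc m)))) 1 - poly (pderiv (pderiv (rising_poly (Suc m)))) 0) =
      of_nat (Suc m) * (2 * (-1) ^ Suc m * ?b m / of_nat m)"
    using assms by (simp add: divide_simps) (simp add: algebra_simps)
  thus ?thesis by (metis mult_cancel_left of_nat_neq_0)
qed

section \<open>The values of S_i(n) at a = 0\<close>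

lemma S_rel_0_coeffs:
  assumes "S_rel n (\<lambda>_. 0) s"
  assumes n: "n \<ge> 1" and j: "j \<ge> 1"
  shows "poly (rising_poly (Suc n)) (of_nat j) - poly (rising_poly (Suc n)) (1 - of_nat j) =
      (2 * real j - 1) * (s 0 + (\<Sum>i=1..n. s i * (real j * (real j - 1)) ^ i))"
proof -
  have aF0: "aF (\<lambda>_. 0) = 0" by (simp add: aF_def fps_zero_def)
  have G: "Gf (\<lambda>_. 0) j = (\<Prod>i<j. inverse (1 + fps_const (of_nat i) * fps_X))"
    unfolding Gf_def aF0 by (auto simp: fps_divide_unit fps_of_nat [symmetric] atLeast0LessThan intro!: prod.cong)
  have H: "Hf (\<lambda>_. 0) j = (\<Prod>i\<in>{1..<j}. (1 + fps_const (- of_nat i) * fps_X))"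
    unfolding Hf_def aF0
    by (rule prod.reindex_bij_witness[of _ "\<lambda>i. - int i" "\<lambda>i. nat (- i)"])
       (use j in \<open>auto simp: fps_of_int [symmetric] fps_of_nat [symmetric] fps_const_neg [symmetric] simp del: fps_const_neg\<close>)
  have "fps_nth ((Gf (\<lambda>_. 0) j - Hf (\<lambda>_. 0) j) / fps_X ^ 2 * (1 + aF (\<lambda>_. 0) * fps_X ^ 2)) (n - 1) =
      fps_nth (Gf (\<lambda>_. 0) j - Hf (\<lambda>_. 0) j) (Suc n)"
    using n by (cases n) (simp_all add: aF0)
  also have "\<dots> = poly (rising_poly (Suc n)) (of_nat j) - poly (rising_poly (Suc n)) (1 - of_nat j)"
    unfolding G H using j by (simp add: rising_poly_of_nat rising_poly_1_minus_of_nat)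
  finally show ?thesis
    using assms(1) j unfolding S_rel_def by auto
qed

text \<open>With e = \<open>rising_poly (Suc n)\<close> the identity reads e(z) - e(1 - z) = u r(v),
  where r has the coefficients s_i. At z = 1 one has v = 0, which gives s_0; at z = 2 one has u = 3
  and v = 2, which gives the weighted sum; the first two derivatives at z = 1 give s_1 and
  s_2.\<close>

theorem S_rel_0_values:
  assumes S: "S_rel n (\<lambda>_. 0) s" and n: "n \<ge> 3"
  shows "s 0 = 0" "s 1 = 2 * (-1) ^ Suc n * of_rat (bernoulli (Suc n)) / of_nat (Suc n)"
    "s 2 = (-1) ^ Suc n * of_rat (bernoulli n) / of_nat n - 3 * s 1"
    "3 * (\<Sum>i=1..n. s i * 2 ^ i) = (-1) ^ Suc n"
proof -
  have n1: "n \<ge> 1" using n by simp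
  note eq = S_rel_0_coeffs[OF S n1]
  have r1: "poly (rising_poly (Suc n)) 1 = 0"
    by (rule rising_poly_root) (simp_all add: poly_power_sum_poly_1)
  have r0: "poly (rising_poly (Suc n)) 0 = 0"
    by (rule rising_poly_root) simp_all
  show s0: "s 0 = 0"
    using eq[of 1] r1 r0 by (simp add: power_0_left)
  \<comment> \<open>For j = 2 the only nontrivial factor of \<open>G\<close> is 1 / (1 + x).\<close>
  have two: "poly (rising_poly (Suc n)) 2 = (-1) ^ Suc n"
  proof -
    have "{..<2::nat} = {0, 1}" by auto
    hence "(\<Prod>i<2. inverse (1 + fps_const (real i) * fps_X)) = inverse (1 + fps_const 1 * fps_X)"
      by simp
    thus ?thesis
      using rising_poly_of_nat[of "Suc n" 2] unfolding inverse_linear_fps by simp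
  qed
  \<comment> \<open>For j = 2 the product \<open>H\<close> is 1 - x, without coefficients beyond
    degree 1.\<close>
  have neg1: "poly (rising_poly (Suc n)) (-1) = 0"
  proof -
    have *: "{Suc 0..<2} = {1}" by auto
    show ?thesis
      using rising_poly_1_minus_of_nat[of 2 "Suc n"] n by (simp add: *)
  qed
  show "3 * (\<Sum>i=1..n. s i * 2 ^ i) = (-1) ^ Suc n"
    using eq[of 2] two neg1 s0 by simp
  define r where "r = (\<Sum>i\<le>n. monom (s i) i)"
  have poly_r: "poly r v = s 0 + (\<Sum>i=1..n. s i * v ^ i)" for v
  proof -
    have "{..n} = insert 0 {1..n}" by auto
    thus ?thesis by (simp add: r_def poly_sum poly_monom)
  qed
  define u v w where "u = [:-1, 2 :: real:]" and "v = [:0, -1, 1 :: real:]" and "w = [:1, -1 :: real:]"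
  let ?e = "rising_poly (Suc n)"
  have poly_eq: "?e - pcompose ?e w = u * pcompose r v"
  proof (rule poly_eq_if_eq_on_nat)
    fix j :: nat assume "j \<ge> 1"
    from eq[OF this] show "poly (?e - pcompose ?e w) (of_nat j) = poly (u * pcompose r v) (of_nat j)"
      by (simp add: u_def v_def w_def poly_pcompose poly_r algebra_simps)
  qed
  have pderiv_refl: "pderiv w = -1" by (simp add: w_def pderiv_pCons one_pCons)
  have pderiv_2: "pderiv (2 :: real poly) = 0" by (simp add: numeral_poly)
  \<comment> \<open>Since v' = u and u' = 2, the two derivatives at z = 1, where u = 1 and v = 0,
    are s_1 and 6 s_1 + 2 s_2.\<close>
  have dv: "pderiv v = u" "pderiv u = 2" by (simp_all add: u_def v_def pderiv_pCons numeral_poly)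
  have d1: "pderiv ?e + pcompose (pderiv ?e) w = 2 * pcompose r v + u * u * pcompose (pderiv r) v"
    using arg_cong[OF poly_eq, of pderiv]
    unfolding pderiv_diff pderiv_pcompose pderiv_mult dv pderiv_refl by (simp add: algebra_simps)
  have d2: "pderiv (pderiv ?e) - pcompose (pderiv (pderiv ?e)) w =
     6 * u * pcompose (pderiv r) v + u * u * u * pcompose (pderiv (pderiv r)) v"
    using arg_cong[OF d1, of pderiv]
    unfolding pderiv_diff pderiv_add pderiv_pcompose pderiv_mult dv pderiv_refl pderiv_2 by (simp add: algebra_simps)
  have r': "poly (pderiv r) 0 = s 1" "poly (pderiv (pderiv r)) 0 = 2 * s 2" "poly r 0 = 0"
    using n s0 by (auto simp: poly_0_coeff_0 coeff_pderiv r_def coeff_sum numeral_2_eq_2)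
  have "poly (pderiv ?e) 1 + poly (pderiv ?e) 0 = s 1"
    using arg_cong[OF d1, of "\<lambda>p. poly p 1"] by (simp add: u_def v_def w_def poly_pcompose r')
  thus s1: "s 1 = 2 * (-1) ^ Suc n * of_rat (bernoulli (Suc n)) / of_nat (Suc n)"
    using rising_poly_pderiv_sum[of "Suc n"] n by simp
  have "poly (pderiv (pderiv ?e)) 1 - poly (pderiv (pderiv ?e)) 0 = 6 * s 1 + 2 * s 2"
    using arg_cong[OF d2, of "\<lambda>p. poly p 1"] by (simp add: u_def v_def w_def poly_pcompose r')
  thus s2: "s 2 = (-1) ^ Suc n * of_rat (bernoulli n) / of_nat n - 3 * s 1"
    using rising_poly_pderiv2_diff[of n] n by (simp only: times_divide_eq_right [symmetric] mult.assoc)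
qed

section \<open>The polynomials \<open>S\<^sub>i(n)\<close>\<close>


definition wser :: "(nat \<Rightarrow> real) \<Rightarrow> real fps" where
  "wser c = 1 + aF c * fps_X ^ 2"

text \<open>The series \<open>w\<^sup>j\<^sup>+\<^sup>1 / \<Prod>\<^sub>i\<^sub><\<^sub>j (1 + i x)\<close> for an arbitrary integer \<open>j\<close>: on \<open>j\<close> and \<open>1 - j\<close> it
  gives \<open>w G\<close> and \<open>w H\<close>.\<close>
definition gser :: "(nat \<Rightarrow> real) \<Rightarrow> int \<Rightarrow> real fps" where
  "gser c j = wser c * (if j \<ge> 0 then Gf c (nat j) else Hf c (nat (1 - j)))"

lemma wser_nth_0 [simp]: "fps_nth (wser c) 0 = 1"
  by (simp add: wser_def)

lemma gser_0: "gser c 0 = wser c"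
  by (simp add: gser_def Gf_def)

text \<open>The recurrence crosses j = 0 without changing its form, which is the reason for joining
  \<open>G\<close> and \<open>H\<close> into one family. Each coefficient in x thus satisfies a
  first-order difference equation on all integers.\<close>

lemma gser_rec: "(1 + of_int j * fps_X) * gser c (j + 1) = wser c * gser c j"
proof (cases "j \<ge> 0")
  case True
  then obtain m where m: "j = int m" by (metis nonneg_int_cases)
  have [simp]: "nat (int m + 1) = Suc m" by simp
  have "Gf c (Suc m) = Gf c m * (wser c / (1 + of_nat m * fps_X))"
    by (simp add: Gf_def wser_def)
  moreover have "(1 + of_nat m * fps_X) * (wser c / (1 + of_nat m * fps_X)) = wser c"
    by (simp add: fps_divide_unit mult.left_commute inverse_mult_eq_1' fps_of_nat [symmetric])
  ultimately have "(1 + of_nat m * fps_X) * Gf c (Suc m) = Gf c m * wser c"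
    by (simp add: mult_ac)
  thus ?thesis by (simp add: gser_def m mult.left_commute) (simp only: mult.commute)?
next
  case False
  define m where "m = nat (- j)"
  have m: "j = - int m" "m \<ge> 1" using False by (auto simp: m_def)
  have "{1 - int (Suc m)..-1} = insert (- int m) {1 - int m..-1}" using m by auto
  hence "Hf c (Suc m) = (\<Prod>i\<in>insert (- int m) {1 - int m..-1}. (1 + of_int i * fps_X) / wser c)"
    unfolding Hf_def wser_def by (rule arg_cong)
  also have "\<dots> = (1 + of_int (- int m) * fps_X) / wser c * Hf c m"
    unfolding Hf_def wser_def by (rule prod.insert) auto
  finally have "Hf c (Suc m) = Hf c m * ((1 + of_int (- int m) * fps_X) / wser c)"
    by (simp only: mult.commute)
  moreover have "wser c * ((1 + of_int (- int m) * fps_X) / wser c) = 1 + of_int (- int m) * fps_X"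
    by (simp add: fps_divide_unit mult.left_commute inverse_mult_eq_1')
  ultimately have *: "wser c * Hf c (Suc m) = Hf c m * (1 + of_int (- int m) * fps_X)"
    by (metis mult.left_commute)
  have "gser c (j + 1) = wser c * Hf c m"
  proof (cases "m = 1")
    case True
    thus ?thesis by (simp add: gser_def m Gf_def Hf_def)
  next
    case False
    hence "j + 1 < 0" "nat (1 - (j + 1)) = m" using m by auto
    thus ?thesis by (simp add: gser_def)
  qed
  moreover have "gser c j = wser c * Hf c (Suc m)"
  proof -
    have "\<not> j \<ge> 0" "nat (1 - j) = Suc m" using m by auto
    thus ?thesis by (simp add: gser_def)
  qed
  ultimately have "(1 + of_int j * fps_X) * gser c (j + 1) = (1 + of_int (- int m) * fps_X) * (wser c * Hf c m)"
      "wser c * gser c j = wser c * (Hf c m * (1 + of_int (- int m) * fps_X))"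
    using * by (simp_all only: m(1))
  thus ?thesis by (simp only: mult_ac)
qed

lemma fps_nth_linear_mult: "fps_nth ((1 + of_int j * fps_X) * F) (Suc N) = fps_nth F (Suc N) + of_int j * (fps_nth F N :: real)"
proof -
  have "(1 + of_int j * fps_X) * F = F + fps_const (of_int j) * (fps_X * F)"
    by (simp add: algebra_simps fps_of_int [symmetric])
  thus ?thesis by simp
qed

lemma fps_nth_wser_mult:
  "fps_nth (wser c * F) N = fps_nth F N + (if N \<ge> 2 then \<Sum>k\<le>N-2. c k * fps_nth F (N - 2 - k) else 0)"
proof -
  have "wser c * F = F + (aF c * F) * fps_X ^ 2"
    by (simp add: wser_def algebra_simps)
  thus ?thesis
    by (simp add: fps_X_power_mult_right_nth not_less) (simp add: fps_mult_nth aF_def atMost_atLeast0)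
qed

lemma gser_nth_at_0: "fps_nth (gser c 0) N = (if N = 0 then 1 else if N = 1 then 0 else c (N - 2))"
  unfolding gser_0 wser_def by (auto simp: fps_X_power_mult_right_nth aF_def)

lemma gser_nth_rec:
  "fps_nth (gser c (j + 1)) (Suc N) - fps_nth (gser c j) (Suc N) =
     (if Suc N \<ge> 2 then \<Sum>k\<le>Suc N - 2. c k * fps_nth (gser c j) (Suc N - 2 - k) else 0) - of_int j * fps_nth (gser c (j + 1)) N"
  using arg_cong[OF gser_rec[of j c], of "\<lambda>F. fps_nth F (Suc N)"]
  unfolding fps_nth_linear_mult fps_nth_wser_mult by linarith

lemma eq_if_same_increments:
  fixes f g :: "int \<Rightarrow> real"
  assumes "\<And>j. f (j + 1) - f j = g (j + 1) - g j" "f 0 = g 0"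
  shows "f j = g j"
proof (induction j rule: int_induct[of _ 0])
  case (step1 i)
  thus ?case using assms(1)[of i] by simp
next
  case (step2 i)
  thus ?case using assms(1)[of "i - 1"] by simp
qed (use assms(2) in simp)

lemma gser_nth_0: "fps_nth (gser c j) 0 = 1"
proof (rule eq_if_same_increments)
  show "fps_nth (gser c (j + 1)) 0 - fps_nth (gser c j) 0 = 1 - 1" for j
    using arg_cong[OF gser_rec[of j c], of "\<lambda>F. fps_nth F 0"] by (simp add: fps_of_int [symmetric])
qed (simp add: gser_nth_at_0)

lemma gser_nth_1: "fps_nth (gser c j) (Suc 0) = - of_int j * (of_int j - 1) / 2"
proof (rule eq_if_same_increments)
  show "fps_nth (gser c (j + 1)) (Suc 0) - fps_nth (gser c j) (Suc 0) =
      - of_int (j + 1) * (of_int (j + 1) - 1) / 2 - (- of_int j * (of_int j - 1) / 2)" for j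
    using gser_nth_rec[of c j 0] by (simp add: gser_nth_0 field_simps)
qed (simp add: gser_nth_at_0)

section \<open>Polynomial dependence on the integer j\<close>

text \<open>Both the degree in j and the variables are recorded, because S_i(n) has to stop at i = n
  and to involve only a_0, ..., a_(n-2).\<close>

definition poly_dep :: "nat set \<Rightarrow> nat \<Rightarrow> (int \<Rightarrow> (nat \<Rightarrow> real) \<Rightarrow> real) \<Rightarrow> bool" where
  "poly_dep V d f \<longleftrightarrow> (\<exists>p :: nat \<Rightarrow> mpoly. (\<forall>i. mp_vars (p i) \<subseteq> V) \<and>
     (\<forall>j c. f j c = (\<Sum>i\<le>d. mp_eval (p i) c * of_int j ^ i)))"

lemma poly_depI:
  assumes "\<And>i. mp_vars (p i) \<subseteq> V" "\<And>j c. f j c = (\<Sum>i\<le>d. mp_eval (p i) c * of_int j ^ i)"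
  shows "poly_dep V d f"
  unfolding poly_dep_def by (rule exI[of _ p]) (intro conjI allI assms)

lemma poly_dep_mono: "poly_dep V d f \<Longrightarrow> V \<subseteq> V' \<Longrightarrow> d \<le> d' \<Longrightarrow> poly_dep V' d' f"
proof -
  assume f: "poly_dep V d f" and V: "V \<subseteq> V'" and d: "d \<le> d'"
  obtain p where *: "(\<forall>i. mp_vars (p i) \<subseteq> V) \<and> (\<forall>j c. f j c = (\<Sum>i\<le>d. mp_eval (p i) c * of_int j ^ i))"
    using f unfolding poly_dep_def by (rule exE)
  note p = conjunct1[OF *, rule_format] conjunct2[OF *, rule_format]
  let ?p = "\<lambda>i. if i \<le> d then p i else 0"
  have "f j c = (\<Sum>i\<le>d'. mp_eval (?p i) c * of_int j ^ i)" for j c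
    unfolding p(2) by (rule sum.mono_neutral_cong_left) (use d in auto)
  moreover have "mp_vars (?p i) \<subseteq> V'" for i using p(1) V by auto
  ultimately show ?thesis by (rule poly_depI[of ?p, rotated])
qed

lemma poly_dep_add: "poly_dep V d f \<Longrightarrow> poly_dep V d g \<Longrightarrow> poly_dep V d (\<lambda>j c. f j c + g j c)"
proof -
  assume f: "poly_dep V d f" and g: "poly_dep V d g"
  obtain p where *: "(\<forall>i. mp_vars (p i) \<subseteq> V) \<and> (\<forall>j c. f j c = (\<Sum>i\<le>d. mp_eval (p i) c * of_int j ^ i))"
    using f unfolding poly_dep_def by (rule exE)
  note p = conjunct1[OF *, rule_format] conjunct2[OF *, rule_format]
  obtain q where *: "(\<forall>i. mp_vars (q i) \<subseteq> V) \<and> (\<forall>j c. g j c = (\<Sum>i\<le>d. mp_eval (q i) c * of_int j ^ i))"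
    using g unfolding poly_dep_def by (rule exE)
  note q = conjunct1[OF *, rule_format] conjunct2[OF *, rule_format]
  show ?thesis unfolding poly_dep_def
    by (intro exI[of _ "\<lambda>i. p i + q i"]) (simp add: p q mp_vars_add_le sum.distrib distrib_right)
qed

lemma poly_dep_cmult:
  assumes "poly_dep V d f" "mp_vars a \<subseteq> V"
  shows "poly_dep V d (\<lambda>j c. mp_eval a c * f j c)"
proof -
  obtain p where *: "(\<forall>i. mp_vars (p i) \<subseteq> V) \<and> (\<forall>j c. f j c = (\<Sum>i\<le>d. mp_eval (p i) c * of_int j ^ i))"
    using assms(1) unfolding poly_dep_def by (rule exE)
  note p = conjunct1[OF *, rule_format] conjunct2[OF *, rule_format]
  show ?thesis unfolding poly_dep_def
    by (intro exI[of _ "\<lambda>i. a * p i"]) (simp add: p assms(2) mp_vars_mult_le sum_distrib_left mult.assoc)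
qed

lemma poly_dep_mult_j:
  assumes "poly_dep V d f"
  shows "poly_dep V (Suc d) (\<lambda>j c. of_int j * f j c)"
proof -
  obtain p where *: "(\<forall>i. mp_vars (p i) \<subseteq> V) \<and> (\<forall>j c. f j c = (\<Sum>i\<le>d. mp_eval (p i) c * of_int j ^ i))"
    using assms(1) unfolding poly_dep_def by (rule exE)
  note p = conjunct1[OF *, rule_format] conjunct2[OF *, rule_format]
  have "of_int j * f j c = (\<Sum>i\<le>Suc d. mp_eval (case i of 0 \<Rightarrow> 0 | Suc i \<Rightarrow> p i) c * of_int j ^ i)" for j c
    by (subst sum.atMost_Suc_shift) (simp add: p(2) sum_distrib_left mult_ac)
  moreover have "mp_vars (case i of 0 \<Rightarrow> 0 | Suc i \<Rightarrow> p i) \<subseteq> V" for i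
    using p(1) by (auto split: nat.splits)
  ultimately show ?thesis by (rule poly_depI[of "\<lambda>i. case i of 0 \<Rightarrow> 0 | Suc i \<Rightarrow> p i", rotated])
qed

lemma poly_dep_0: "poly_dep V d (\<lambda>j c. 0)"
  unfolding poly_dep_def by (intro exI[of _ "\<lambda>_. 0"]) auto

lemma poly_dep_const:
  assumes "mp_vars a \<subseteq> V"
  shows "poly_dep V d (\<lambda>j c. mp_eval a c)"
proof -
  have "poly_dep V 0 (\<lambda>j c. mp_eval a c)"
    unfolding poly_dep_def by (intro exI[of _ "\<lambda>_. a"]) (use assms in auto)
  thus ?thesis by (rule poly_dep_mono) auto
qed

lemma poly_dep_sum: "(\<And>i. i \<in> I \<Longrightarrow> poly_dep V d (f i)) \<Longrightarrow> poly_dep V d (\<lambda>j c. \<Sum>i\<in>I. f i j c)"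
  by (induction I rule: infinite_finite_induct) (auto intro: poly_dep_0 poly_dep_add)

lemma poly_dep_cong: "(\<And>j c. f j c = g j c) \<Longrightarrow> poly_dep V d f \<Longrightarrow> poly_dep V d g"
  unfolding poly_dep_def by auto

lemma poly_dep_uminus: "poly_dep V d f \<Longrightarrow> poly_dep V d (\<lambda>j c. - f j c)"
  using poly_dep_cmult[of V d f "mp_const (-1)"] by (simp add: of_rat_minus)

lemma poly_dep_diff: "poly_dep V d f \<Longrightarrow> poly_dep V d g \<Longrightarrow> poly_dep V d (\<lambda>j c. f j c - g j c)"
  using poly_dep_add[OF _ poly_dep_uminus, of V d f g] by simp

lemma poly_dep_shift:
  assumes "poly_dep V d f"
  shows "poly_dep V d (\<lambda>j c. f (j + 1) c)"
proof -
  obtain p where *: "(\<forall>i. mp_vars (p i) \<subseteq> V) \<and> (\<forall>j c. f j c = (\<Sum>i\<le>d. mp_eval (p i) c * of_int j ^ i))"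
    using assms(1) unfolding poly_dep_def by (rule exE)
  note p = conjunct1[OF *, rule_format] conjunct2[OF *, rule_format]
  have pow: "poly_dep V i (\<lambda>j c. of_int (j + 1) ^ i)" for i
  proof (induction i)
    case 0
    show ?case using poly_dep_const[of 1 V 0] by simp
  next
    case (Suc i)
    from poly_dep_add[OF poly_dep_mult_j[OF Suc] poly_dep_mono[OF Suc subset_refl, of "Suc i"]]
    show ?case by (simp add: algebra_simps)
  qed
  show ?thesis unfolding p(2)
    by (intro poly_dep_sum poly_dep_cmult p(1) poly_dep_mono[OF pow subset_refl]) auto
qed

lemma poly_dep_power: "poly_dep V i (\<lambda>j c. of_int j ^ i)"
proof (induction i)
  case 0
  show ?case using poly_dep_const[of 1 V 0] by simp
next
  case (Suc i)
  from poly_dep_mult_j[OF Suc] show ?case by simp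
qed

lemma poly_dep_power_sum_poly: "poly_dep V (Suc m) (\<lambda>j c. poly (power_sum_poly m) (of_int j))"
proof (induction m rule: less_induct)
  case (less m)
  have "poly_dep V (Suc m) (\<lambda>j c. mp_eval (mp_const (1 / of_nat (Suc m))) c * (of_int j ^ Suc m -
      (\<Sum>k<m. mp_eval (mp_const (of_nat (Suc m choose k))) c * poly (power_sum_poly k) (of_int j))))"
    by (intro poly_dep_cmult poly_dep_diff poly_dep_power poly_dep_sum poly_dep_mono[OF less subset_refl]) auto
  thus ?case
  proof (rule poly_dep_cong [rotated])
    fix j :: int and c :: "nat \<Rightarrow> real"
    have "real (Suc m) * poly (power_sum_poly m) (of_int j) = of_int j ^ Suc m - (\<Sum>k<m. real (Suc m choose k) * poly (power_sum_poly k) (of_int j))"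
      by (rule poly_power_sum_poly_rec)
    hence "poly (power_sum_poly m) (of_int j) = (1 / real (Suc m)) * (of_int j ^ Suc m - (\<Sum>k<m. real (Suc m choose k) * poly (power_sum_poly k) (of_int j)))"
      by (simp add: field_simps del: power_Suc binomial_Suc_Suc)
    thus "mp_eval (mp_const (1 / of_nat (Suc m))) c * (of_int j ^ Suc m - (\<Sum>k<m. mp_eval (mp_const (of_nat (Suc m choose k))) c * poly (power_sum_poly k) (of_int j)))
       = poly (power_sum_poly m) (of_int j)"
      by (simp only: mp_eval_hom of_rat_divide of_rat_1 of_rat_of_nat_eq)
  qed
qed

text \<open>\<open>power_sum_poly\<close> inverts the difference operator on negative integers too,
  so summation in j stays polynomial and raises the degree by one.\<close>

lemma poly_dep_summation:
  assumes g: "poly_dep V d g" and f: "\<And>j c. f (j + 1) c - f j c = g j c" "\<And>c. f 0 c = mp_eval a c" "mp_vars a \<subseteq> V"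
  shows "poly_dep V (Suc d) f"
proof -
  obtain p where *: "(\<forall>i. mp_vars (p i) \<subseteq> V) \<and> (\<forall>j c. g j c = (\<Sum>i\<le>d. mp_eval (p i) c * of_int j ^ i))"
    using g unfolding poly_dep_def by (rule exE)
  note p = conjunct1[OF *, rule_format] conjunct2[OF *, rule_format]
  let ?F = "\<lambda>j c. mp_eval a c + (\<Sum>i\<le>d. mp_eval (p i) c * poly (power_sum_poly i) (of_int j))"
  have "poly_dep V (Suc d) ?F"
    by (intro poly_dep_add poly_dep_const poly_dep_sum poly_dep_cmult p(1) f(3) poly_dep_mono[OF poly_dep_power_sum_poly subset_refl]) auto
  moreover have "?F j c = f j c" for j c
  proof (rule eq_if_same_increments)
    show "?F (j + 1) c - ?F j c = f (j + 1) c - f j c" for j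
      unfolding f(1) p(2) by (simp add: sum_subtractf [symmetric] right_diff_distrib [symmetric] power_sum_poly_diff)
  qed (simp add: f(2))
  ultimately show ?thesis by (rule poly_dep_cong [rotated])
qed

text \<open>The series is w^(j+1) times a factor free of c, so the newest variable enters the
  coefficient of x^N only as (j + 1) c (N - 2). The second clause splits this term off; it later
  becomes u a_(n-1). A step of the induction costs at most two degrees, one for the factor j and one
  for the summation.\<close>

lemma poly_dep_gser:
  "poly_dep {..<N - 1} (2 * N) (\<lambda>j c. fps_nth (gser c j) N) \<and>
   (N \<ge> 2 \<longrightarrow> poly_dep {..<N - 2} (2 * N) (\<lambda>j c. fps_nth (gser c j) N - of_int (j + 1) * c (N - 2)))"
proof (induction N rule: less_induct)
  case (less N)
  consider "N = 0" | "N = 1" | "N \<ge> 2" by linarith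
  thus ?case
  proof cases
    case 1
    thus ?thesis using poly_dep_const[of 1 "{}" 0] by (simp add: gser_nth_0)
  next
    case 2
    have "poly_dep {} 2 (\<lambda>j c. mp_eval (mp_const (-1/2)) c * (of_int j ^ 2 - of_int j ^ 1))"
      by (intro poly_dep_cmult poly_dep_diff poly_dep_mono[OF poly_dep_power subset_refl]) auto
    hence "poly_dep {} 2 (\<lambda>j c. fps_nth (gser c j) (Suc 0))"
      by (rule poly_dep_cong [rotated]) (simp add: gser_nth_1 of_rat_divide of_rat_minus power2_eq_square field_simps)
    thus ?thesis using 2 by simp
  next
    case 3
    then obtain M where N: "N = Suc (Suc M)" by (metis Suc_eq_plus1 add_2_eq_Suc le_Suc_ex)
    let ?g = "\<lambda>j c. (\<Sum>k<M. mp_eval (Var k) c * fps_nth (gser c j) (M - k)) - of_int j * fps_nth (gser c (j + 1)) (Suc M)"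
    have IH: "poly_dep {..<K - 1} (2 * K) (\<lambda>j c. fps_nth (gser c j) K)" if "K < N" for K
      using less that by blast
    have "poly_dep {..<M} (Suc (2 * Suc M)) ?g"
    proof (intro poly_dep_diff poly_dep_sum poly_dep_cmult)
      fix k assume "k \<in> {..<M}"
      thus "mp_vars (Var k) \<subseteq> {..<M}" "poly_dep {..<M} (Suc (2 * Suc M)) (\<lambda>j c. fps_nth (gser c j) (M - k))"
        using poly_dep_mono[OF IH[of "M - k"], of "{..<M}" "Suc (2 * Suc M)"] N by auto
    next
      show "poly_dep {..<M} (Suc (2 * Suc M)) (\<lambda>j c. of_int j * fps_nth (gser c (j + 1)) (Suc M))"
        using poly_dep_mult_j[OF poly_dep_shift[OF IH[of "Suc M"]]] N by simp
    qed
    hence "poly_dep {..<M} (Suc (Suc (2 * Suc M))) (\<lambda>j c. fps_nth (gser c j) N - of_int (j + 1) * c M)"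
    proof (rule poly_dep_summation)
      fix j c
      have "fps_nth (gser c (j + 1)) N - fps_nth (gser c j) N =
         (\<Sum>k\<le>M. c k * fps_nth (gser c j) (M - k)) - of_int j * fps_nth (gser c (j + 1)) (Suc M)"
        using gser_nth_rec[of c j "Suc M"] by (simp add: N)
      also have "(\<Sum>k\<le>M. c k * fps_nth (gser c j) (M - k)) = (\<Sum>k<M. c k * fps_nth (gser c j) (M - k)) + c M"
        by (simp add: lessThan_Suc_atMost [symmetric] gser_nth_0)
      finally show "fps_nth (gser c (j + 1)) N - of_int (j + 1 + 1) * c M - (fps_nth (gser c j) N - of_int (j + 1) * c M) = ?g j c"
        by (simp add: algebra_simps)
    next
      show "fps_nth (gser c 0) N - of_int (0 + 1) * c M = mp_eval 0 c" for c
        by (simp add: gser_nth_at_0 N)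
    qed auto
    hence *: "poly_dep {..<N - 2} (2 * N) (\<lambda>j c. fps_nth (gser c j) N - of_int (j + 1) * c (N - 2))"
      by (simp add: N)
    have "poly_dep {..<N - 1} (2 * N) (\<lambda>j c. (fps_nth (gser c j) N - of_int (j + 1) * c (N - 2)) + mp_eval (Var (N - 2)) c * (of_int j ^ 1 + of_int j ^ 0))"
      by (intro poly_dep_add poly_dep_cmult poly_dep_mono[OF *] poly_dep_mono[OF poly_dep_power subset_refl]) (use 3 in auto)
    hence "poly_dep {..<N - 1} (2 * N) (\<lambda>j c. fps_nth (gser c j) N)"
      by (rule poly_dep_cong [rotated]) (simp add: algebra_simps)
    with * show ?thesis by blast
  qed
qed

text \<open>Since \<open>j\<close> and \<open>1 - j\<close> are the roots of \<open>z\<^sup>2 = z + v\<close> with \<open>v = j (j - 1)\<close>, the quotients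
  \<open>(j\<^sup>i - (1 - j)\<^sup>i) / (2 j - 1)\<close> satisfy a Fibonacci-like recurrence over \<open>\<rat>[v]\<close>.\<close>
fun fibc :: "nat \<Rightarrow> nat \<Rightarrow> rat" where
  "fibc 0 k = 0"
| "fibc (Suc 0) k = (if k = 0 then 1 else 0)"
| "fibc (Suc (Suc i)) k = fibc (Suc i) k + (case k of 0 \<Rightarrow> 0 | Suc k \<Rightarrow> fibc i k)"

lemma fibc_eq_0: "i \<le> 2 * k \<Longrightarrow> fibc i k = 0"
  by (induction i k rule: fibc.induct) (auto split: nat.splits)

lemma fibc_sum_large:
  fixes z :: real
  shows "i \<le> M \<Longrightarrow> z ^ i - (1 - z) ^ i = (2 * z - 1) * (\<Sum>k\<le>M. of_rat (fibc i k) * (z * (z - 1)) ^ k)"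
proof (induction i arbitrary: M rule: induct_nat_012)
  case 1
  have "(\<Sum>k\<le>M. of_rat (fibc (Suc 0) k) * (z * (z - 1)) ^ k) = (\<Sum>k\<le>M. if k = 0 then 1 else 0)"
    by (intro sum.cong) auto
  thus ?case by simp
next
  case (ge2 i)
  then obtain L where M: "M = Suc L" "i \<le> L" by (cases M) auto
  have "z ^ Suc (Suc i) - (1 - z) ^ Suc (Suc i) = (z ^ Suc i - (1 - z) ^ Suc i) + z * (z - 1) * (z ^ i - (1 - z) ^ i)"
    by (simp add: algebra_simps)
  also have "\<dots> = (2 * z - 1) * ((\<Sum>k\<le>M. of_rat (fibc (Suc i) k) * (z * (z - 1)) ^ k) +
     z * (z - 1) * (\<Sum>k\<le>L. of_rat (fibc i k) * (z * (z - 1)) ^ k))"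
    using ge2.IH(2)[of M] ge2.IH(1)[of L] ge2.prems M by (simp only: distrib_left mult.left_commute Suc_leD)
  also have "z * (z - 1) * (\<Sum>k\<le>L. of_rat (fibc i k) * (z * (z - 1)) ^ k) = (\<Sum>k\<le>M. of_rat (case k of 0 \<Rightarrow> 0 | Suc k \<Rightarrow> fibc i k) * (z * (z - 1)) ^ k)"
    unfolding M sum.atMost_Suc_shift by (simp add: sum_distrib_left mult_ac)
  finally show ?case by (simp add: sum.distrib [symmetric] of_rat_add distrib_right)
qed simp

lemma fibc_sum:
  fixes z :: real
  assumes "i \<le> 2 * n + 2"
  shows "z ^ i - (1 - z) ^ i = (2 * z - 1) * (\<Sum>k\<le>n. of_rat (fibc i k) * (z * (z - 1)) ^ k)"
proof -
  have "(\<Sum>k\<le>i + n. of_rat (fibc i k) * (z * (z - 1)) ^ k) = (\<Sum>k\<le>n. of_rat (fibc i k) * (z * (z - 1)) ^ k)"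
    by (rule sum.mono_neutral_right) (use assms in \<open>auto intro!: fibc_eq_0\<close>)
  thus ?thesis using fibc_sum_large[of i "i + n" z] by simp
qed

section \<open>Existence and uniqueness of the S_i(n)\<close>

text \<open>The division by x^2 is exact because the coefficients of x^0 and x^1 in
  \<open>gser\<close> agree at j and 1 - j; the latter is -j (j - 1) / 2.\<close>

lemma S_rel_lhs:
  assumes "n \<ge> 1" "j \<ge> (1::nat)"
  shows "fps_nth ((Gf c j - Hf c j) / fps_X ^ 2 * (1 + aF c * fps_X ^ 2)) (n - 1) =
     fps_nth (gser c (int j)) (Suc n) - fps_nth (gser c (1 - int j)) (Suc n)"
proof -
  define D where "D = Gf c j - Hf c j"
  have H: "gser c (1 - int j) = wser c * Hf c j"
  proof (cases "j = 1")
    case True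
    thus ?thesis by (simp add: gser_0 Hf_def)
  next
    case False
    thus ?thesis using assms by (simp add: gser_def)
  qed
  have wD: "wser c * D = gser c (int j) - gser c (1 - int j)"
    unfolding H D_def by (simp add: gser_def algebra_simps)
  have D0: "fps_nth D 0 = 0"
    using arg_cong[OF wD, of "\<lambda>F. fps_nth F 0"] by (simp add: gser_nth_0)
  have D1: "fps_nth D (Suc 0) = 0"
    using arg_cong[OF wD, of "\<lambda>F. fps_nth F (Suc 0)"] by (simp add: gser_nth_1 fps_nth_wser_mult D0 algebra_simps)
  have "D = fps_shift 2 D * fps_X ^ 2"
  proof (rule fps_ext)
    fix m show "fps_nth D m = fps_nth (fps_shift 2 D * fps_X ^ 2) m"
    proof (cases "m < 2")
      case True
      thus ?thesis using D0 D1 by (auto simp: fps_X_power_mult_right_nth less_2_cases_iff)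
    next
      case False
      then obtain k where "m = k + 2" by (metis add.commute le_Suc_ex not_less)
      thus ?thesis by (simp add: fps_X_power_mult_right_nth)
    qed
  qed
  hence "wser c * D = (fps_shift 2 D * wser c) * fps_X ^ 2"
    by (metis mult.assoc mult.commute)
  hence "fps_nth (wser c * D) (Suc n) = fps_nth ((fps_shift 2 D * wser c) * fps_X ^ 2) (Suc n)"
    by (rule arg_cong)
  also have "\<dots> = fps_nth (fps_shift 2 D * wser c) (n - 1)"
    using assms by (simp add: fps_X_power_mult_right_nth)
  finally have "fps_nth (wser c * D) (Suc n) = fps_nth (fps_shift 2 D * wser c) (n - 1)" .
  thus ?thesis unfolding wD by (simp add: D_def wser_def)
qed

lemma S_exists:
  assumes n: "n \<ge> 1"
  shows "\<exists>S. (\<forall>i>n. S i = 0) \<and> (\<forall>i. mp_vars (S i) \<subseteq> {..<n - 1}) \<and>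
      (\<forall>c::nat \<Rightarrow> real. S_rel n c (\<lambda>i. mp_eval (S i) c))"
proof -
  have "poly_dep {..<n - 1} (2 * Suc n) (\<lambda>j c. fps_nth (gser c j) (Suc n) - of_int (j + 1) * c (n - 1))"
    using poly_dep_gser[of "Suc n"] n by (simp add: Suc_le_eq numeral_2_eq_2)
  then obtain p where *: "(\<forall>i. mp_vars (p i) \<subseteq> {..<n - 1}) \<and>
    (\<forall>j c. fps_nth (gser c j) (Suc n) - of_int (j + 1) * c (n - 1) = (\<Sum>i\<le>2 * Suc n. mp_eval (p i) c * of_int j ^ i))"
    unfolding poly_dep_def by (rule exE)
  note p = conjunct1[OF *, rule_format] conjunct2[OF *, rule_format]
  \<comment> \<open>The degree bound 2 n + 2 in j is just what \<open>fibc_sum\<close> needs to stop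
    the powers of v at n.\<close>
  define S where "S k = (if k \<le> n then (\<Sum>i\<le>2 * Suc n. p i * mp_const (fibc i k)) else 0)" for k
  have "S_rel n c (\<lambda>i. mp_eval (S i) c)" for c
    unfolding S_rel_def
  proof (intro allI impI)
    fix j :: nat assume j: "j \<ge> 1"
    let ?z = "real j" and ?v = "real j * (real j - 1)"
    \<comment> \<open>The split-off terms give (j + 1) - (2 - j) = 2 j - 1 = u as the factor of
      a_(n-1).\<close>
    have "fps_nth (gser c (int j)) (Suc n) - fps_nth (gser c (1 - int j)) (Suc n) =
       (2 * ?z - 1) * c (n - 1) + ((\<Sum>i\<le>2 * Suc n. mp_eval (p i) c * ?z ^ i) - (\<Sum>i\<le>2 * Suc n. mp_eval (p i) c * (1 - ?z) ^ i))"
      using p(2)[of c "int j"] p(2)[of c "1 - int j"] by (simp add: algebra_simps del: sum.atMost_Suc)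
    also have "(\<Sum>i\<le>2 * Suc n. mp_eval (p i) c * ?z ^ i) - (\<Sum>i\<le>2 * Suc n. mp_eval (p i) c * (1 - ?z) ^ i) =
      (\<Sum>i\<le>2 * Suc n. mp_eval (p i) c * (?z ^ i - (1 - ?z) ^ i))"
      by (simp add: sum_subtractf right_diff_distrib del: sum.atMost_Suc)
    also have "\<dots> = (\<Sum>i\<le>2 * Suc n. mp_eval (p i) c * ((2 * ?z - 1) * (\<Sum>k\<le>n. of_rat (fibc i k) * ?v ^ k)))"
      by (intro sum.cong refl arg_cong2[where f = "(*)"] fibc_sum) auto
    also have "\<dots> = (2 * ?z - 1) * (\<Sum>k\<le>n. \<Sum>i\<le>2 * Suc n. mp_eval (p i) c * of_rat (fibc i k) * ?v ^ k)"
      by (subst sum.swap) (simp add: sum_distrib_left mult_ac del: sum.atMost_Suc)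
    also have "(\<Sum>k\<le>n. \<Sum>i\<le>2 * Suc n. mp_eval (p i) c * of_rat (fibc i k) * ?v ^ k) = (\<Sum>k\<le>n. mp_eval (S k) c * ?v ^ k)"
      by (intro sum.cong refl) (simp add: S_def sum_distrib_right del: sum.atMost_Suc)
    also have "{..n} = insert 0 {1..n}" by auto
    finally show "fps_nth ((Gf c j - Hf c j) / fps_X\<^sup>2 * (1 + aF c * fps_X\<^sup>2)) (n - 1) =
         (2 * real j - 1) * (c (n - 1) + mp_eval (S 0) c + (\<Sum>i = 1..n. mp_eval (S i) c * (real j * (real j - 1)) ^ i))"
      unfolding S_rel_lhs[OF n j] by (simp add: algebra_simps)
  qed
  moreover have "mp_vars (S i) \<subseteq> {..<n - 1}" for i
  proof (cases "i \<le> n")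
    case True
    have "mp_vars (\<Sum>k\<le>2 * Suc n. p k * mp_const (fibc k i)) \<subseteq> {..<n - 1}"
      by (intro mp_vars_sum_le mp_vars_mult_le p(1)) simp
    thus ?thesis using True by (simp add: S_def)
  qed (simp add: S_def)
  moreover have "\<forall>i>n. S i = 0" by (simp add: S_def)
  ultimately show ?thesis by blast
qed

text \<open>v = j (j - 1) takes infinitely many values and u is never 0, so the polynomial in v is
  determined.\<close>

lemma S_rel_unique:
  assumes "S_rel n c s" "S_rel n c t" "i \<le> n"
  shows "s i = t i"
proof -
  define r where "r = (\<Sum>i\<le>n. monom (s i - t i) i)"
  have poly_r: "poly r v = (s 0 - t 0) + (\<Sum>i=1..n. s i * v ^ i) - (\<Sum>i=1..n. t i * v ^ i)" for v
  proof -
    have "{..n} = insert 0 {1..n}" by auto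
    thus ?thesis by (simp add: r_def poly_sum poly_monom left_diff_distrib sum_subtractf)
  qed
  have root: "poly r (real j * (real j - 1)) = 0" if "j \<ge> 1" for j :: nat
  proof -
    have "(2 * real j - 1) * (c (n - 1) + s 0 + (\<Sum>i=1..n. s i * (real j * (real j - 1)) ^ i)) =
        (2 * real j - 1) * (c (n - 1) + t 0 + (\<Sum>i=1..n. t i * (real j * (real j - 1)) ^ i))"
      by (rule trans[OF sym[OF assms(1)[unfolded S_rel_def, rule_format, OF that]] assms(2)[unfolded S_rel_def, rule_format, OF that]])
    thus ?thesis using that by (simp add: poly_r)
  qed
  have "r = 0"
  proof (rule ccontr)
    assume "r \<noteq> 0"
    hence "finite {x. poly r x = 0}" by (rule poly_roots_finite)
    moreover have "(\<lambda>j::nat. real j * (real j - 1)) ` {1..} \<subseteq> {x. poly r x = 0}" using root by auto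
    ultimately have "finite ((\<lambda>j::nat. real j * (real j - 1)) ` {1..})" using finite_subset by blast
    moreover have "inj_on (\<lambda>j::nat. real j * (real j - 1)) {1..}"
    proof (rule inj_onI)
      fix i j :: nat assume ij: "i \<in> {1..}" "j \<in> {1..}" "real i * (real i - 1) = real j * (real j - 1)"
      have "(real i - real j) * (real i + real j - 1) = 0" using ij(3) by (simp add: algebra_simps)
      thus "i = j" using ij(1,2) by auto
    qed
    ultimately show False using finite_imageD infinite_Ici by blast
  qed
  moreover have "coeff r i = s i - t i"
    using assms(3) by (simp add: r_def coeff_sum)
  ultimately show ?thesis by simp
qed

lemma S_poly_props:
  assumes n: "n \<ge> 1"
  shows "\<And>i. i > n \<Longrightarrow> S_poly n i = 0" "\<And>i. mp_vars (S_poly n i) \<subseteq> {..<n - 1}"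
    "\<And>c. S_rel n c (\<lambda>i. mp_eval (S_poly n i) c)"
proof -
  let ?P = "\<lambda>S. (\<forall>i>n. S i = 0) \<and> (\<forall>i. mp_vars (S i) \<subseteq> {..<n - 1}) \<and>
      (\<forall>c::nat \<Rightarrow> real. S_rel n c (\<lambda>i. mp_eval (S i) c))"
  have "\<exists>!S. ?P S"
  proof (rule ex_ex1I)
    show "\<exists>S. ?P S" by (rule S_exists[OF n])
  next
    fix S T assume S: "?P S" and T: "?P T"
    show "S = T"
    proof
      fix i
      show "S i = T i"
      proof (cases "i \<le> n")
        case True
        have "mp_eval (S i) c = mp_eval (T i) c" for c :: "nat \<Rightarrow> real"
          using S_rel_unique[of n c "\<lambda>i. mp_eval (S i) c" "\<lambda>i. mp_eval (T i) c" i] S T True by auto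
        thus ?thesis by (rule mp_eval_inject)
      qed (use S T in auto)
    qed
  qed
  from theI'[OF this] have "?P (S_poly n)" unfolding S_poly_def .
  thus "\<And>i. i > n \<Longrightarrow> S_poly n i = 0" "\<And>i. mp_vars (S_poly n i) \<subseteq> {..<n - 1}"
    "\<And>c. S_rel n c (\<lambda>i. mp_eval (S_poly n i) c)" by blast+
qed

text \<open>At j = 1 one has v = 0, and the identity reads off a coefficient of w^2 - w = a x^2 +
  a^2 x^4. So S_0(n) is a coefficient of a^2, of degree 2, and cannot affect linear parts.\<close>

lemma S_poly_0:
  assumes n: "n \<ge> 1"
  shows "S_poly n 0 = (if n \<ge> 3 then \<Sum>k\<le>n-3. Var k * Var (n - 3 - k) else 0)"
proof (rule mp_eval_inject)
  fix c :: "nat \<Rightarrow> real"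
  have "fps_nth (gser c 1) (Suc n) - fps_nth (gser c 0) (Suc n) = c (n - 1) + mp_eval (S_poly n 0) c + (\<Sum>i=1..n. mp_eval (S_poly n i) c * 0 ^ i)"
    using S_poly_props(3)[OF n, of c] S_rel_lhs[OF n, of 1 c] unfolding S_rel_def
    by (auto dest!: spec[of _ 1] simp: S_rel_lhs)
  also have "(\<Sum>i=1..n. mp_eval (S_poly n i) c * 0 ^ i) = 0" by (intro sum.neutral) auto
  also have "fps_nth (gser c 1) (Suc n) - fps_nth (gser c 0) (Suc n) = (\<Sum>k\<le>n - 1. c k * fps_nth (gser c 0) (n - 1 - k))"
    using gser_nth_rec[of c 0 n] n by simp
  also have "\<dots> = (\<Sum>k\<le>n - 1. (if k = n - 1 then c (n - 1) else 0) + (if k + 3 \<le> n then c k * c (n - 3 - k) else 0))"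
    by (intro sum.cong refl) (use n in \<open>auto simp: gser_nth_at_0 numeral_3_eq_3\<close>)
  also have "\<dots> = c (n - 1) + (\<Sum>k\<le>n - 1. if k + 3 \<le> n then c k * c (n - 3 - k) else 0)"
    by (simp add: sum.distrib)
  finally have "mp_eval (S_poly n 0) c = (\<Sum>k\<le>n - 1. if k + 3 \<le> n then c k * c (n - 3 - k) else 0)" by simp
  also have "\<dots> = mp_eval (if n \<ge> 3 then \<Sum>k\<le>n-3. Var k * Var (n - 3 - k) else 0) c"
  proof (cases "n \<ge> 3")
    case True
    have "(\<Sum>k\<le>n - 1. if k + 3 \<le> n then c k * c (n - 3 - k) else 0) = (\<Sum>k\<le>n - 3. c k * c (n - 3 - k))"
      by (rule sum.mono_neutral_cong_right) (use True in auto)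
    thus ?thesis using True by simp
  qed (auto intro!: sum.neutral)
  finally show "mp_eval (S_poly n 0) c = mp_eval (if n \<ge> 3 then \<Sum>k\<le>n-3. Var k * Var (n - 3 - k) else 0) c" .
qed

lemma S_poly_0_lin: "n \<ge> 1 \<Longrightarrow> c0 (S_poly n 0) = 0" "n \<ge> 1 \<Longrightarrow> lin l (S_poly n 0) = 0"
  by (simp_all add: S_poly_0)

lemma S_poly_consts:
  assumes n: "n \<ge> 3"
  shows "c0 (S_poly n 1) = 2 * (-1) ^ Suc n * bernoulli (Suc n) / of_nat (Suc n)"
    "c0 (S_poly n 2) = (-1) ^ Suc n * bernoulli n / of_nat n - 3 * c0 (S_poly n 1)"
    "3 * (\<Sum>i=1..n. c0 (S_poly n i) * 2 ^ i) = (-1) ^ Suc n"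
proof -
  have "S_rel n (\<lambda>_. 0) (\<lambda>i. of_rat (c0 (S_poly n i)))"
    using S_poly_props(3)[of n "\<lambda>_. 0"] n by (simp add: c0_mp_eval)
  note v = S_rel_0_values[OF this n]
  have "(of_rat (c0 (S_poly n 1)) :: real) = of_rat (2 * (-1) ^ Suc n * bernoulli (Suc n) / of_nat (Suc n))"
    unfolding v(2) by (simp add: of_rat_mult of_rat_divide of_rat_power of_rat_minus of_rat_add)
  thus "c0 (S_poly n 1) = 2 * (-1) ^ Suc n * bernoulli (Suc n) / of_nat (Suc n)" by (simp only: of_rat_eq_iff)
  have "(of_rat (c0 (S_poly n 2)) :: real) = of_rat ((-1) ^ Suc n * bernoulli n / of_nat n - 3 * c0 (S_poly n 1))"
    unfolding v(3) by (simp add: of_rat_mult of_rat_divide of_rat_power of_rat_minus of_rat_diff)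
  thus "c0 (S_poly n 2) = (-1) ^ Suc n * bernoulli n / of_nat n - 3 * c0 (S_poly n 1)" by (simp only: of_rat_eq_iff)
  have "(of_rat (3 * (\<Sum>i=1..n. c0 (S_poly n i) * 2 ^ i)) :: real) = of_rat ((-1) ^ Suc n)"
    using v(4) by (simp add: of_rat_mult of_rat_sum of_rat_power of_rat_minus)
  thus "3 * (\<Sum>i=1..n. c0 (S_poly n i) * 2 ^ i) = (-1) ^ Suc n" by (simp only: of_rat_eq_iff)
qed

section \<open>Convolutions of divisor sums\<close>


definition divpairs :: "int \<Rightarrow> (int \<times> int) set" where
  "divpairs n = {(d, e). d > 0 \<and> e > 0 \<and> d * e = n}"

definition quads :: "int \<Rightarrow> (int \<times> int \<times> int \<times> int) set" where
  "quads n = {(a, b, x, y). a > 0 \<and> b > 0 \<and> x > 0 \<and> y > 0 \<and> a * x + b * y = n}"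

lemma finite_divpairs [simp]: "finite (divpairs n)"
proof (rule finite_subset)
  show "divpairs n \<subseteq> {1..n} \<times> {1..n}"
    by (auto simp: divpairs_def mult_le_cancel_left1 mult_le_cancel_right1)
qed auto

lemma finite_quads [simp]: "finite (quads n)"
proof (rule finite_subset)
  show "quads n \<subseteq> {1..n} \<times> {1..n} \<times> {1..n} \<times> {1..n}"
  proof
    fix q assume "q \<in> quads n"
    then obtain a b x y where q: "q = (a, b, x, y)" and pos: "a > 0" "b > 0" "x > 0" "y > 0" "a * x + b * y = n"
      by (auto simp: quads_def)
    have "a \<le> a * x" "x \<le> a * x" "b \<le> b * y" "y \<le> b * y"
      using pos by (auto simp: mult_le_cancel_left1 mult_le_cancel_right1)
    moreover have "a * x > 0" "b * y > 0" using pos by auto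
    ultimately have "a \<le> n" "b \<le> n" "x \<le> n" "y \<le> n"
      using pos(5) by linarith+
    thus "q \<in> {1..n} \<times> {1..n} \<times> {1..n} \<times> {1..n}"
      using pos(1-4) by (simp add: q)
  qed
qed auto

lemma sum_divpairs_swap: "(\<Sum>(d, e)\<in>divpairs n. f d e) = (\<Sum>(d, e)\<in>divpairs n. f e d)"
  by (rule sum.reindex_bij_witness[of _ "\<lambda>(d, e). (e, d)" "\<lambda>(d, e). (e, d)"])
     (auto simp: divpairs_def mult.commute)

lemma sum_quads_swap:
  fixes f :: "int \<Rightarrow> int \<Rightarrow> int \<Rightarrow> int \<Rightarrow> 'a::comm_monoid_add"
  shows "(\<Sum>(a, b, x, y)\<in>quads n. f a b x y) = (\<Sum>(a, b, x, y)\<in>quads n. f a y x b)"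
  by (rule sum.reindex_bij_witness[of _ "\<lambda>(a, b, x, y). (a, y, x, b)" "\<lambda>(a, b, x, y). (a, y, x, b)"])
     (auto simp: quads_def algebra_simps)

section \<open>Folding sums over a x + b y = n onto the part a > b\<close>

definition upper_sum :: "int \<Rightarrow> (int \<Rightarrow> int \<Rightarrow> int \<Rightarrow> int \<Rightarrow> int) \<Rightarrow> int" where
  "upper_sum n f = (\<Sum>(a, b, x, y)\<in>{(a, b, x, y)\<in>quads n. a > b}. f a b x y)"

text \<open>The map preserves the equation, as (x + y) b + x (a - b) = a x + b y, keeps the first
  entry above the second, and is its own inverse. It is a bijection in the style of
  Liouville.\<close>

lemma upper_sum_involution: "upper_sum n f = upper_sum n (\<lambda>a b x y. f (x + y) x b (a - b))"
  unfolding upper_sum_def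
  by (rule sum.reindex_bij_witness[of _ "\<lambda>(a, b, x, y). (x + y, x, b, a - b)" "\<lambda>(a, b, x, y). (x + y, x, b, a - b)"])
     (auto simp: quads_def algebra_simps)

lemma upper_sum_add: "upper_sum n (\<lambda>a b x y. f a b x y + g a b x y) = upper_sum n f + upper_sum n g"
  by (simp add: upper_sum_def sum.distrib case_prod_beta)

lemma upper_sum_diff: "upper_sum n (\<lambda>a b x y. f a b x y - g a b x y) = upper_sum n f - upper_sum n g"
  by (simp add: upper_sum_def sum_subtractf case_prod_beta)

lemma sum_quads_diag:
  "(\<Sum>(a, b, x, y)\<in>{(a, b, x, y)\<in>quads n. a = b}. f a b x y) = (\<Sum>(d, e)\<in>divpairs n. \<Sum>x\<in>{1..<e}. f d d x (e - x))"
proof -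
  have "(\<Sum>(d, e)\<in>divpairs n. \<Sum>x\<in>{1..<e}. f d d x (e - x)) = (\<Sum>(p, x)\<in>Sigma (divpairs n) (\<lambda>(d, e). {1..<e}). f (fst p) (fst p) x (snd p - x))"
    by (subst sum.Sigma [symmetric]) (auto simp: case_prod_beta)
  also have "\<dots> = (\<Sum>(a, b, x, y)\<in>{(a, b, x, y)\<in>quads n. a = b}. f a b x y)"
    by (rule sum.reindex_bij_witness[of _ "\<lambda>(a, b, x, y). ((a, x + y), x)" "\<lambda>((d, e), x). (d, d, x, e - x)"])
       (auto simp: quads_def divpairs_def algebra_simps)
  finally show ?thesis ..
qed

lemma sum_quads_split:
  "(\<Sum>(a, b, x, y)\<in>quads n. f a b x y) =
     upper_sum n (\<lambda>a b x y. f a b x y + f b a y x) + (\<Sum>(d, e)\<in>divpairs n. \<Sum>x\<in>{1..<e}. f d d x (e - x))"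
proof -
  let ?U = "{(a, b, x, y)\<in>quads n. a > b}" and ?E = "{(a, b, x, y)\<in>quads n. a = b}" and ?L = "{(a, b, x, y)\<in>quads n. a < b}"
  have fin: "finite ?U" "finite ?E" "finite ?L" by (rule finite_subset[OF _ finite_quads[of n]]; auto)+
  have "quads n = ?U \<union> (?L \<union> ?E)" by auto
  hence "(\<Sum>(a, b, x, y)\<in>quads n. f a b x y) = (\<Sum>(a, b, x, y)\<in>?U \<union> (?L \<union> ?E). f a b x y)" by (rule arg_cong)
  also have "\<dots> = (\<Sum>(a, b, x, y)\<in>?U. f a b x y) + (\<Sum>(a, b, x, y)\<in>?L \<union> ?E. f a b x y)"
    by (rule sum.union_disjoint) (use fin in auto)
  also have "(\<Sum>(a, b, x, y)\<in>?L \<union> ?E. f a b x y) = (\<Sum>(a, b, x, y)\<in>?L. f a b x y) + (\<Sum>(a, b, x, y)\<in>?E. f a b x y)"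
    by (rule sum.union_disjoint) (use fin in auto)
  also have "(\<Sum>(a, b, x, y)\<in>?L. f a b x y) = (\<Sum>(a, b, x, y)\<in>?U. f b a y x)"
    by (rule sum.reindex_bij_witness[of _ "\<lambda>(a, b, x, y). (b, a, y, x)" "\<lambda>(a, b, x, y). (b, a, y, x)"])
       (auto simp: quads_def algebra_simps)
  finally show ?thesis
    unfolding upper_sum_add sum_quads_diag by (simp only: upper_sum_def add.assoc)
qed

text \<open>The folding is preceded by the symmetry (a, b, x, y) \<mapsto> (y, x, b, a), so it
  compares x with y instead of a with b. Two foldings of one sum yield a relation among sums over a
  > b.\<close>

lemma sum_quads_split':
  "(\<Sum>(a, b, x, y)\<in>quads n. f a b x y) =
     upper_sum n (\<lambda>a b x y. f y x b a + f x y a b) + (\<Sum>(d, e)\<in>divpairs n. \<Sum>a\<in>{1..<d}. f (d - a) a e e)"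
proof -
  have "(\<Sum>(a, b, x, y)\<in>quads n. f a b x y) = (\<Sum>(a, b, x, y)\<in>quads n. f y x b a)"
    by (rule sum.reindex_bij_witness[of _ "\<lambda>(a, b, x, y). (y, x, b, a)" "\<lambda>(a, b, x, y). (y, x, b, a)"])
       (auto simp: quads_def algebra_simps)
  also have "\<dots> = upper_sum n (\<lambda>a b x y. f y x b a + f x y a b) + (\<Sum>(d, e)\<in>divpairs n. \<Sum>x\<in>{1..<e}. f (e - x) x d d)"
    by (subst sum_quads_split) simp
  also have "(\<Sum>(d, e)\<in>divpairs n. \<Sum>x\<in>{1..<e}. f (e - x) x d d) = (\<Sum>(d, e)\<in>divpairs n. \<Sum>a\<in>{1..<d}. f (d - a) a e e)"
    by (rule sum_divpairs_swap)
  finally show ?thesis .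
qed

text \<open>A full sum collapses to divisor sums once its summand is a coboundary for the involution
  \<open>(a, b, x, y) \<mapsto> (x + y, x, b, a - b)\<close> of the part \<open>a > b\<close>, up to the discrepancy between the two ways
  of folding a full sum onto that part.\<close>
lemma sum_quads_collapse:
  fixes f g h :: "int \<Rightarrow> int \<Rightarrow> int \<Rightarrow> int \<Rightarrow> int"
  assumes "\<And>a b x y. g a b x y + g b a y x = f a b x y - f (x + y) x b (a - b) +
     (h a b x y + h b a y x) - (h y x b a + h x y a b)"
  shows "(\<Sum>(a, b, x, y)\<in>quads n. g a b x y) =
     (\<Sum>(d, e)\<in>divpairs n. (\<Sum>x\<in>{1..<e}. g d d x (e - x) - h d d x (e - x)) + (\<Sum>a\<in>{1..<d}. h (d - a) a e e))"
proof -
  have "(\<Sum>(a, b, x, y)\<in>quads n. g a b x y) = upper_sum n (\<lambda>a b x y. h a b x y + h b a y x) - 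
      upper_sum n (\<lambda>a b x y. h y x b a + h x y a b) + (\<Sum>(d, e)\<in>divpairs n. \<Sum>x\<in>{1..<e}. g d d x (e - x))"
    unfolding sum_quads_split[of g] assms upper_sum_add upper_sum_diff
    using upper_sum_involution[of n f] by simp
  also have "upper_sum n (\<lambda>a b x y. h a b x y + h b a y x) = 
     upper_sum n (\<lambda>a b x y. h y x b a + h x y a b) + (\<Sum>(d, e)\<in>divpairs n. \<Sum>a\<in>{1..<d}. h (d - a) a e e)
      - (\<Sum>(d, e)\<in>divpairs n. \<Sum>x\<in>{1..<e}. h d d x (e - x))"
    using sum_quads_split[of h n] sum_quads_split'[of h n] by linarith
  finally show ?thesis
    by (simp add: case_prod_beta sum.distrib sum_subtractf)
qed

lemma sum_int_induct:
  fixes f F :: "int \<Rightarrow> int"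
  assumes "F 1 = 0" "\<And>e. e \<ge> 1 \<Longrightarrow> F (e + 1) = F e + f e" "e \<ge> 1"
  shows "(\<Sum>x\<in>{1..<e}. f x) = F e"
  using assms(3)
proof (induction e rule: int_ge_induct)
  case (step e)
  hence "{1..<e + 1} = insert e {1..<e}" by auto
  thus ?case using step assms(2)[of e] by simp
qed (use assms(1) in simp)

definition dsum :: "nat \<Rightarrow> nat \<Rightarrow> nat" where
  "dsum r n = (\<Sum>d\<in>{d. d dvd n}. d ^ r)"

text \<open>The divisors of 0 form an infinite set, so the sum takes its default value 0. This
  removes the boundary terms k = 0 and k = n of the convolutions.\<close>

lemma dsum_0 [simp]: "dsum r 0 = 0"
  by (simp add: dsum_def)

lemma sigma_eq_dsum: "sigma n = dsum 1 n"
  by (simp add: sigma_def dsum_def)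

lemma dsum_divpairs: "int (dsum r n) = (\<Sum>(d, e)\<in>divpairs (int n). d ^ r)"
proof (cases "n = 0")
  case True
  have "divpairs 0 = {}" by (auto simp: divpairs_def)
  thus ?thesis using True by simp
next
  case False
  have "int (dsum r n) = (\<Sum>d\<in>{d. d dvd n}. int d ^ r)"
    by (simp add: dsum_def)
  also have "\<dots> = (\<Sum>(d, e)\<in>divpairs (int n). d ^ r)"
  proof (rule sum.reindex_bij_witness[of _ "\<lambda>(d, e). nat d" "\<lambda>d. (int d, int (n div d))"])
    fix p assume "p \<in> divpairs (int n)"
    then obtain d e where p: "p = (d, e)" "d > 0" "e > 0" "d * e = int n" by (auto simp: divpairs_def)
    then obtain d' e' where de: "d = int d'" "e = int e'" by (metis nonneg_int_cases order_less_imp_le)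
    hence n: "n = d' * e'" using p(4) by (metis of_nat_eq_iff of_nat_mult)
    thus "(case p of (d, e) \<Rightarrow> nat d) \<in> {d. d dvd n}"
      "(int (case p of (d, e) \<Rightarrow> nat d), int (n div (case p of (d, e) \<Rightarrow> nat d))) = p"
      using p de by auto
  qed (use False in \<open>auto simp: divpairs_def of_nat_mult [symmetric] simp del: of_nat_mult intro: Nat.gr0I\<close>)
  finally show ?thesis .
qed

lemma dsum_convolution:
  "(\<Sum>k\<le>n. F (int k) (int (n - k)) * int (dsum r k) * int (dsum s (n - k))) =
     (\<Sum>(a, b, x, y)\<in>quads (int n). F (a * x) (b * y) * a ^ r * b ^ s)"
proof -
  have "(\<Sum>k\<le>n. F (int k) (int (n - k)) * int (dsum r k) * int (dsum s (n - k))) =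
     (\<Sum>k\<le>n. \<Sum>(p, q)\<in>divpairs (int k) \<times> divpairs (int (n - k)). F (int k) (int (n - k)) * fst p ^ r * fst q ^ s)"
  proof (intro sum.cong refl)
    fix k
    have "F (int k) (int (n - k)) * int (dsum r k) * int (dsum s (n - k)) =
        (\<Sum>p\<in>divpairs (int k). \<Sum>q\<in>divpairs (int (n - k)). F (int k) (int (n - k)) * fst p ^ r * fst q ^ s)"
      unfolding dsum_divpairs case_prod_beta mult.assoc sum_product by (simp only: sum_distrib_left)
    thus "F (int k) (int (n - k)) * int (dsum r k) * int (dsum s (n - k)) =
        (\<Sum>(p, q)\<in>divpairs (int k) \<times> divpairs (int (n - k)). F (int k) (int (n - k)) * fst p ^ r * fst q ^ s)"
      by (simp only: sum.cartesian_product)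
  qed
  also have "\<dots> = (\<Sum>(k, (p, q))\<in>Sigma {..n} (\<lambda>k. divpairs (int k) \<times> divpairs (int (n - k))). F (int k) (int (n - k)) * fst p ^ r * fst q ^ s)"
    by (subst sum.Sigma) (auto simp: case_prod_beta)
  also have "\<dots> = (\<Sum>(a, b, x, y)\<in>quads (int n). F (a * x) (b * y) * a ^ r * b ^ s)"
  proof (rule sum.reindex_bij_witness[of _ "\<lambda>(a, b, x, y). (nat (a * x), ((a, x), (b, y)))" "\<lambda>(k, ((a, x), (b, y))). (a, b, x, y)"])
    fix q assume "q \<in> quads (int n)"
    then obtain a b x y where q: "q = (a, b, x, y)" "a > 0" "b > 0" "x > 0" "y > 0" "a * x + b * y = int n"
      by (auto simp: quads_def)
    have "a * x > 0" "b * y > 0" using q by auto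
    hence "int (nat (a * x)) = a * x" "nat (a * x) \<le> n" using q(6) by linarith+
    hence "int (nat (a * x)) = a * x" "nat (a * x) \<le> n" "b * y = int (n - nat (a * x))"
      using q(6) by (auto simp: of_nat_diff)
    thus "(case q of (a, b, x, y) \<Rightarrow> (nat (a * x), (a, x), b, y)) \<in> Sigma {..n} (\<lambda>k. divpairs (int k) \<times> divpairs (int (n - k)))"
      using q by (simp add: divpairs_def)
  qed (auto simp: divpairs_def quads_def of_nat_diff)
  finally show ?thesis .
qed

section \<open>Three convolution identities\<close>

text \<open>The coefficient form of 12 \<theta> P = P^2 - Q.\<close>

lemma dsum_1_1_convolution:
  "12 * (\<Sum>k\<le>n. int (dsum 1 k) * int (dsum 1 (n - k))) = 5 * int (dsum 3 n) + (1 - 6 * int n) * int (dsum 1 n)"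
proof -
  have "12 * (\<Sum>k\<le>n. int (dsum 1 k) * int (dsum 1 (n - k))) = 6 * (\<Sum>(a, b, x, y)\<in>quads (int n). 2 * a * b)"
    using dsum_convolution[where F = "\<lambda>_ _. 2" and r = 1 and s = 1 and n = n] by (simp add: sum_distrib_left [symmetric] mult.assoc)
  also have "(\<Sum>(a, b, x, y)\<in>quads (int n). 2 * a * b) = 
     (\<Sum>(d, e)\<in>divpairs (int n). (\<Sum>x\<in>{1..<e}. 2 * d * d - (2 * d^2 + d * d)) + (\<Sum>a\<in>{1..<d}. 2 * a^2 + (d - a) * a))"
    \<comment> \<open>\<open>f\<close> and \<open>h\<close> are a certificate: the hypothesis of the
      collapse becomes a polynomial identity. The factor 2 in the summand keeps the certificate
      integral.\<close>
    by (rule sum_quads_collapse[where f = "\<lambda>a b x y. - 2 * b^2 + 2 * a * b - 2 * a^2" and h = "\<lambda>a b x y. 2 * b^2 + a * b"]) algebra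
  also have "6 * \<dots> = (\<Sum>(d, e)\<in>divpairs (int n). 5 * d ^ 3 + (1 - 6 * int n) * d ^ 1)"
    unfolding sum_distrib_left
  proof (intro sum.cong refl, clarify)
    fix d e assume "(d, e) \<in> divpairs (int n)"
    hence de: "d > 0" "e > 0" "int n = d * e" by (auto simp: divpairs_def)
    have 1: "(\<Sum>x\<in>{1..<e}. 2 * d * d - (2 * d^2 + d * d)) = - (d ^ 2) * (e - 1)"
      using de by (simp add: power2_eq_square)
    \<comment> \<open>The upper limit gets its own name because the summand depends on d as well;
      the induction moves only the limit.\<close>
    have "(\<Sum>a\<in>{1..<d'}. 6 * (2 * a^2 + (d - a) * a)) = (d' - 1) * d' * (2 * d' - 1) + 3 * d * d' * (d' - 1)" if "d' \<ge> 1" for d'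
      by (rule sum_int_induct[OF _ _ that]) (simp, algebra)
    from this[of d] have 2: "6 * (\<Sum>a\<in>{1..<d}. 2 * a^2 + (d - a) * a) = (d - 1) * d * (2 * d - 1) + 3 * d * d * (d - 1)"
      using de by (simp add: sum_distrib_left)
    show "6 * ((\<Sum>x\<in>{1..<e}. 2 * d * d - (2 * d^2 + d * d)) + (\<Sum>a\<in>{1..<d}. 2 * a^2 + (d - a) * a)) = 5 * d ^ 3 + (1 - 6 * int n) * d ^ 1"
      unfolding distrib_left 1 2 de by (simp add: algebra_simps power2_eq_square power3_eq_cube)
  qed
  also have "\<dots> = 5 * int (dsum 3 n) + (1 - 6 * int n) * int (dsum 1 n)"
    unfolding dsum_divpairs by (simp add: case_prod_beta sum.distrib sum_distrib_left)
  finally show ?thesis .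
qed

text \<open>The coefficient form of 3 \<theta> Q = P Q - R.\<close>

lemma dsum_1_3_convolution:
  "240 * (\<Sum>k\<le>n. int (dsum 1 k) * int (dsum 3 (n - k))) = 21 * int (dsum 5 n) + (10 - 30 * int n) * int (dsum 3 n) - int (dsum 1 n)"
proof -
  have "240 * (\<Sum>k\<le>n. int (dsum 1 k) * int (dsum 3 (n - k))) = 30 * (\<Sum>(a, b, x, y)\<in>quads (int n). 8 * a * b ^ 3)"
    using dsum_convolution[where F = "\<lambda>_ _. 8" and r = 1 and s = 3 and n = n] by (simp add: sum_distrib_left [symmetric] mult.assoc)
  also have "(\<Sum>(a, b, x, y)\<in>quads (int n). 8 * a * b ^ 3) = 
     (\<Sum>(d, e)\<in>divpairs (int n). (\<Sum>x\<in>{1..<e}. 8 * d * d ^ 3 - (2 * d^4 + 4 * d * d^3 + 3 * d^2 * d^2)) + 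
        (\<Sum>a\<in>{1..<d}. 2 * a^4 + 4 * (d - a) * a^3 + 3 * (d - a)^2 * a^2))"
    \<comment> \<open>A certificate of degree 4; the factor 8 in the summand clears its
      denominators.\<close>
    by (rule sum_quads_collapse[where f = "\<lambda>a b x y. - 2 * b^4 + 4 * a * b^3 - 6 * a^2 * b^2 + 4 * a^3 * b - 2 * a^4"
         and h = "\<lambda>a b x y. 2 * b^4 + 4 * a * b^3 + 3 * a^2 * b^2"]) algebra
  also have "30 * \<dots> = (\<Sum>(d, e)\<in>divpairs (int n). 21 * d ^ 5 + (10 - 30 * int n) * d ^ 3 - d ^ 1)"
    unfolding sum_distrib_left
  proof (intro sum.cong refl, clarify)
    fix d e assume "(d, e) \<in> divpairs (int n)"
    hence de: "d > 0" "e > 0" "int n = d * e" by (auto simp: divpairs_def)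
    have 1: "(\<Sum>x\<in>{1..<e}. 8 * d * d ^ 3 - (2 * d^4 + 4 * d * d^3 + 3 * d^2 * d^2)) = - (d ^ 4) * (e - 1)"
      using de by (simp add: power4_eq_xxxx power2_eq_square power3_eq_cube)
    have "(\<Sum>a\<in>{1..<d'}. 30 * (2 * a^4 + 4 * (d - a) * a^3 + 3 * (d - a)^2 * a^2)) = 
        (d' - 1) * d' * (2 * d' - 1) * (3 * d'^2 - 3 * d' - 1) - 15 * d * d'^2 * (d' - 1)^2 + 15 * d^2 * d' * (d' - 1) * (2 * d' - 1)" if "d' \<ge> 1" for d'
      by (rule sum_int_induct[OF _ _ that]) (simp, algebra)
    from this[of d] have 2: "30 * (\<Sum>a\<in>{1..<d}. 2 * a^4 + 4 * (d - a) * a^3 + 3 * (d - a)^2 * a^2) = 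
        (d - 1) * d * (2 * d - 1) * (3 * d^2 - 3 * d - 1) - 15 * d * d^2 * (d - 1)^2 + 15 * d^2 * d * (d - 1) * (2 * d - 1)"
      using de by (simp add: sum_distrib_left)
    show "30 * ((\<Sum>x\<in>{1..<e}. 8 * d * d ^ 3 - (2 * d^4 + 4 * d * d^3 + 3 * d^2 * d^2)) + 
        (\<Sum>a\<in>{1..<d}. 2 * a^4 + 4 * (d - a) * a^3 + 3 * (d - a)^2 * a^2)) = 21 * d ^ 5 + (10 - 30 * int n) * d ^ 3 - d ^ 1"
      unfolding distrib_left 1 2 de by algebra
  qed
  also have "\<dots> = 21 * int (dsum 5 n) + (10 - 30 * int n) * int (dsum 3 n) - int (dsum 1 n)"
    unfolding dsum_divpairs by (simp add: case_prod_beta sum.distrib sum_subtractf sum_distrib_left)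
  finally show ?thesis .
qed

text \<open>Van der Pol's identity. The weight is chosen such that no divisor sum of higher exponent
  remains on the right, which closes the system of derivatives of A_0.\<close>

lemma dsum_1_1_weighted_convolution:
  "12 * (\<Sum>k\<le>n. (5 * int k * int (n - k) - int n ^ 2) * int (dsum 1 k) * int (dsum 1 (n - k))) = int n ^ 2 * (int n - 1) * int (dsum 1 n)"
proof -
  let ?F = "\<lambda>k l :: int. 5 * k * l - (k + l)^2"
  define T where "T d e x = ?F (d * x) ((e - x) * d) * d * (e - x) - d^3 * x^2 * (e - x)" for d e x :: int
  have "(\<Sum>k\<le>n. (5 * int k * int (n - k) - int n ^ 2) * int (dsum 1 k) * int (dsum 1 (n - k))) =
      (\<Sum>k\<le>n. ?F (int k) (int (n - k)) * int (dsum 1 k) * int (dsum 1 (n - k)))"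
    by (intro sum.cong refl) (simp add: of_nat_diff)
  also have "\<dots> = (\<Sum>(a, b, x, y)\<in>quads (int n). ?F (a * x) (b * y) * a * b)"
    using dsum_convolution[where F = ?F and r = 1 and s = 1 and n = n] by simp
  \<comment> \<open>Exchanging the divisor b with its cofactor y keeps the sum but alters the
    summand; the certificate below is for the altered one.\<close>
  also have "\<dots> = (\<Sum>(a, b, x, y)\<in>quads (int n). ?F (a * x) (y * b) * a * y)"
    by (rule sum_quads_swap)
  also have "\<dots> = (\<Sum>(d, e)\<in>divpairs (int n). (\<Sum>x\<in>{1..<e}. T d e x) + 
        (\<Sum>a\<in>{1..<d}. a^3 * e^2 * e))"
    unfolding T_def by (rule sum_quads_collapse[where h = "\<lambda>a b x y. b^3 * x^2 * y"
         and f = "\<lambda>a b x y. - 2 * b^3 * x * y^2 + b^3 * x^2 * y - a * b^2 * y^3 + 3 * a * b^2 * x * y^2 + a^2 * b * y^3"]) algebra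
  \<comment> \<open>Swapping d and e in the second part gives both inner sums the same range, so
    that they merge.\<close>
  also have "\<dots> = (\<Sum>(d, e)\<in>divpairs (int n). \<Sum>x\<in>{1..<e}. T d e x) + 
        (\<Sum>(d, e)\<in>divpairs (int n). \<Sum>a\<in>{1..<e}. a^3 * d^2 * d)"
    unfolding sum_divpairs_swap[of "\<lambda>d e. \<Sum>a\<in>{1..<e}. a^3 * d^2 * d"] by (simp add: case_prod_beta sum.distrib)
  also have "\<dots> = (\<Sum>(d, e)\<in>divpairs (int n). (\<Sum>x\<in>{1..<e}. T d e x) + 
        (\<Sum>a\<in>{1..<e}. a^3 * d^2 * d))"
    by (subst sum.distrib [symmetric], rule sum.cong[OF refl]) (simp only: case_prod_beta)
  also have "12 * \<dots> = (\<Sum>(d, e)\<in>divpairs (int n). int n ^ 3 * e - int n ^ 2 * d)"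
    unfolding sum_distrib_left
  proof (intro sum.cong refl, clarify)
    fix d e assume "(d, e) \<in> divpairs (int n)"
    hence de: "d > 0" "e > 0" "int n = d * e" by (auto simp: divpairs_def)
    have S: "(\<Sum>x\<in>{1..<e'}. 12 * T d e x + 12 * (x^3 * d^2 * d)) =
        d^3 * (-12 * e^3 * (e' - 1) + 36 * e^2 * e' * (e' - 1) - 22 * e * (e' - 1) * e' * (2 * e' - 1) + 21 * e'^2 * (e' - 1)^2)" 
      if "e' \<ge> 1" for e'
      by (rule sum_int_induct[OF _ _ that]) (simp, unfold T_def, algebra)
    have "(\<Sum>x\<in>{1..<e}. 12 * T d e x + 12 * (x^3 * d^2 * d)) =
        d^3 * (-12 * e^3 * (e - 1) + 36 * e^2 * e * (e - 1) - 22 * e * (e - 1) * e * (2 * e - 1) + 21 * e^2 * (e - 1)^2)"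
      by (rule S) (use de(2) in simp)
    also have "d^3 * (-12 * e^3 * (e - 1) + 36 * e^2 * e * (e - 1) - 22 * e * (e - 1) * e * (2 * e - 1) + 21 * e^2 * (e - 1)^2) =
        (d * e) ^ 3 * e - (d * e) ^ 2 * d"
      by (simp add: algebra_simps power2_eq_square power3_eq_cube)
    finally have "(\<Sum>x\<in>{1..<e}. 12 * T d e x + 12 * (x^3 * d^2 * d)) =
        int n ^ 3 * e - int n ^ 2 * d"
      by (simp only: de(3))
    thus "12 * ((\<Sum>x\<in>{1..<e}. T d e x) + 
        (\<Sum>a\<in>{1..<e}. a^3 * d^2 * d)) = int n ^ 3 * e - int n ^ 2 * d"
      by (simp add: sum_distrib_left sum.distrib)
  qed
  also have "\<dots> = int n ^ 3 * (\<Sum>(d, e)\<in>divpairs (int n). e) - int n ^ 2 * (\<Sum>(d, e)\<in>divpairs (int n). d)"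
    by (simp add: case_prod_beta sum_subtractf sum_distrib_left)
  also have "(\<Sum>(d, e)\<in>divpairs (int n). e) = (\<Sum>(d, e)\<in>divpairs (int n). d)"
    by (rule sum_divpairs_swap)
  also have "(\<Sum>(d, e)\<in>divpairs (int n). d) = int (dsum 1 n)"
    by (simp add: dsum_divpairs)
  also have "int n ^ 3 * int (dsum 1 n) - int n ^ 2 * int (dsum 1 n) = int n ^ 2 * (int n - 1) * int (dsum 1 n)"
    by (simp add: algebra_simps power2_eq_square power3_eq_cube)
  finally show ?thesis .
qed

section \<open>Linear parts and the Chazy equation\<close>


lemma finite_mp_vars [simp]: "finite (mp_vars p)"
  by (simp add: mp_vars_def)

lemma c0_Pp [simp]: "c0 (Pp m) = 0"
  by (cases m) simp_all

lemma lin_Pp: "lin l (Pp m) = (if l = m then 1 else 0)"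
proof (induction m arbitrary: l)
  case (Suc m)
  thus ?case by (simp add: lin_D split: nat.splits)
qed simp

lemma length_Chat_list [simp]: "length (Chat_list m) = m"
  by (induction m) (simp_all add: Let_def)

lemma Chat_Suc:
  "Chat (Suc m) = - mp_subst (S_poly (Suc m) 0) (\<lambda>k. if k < m then Chat_list m ! k else 0) +
     (\<Sum>i=1..Suc m. mp_const (3 * 2 ^ i) * mp_subst (S_poly (Suc m) i) (\<lambda>k. if k < m then Chat_list m ! k else 0) * P i)"
  by (simp add: Chat_def Let_def nth_append)

lemma c0_Chat_list: "k < m \<Longrightarrow> c0 (Chat_list m ! k) = 0"
proof (induction m arbitrary: k)
  case (Suc m)
  let ?\<sigma> = "\<lambda>k. if k < m then Chat_list m ! k else 0"
  have *: "c0 (?\<sigma> k) = 0" for k using Suc.IH by simp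
  show ?case
  proof (cases "k < m")
    case True
    thus ?thesis using Suc.IH by (simp add: Let_def nth_append)
  next
    case False
    hence "k = m" using Suc.prems by simp
    hence "Chat_list (Suc m) ! k = Chat (Suc m)" by (simp add: Chat_def)
    thus ?thesis
      unfolding Chat_Suc by (simp add: c0_subst[OF *] S_poly_0_lin P_def del: sum.cl_ivl_Suc)
  qed
qed simp

lemma c0_Chat: "m \<ge> 1 \<Longrightarrow> c0 (Chat m) = 0"
  unfolding Chat_def by (rule c0_Chat_list) simp

text \<open>Neither the \<open>Chat\<close> nor the P_i have constant terms, so to first order
  S_i(n) counts only with its constant term and P_i with its linear part X_(i-1); S_0(n) drops
  out.\<close>

lemma lin_Chat:
  assumes m: "m \<ge> 1"
  shows "lin l (Chat m) = (if l < m then 3 * 2 ^ Suc l * c0 (S_poly m (Suc l)) else 0)"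
proof -
  obtain n where n: "m = Suc n" using m by (cases m) auto
  let ?\<sigma> = "\<lambda>k. if k < n then Chat_list n ! k else 0"
  have *: "c0 (?\<sigma> k) = 0" for k using c0_Chat_list by simp
  have "lin l (mp_subst (S_poly m 0) ?\<sigma>) = 0"
    using lin_subst[OF *, of "mp_vars (S_poly m 0)" "S_poly m 0" l] m by (simp add: S_poly_0_lin)
  hence "lin l (Chat m) = (\<Sum>i=1..m. 3 * 2 ^ i * c0 (S_poly m i) * lin l (P i))"
    unfolding n Chat_Suc by (simp add: c0_subst[OF *] P_def del: sum.cl_ivl_Suc)
  also have "\<dots> = (\<Sum>i=1..m. if i = Suc l then 3 * 2 ^ Suc l * c0 (S_poly m (Suc l)) else 0)"
    by (intro sum.cong refl) (auto simp: P_def lin_Pp)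
  finally show ?thesis by simp
qed

section \<open>Power series of divisor sums\<close>

text \<open>Keeping the field general lets the same identities serve the real functions A_i and the
  complex Eisenstein series.\<close>

definition divisor_fps :: "nat \<Rightarrow> nat \<Rightarrow> 'a::{real_normed_field, banach} fps" where
  "divisor_fps r i = Abs_fps (\<lambda>n. of_nat (n ^ i * dsum r n))"

lemma dsum_le: "dsum r n \<le> n ^ Suc r"
proof (cases "n = 0")
  case False
  have "dsum r n \<le> (\<Sum>d\<in>{d. d dvd n}. n ^ r)"
    unfolding dsum_def using False by (intro sum_mono power_mono) (auto intro: dvd_imp_le)
  also have "\<dots> = card {d. d dvd n} * n ^ r" by simp
  also have "card {d. d dvd n} \<le> card {1..n}"
    by (rule card_mono) (use False in \<open>auto intro: dvd_imp_le Nat.gr0I\<close>)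
  finally show ?thesis by (simp add: mult_right_mono)
qed simp

lemma conv_radius_of_nat_power: "conv_radius (\<lambda>n. of_nat (Suc n) ^ k :: real) = 1"
proof -
  have "(\<lambda>n. ereal (norm (of_nat (Suc n) ^ k :: real) / norm (of_nat (Suc (Suc n)) ^ k :: real))) \<longlonglongrightarrow> ereal 1"
    unfolding lim_ereal by (simp add: power_divide [symmetric] del: power_Suc) real_asymp
  from conv_radius_ratio_limit_ereal[of "\<lambda>n. of_nat (Suc n) ^ k :: real", OF _ this]
  show ?thesis by (simp add: one_ereal_def)
qed

lemma norm_less_conv_radius_if_poly_growth:
  fixes F :: "'a::{real_normed_field, banach} fps"
  assumes F: "\<And>n. norm (fps_nth F n) \<le> of_nat (Suc n) ^ k" and z: "norm z < 1"
  shows "ereal (norm z) < fps_conv_radius F"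
proof -
  have "fps_conv_radius F \<ge> 1"
    unfolding fps_conv_radius_def
  proof (rule conv_radius_geI_ex)
    fix s :: real assume s: "0 < s" "ereal s < 1"
    hence "summable (\<lambda>n. of_nat (Suc n) ^ k * s ^ n :: real)"
      by (intro summable_in_conv_radius, subst conv_radius_of_nat_power) simp
    moreover have "norm (fps_nth F n * of_real s ^ n) \<le> of_nat (Suc n) ^ k * s ^ n" for n
      using s F[of n] by (simp add: norm_mult norm_power mult_right_mono)
    ultimately have "summable (\<lambda>n. fps_nth F n * of_real s ^ n)"
      by (rule summable_comparison_test'[of _ 0])
    thus "\<exists>z. norm z = s \<and> summable (\<lambda>n. fps_nth F n * z ^ n)"
      using s by (intro exI[of _ "of_real s"]) auto
  qed
  thus ?thesis using z by (metis less_le_trans less_ereal.simps(1) one_ereal_def)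
qed

lemma norm_less_conv_radius_divisor_fps:
  assumes "norm (z :: 'a::{real_normed_field, banach}) < 1"
  shows "ereal (norm z) < fps_conv_radius (divisor_fps r i :: 'a fps)"
proof (rule norm_less_conv_radius_if_poly_growth[OF _ assms])
  fix n
  have "n ^ i * dsum r n \<le> n ^ i * n ^ Suc r" by (intro mult_left_mono dsum_le) simp
  also have "\<dots> = n ^ (i + Suc r)" by (simp add: power_add)
  also have "\<dots> \<le> Suc n ^ (i + Suc r)" by (intro power_mono) auto
  finally have "real (n ^ i * dsum r n) \<le> real (Suc n ^ (i + Suc r))" by (simp only: of_nat_le_iff)
  thus "norm (fps_nth (divisor_fps r i :: 'a fps) n) \<le> of_nat (Suc n) ^ (i + Suc r)"
    by (simp only: divisor_fps_def fps_nth_Abs_fps norm_of_nat of_nat_power)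
qed

context
  fixes z :: "'a::{real_normed_field, banach}" and F G :: "'a fps"
  assumes F: "ereal (norm z) < fps_conv_radius F"
begin

lemma norm_less_conv_radius_mult [simp]:
  "ereal (norm z) < fps_conv_radius G \<Longrightarrow> ereal (norm z) < fps_conv_radius (F * G)"
  using fps_conv_radius_mult[of F G] F by (meson less_le_trans min_less_iff_conj)

lemma norm_less_conv_radius_add [simp]:
  "ereal (norm z) < fps_conv_radius G \<Longrightarrow> ereal (norm z) < fps_conv_radius (F + G)"
  using fps_conv_radius_add[of F G] F by (meson less_le_trans min_less_iff_conj)

lemma norm_less_conv_radius_diff [simp]:
  "ereal (norm z) < fps_conv_radius G \<Longrightarrow> ereal (norm z) < fps_conv_radius (F - G)"
  using fps_conv_radius_diff[of F G] F by (meson less_le_trans min_less_iff_conj)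

lemma norm_less_conv_radius_power [simp]: "ereal (norm z) < fps_conv_radius (F ^ n)"
  using F fps_conv_radius_power[of F n] by (rule less_le_trans)

lemma DERIV_eval_fps_divide:
  assumes "fps_X * fps_deriv F = G" "z \<noteq> 0"
  shows "(eval_fps F has_field_derivative eval_fps G z / z) (at z)"
proof -
  have "ereal (norm z) < fps_conv_radius (fps_deriv F)"
    using F fps_conv_radius_deriv[of F] by (rule less_le_trans)
  hence "eval_fps G z = z * eval_fps (fps_deriv F) z"
    unfolding assms(1) [symmetric] by (subst eval_fps_mult) auto
  thus ?thesis using has_field_derivative_eval_fps[OF F] assms(2) by simp
qed

end

definition divisor_ser :: "nat \<Rightarrow> nat \<Rightarrow> 'a::{real_normed_field, banach} \<Rightarrow> 'a" where
  "divisor_ser r i z = eval_fps (divisor_fps r i) z"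

lemma divisor_fps_deriv: "fps_X * fps_deriv (divisor_fps r i) = divisor_fps r (Suc i)"
proof (rule fps_ext)
  fix n show "fps_nth (fps_X * fps_deriv (divisor_fps r i)) n = fps_nth (divisor_fps r (Suc i)) n"
    by (cases n) (simp_all add: divisor_fps_def mult.assoc)
qed

lemma DERIV_divisor_ser:
  "norm z < 1 \<Longrightarrow> z \<noteq> 0 \<Longrightarrow> (divisor_ser r i has_field_derivative divisor_ser r (Suc i) z / z) (at z)"
  unfolding divisor_ser_def [abs_def]
  by (rule DERIV_eval_fps_divide[OF norm_less_conv_radius_divisor_fps divisor_fps_deriv])

lemma sums_divisor_ser: "norm z < 1 \<Longrightarrow> (\<lambda>n. fps_nth (divisor_fps r i) n * z ^ n) sums divisor_ser r i z"
  unfolding divisor_ser_def by (intro sums_eval_fps norm_less_conv_radius_divisor_fps)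

lemma A_eq_divisor_ser:
  assumes "norm q < 1"
  shows "A i q = divisor_ser 1 i q"
proof -
  have "(\<lambda>n. fps_nth (divisor_fps 1 i) (Suc n) * q ^ Suc n) sums (divisor_ser 1 i q - fps_nth (divisor_fps 1 i) 0 * q ^ 0)"
    using sums_divisor_ser[OF assms] by (subst sums_Suc_iff) auto
  thus ?thesis
    unfolding A_def by (simp add: sums_iff divisor_fps_def sigma_eq_dsum)
qed

lemma divisor_fps_chazy:
  "(divisor_fps 1 3 :: 'a::{real_normed_field, banach} fps) = divisor_fps 1 2 - 24 * (divisor_fps 1 0 * divisor_fps 1 2) + 36 * divisor_fps 1 1 ^ 2"
proof (rule fps_ext)
  fix n
  let ?\<sigma> = "\<lambda>k. int (dsum 1 k)"
  have flip: "(\<Sum>k\<le>n. int k ^ 2 * ?\<sigma> k * ?\<sigma> (n - k)) = (\<Sum>k\<le>n. ?\<sigma> k * (int (n - k) ^ 2 * ?\<sigma> (n - k)))"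
    by (rule sum.reindex_bij_witness[of _ "\<lambda>k. n - k" "\<lambda>k. n - k"]) auto
  have "int n ^ 2 * (int n - 1) * ?\<sigma> n = 12 * (\<Sum>k\<le>n. (5 * int k * int (n - k) - int n ^ 2) * ?\<sigma> k * ?\<sigma> (n - k))"
    by (rule dsum_1_1_weighted_convolution [symmetric])
  \<comment> \<open>With n = k + l the weight 5 k l - n^2 is 3 k l - k^2 - l^2, and the two squares
    contribute equally after reversing the sum.\<close>
  also have "(\<Sum>k\<le>n. (5 * int k * int (n - k) - int n ^ 2) * ?\<sigma> k * ?\<sigma> (n - k)) =
     (\<Sum>k\<le>n. 3 * ((int k * ?\<sigma> k) * (int (n - k) * ?\<sigma> (n - k))) - int k ^ 2 * ?\<sigma> k * ?\<sigma> (n - k) - ?\<sigma> k * (int (n - k) ^ 2 * ?\<sigma> (n - k)))"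
  proof (intro sum.cong refl)
    fix k assume "k \<in> {..n}"
    hence "int n = int k + int (n - k)" by simp
    thus "(5 * int k * int (n - k) - int n ^ 2) * ?\<sigma> k * ?\<sigma> (n - k) = 
       3 * ((int k * ?\<sigma> k) * (int (n - k) * ?\<sigma> (n - k))) - int k ^ 2 * ?\<sigma> k * ?\<sigma> (n - k) - ?\<sigma> k * (int (n - k) ^ 2 * ?\<sigma> (n - k))"
      by algebra
  qed
  also have "\<dots> = 3 * (\<Sum>k\<le>n. (int k * ?\<sigma> k) * (int (n - k) * ?\<sigma> (n - k))) - 2 * (\<Sum>k\<le>n. ?\<sigma> k * (int (n - k) ^ 2 * ?\<sigma> (n - k)))"
    unfolding sum_subtractf flip by (simp add: sum_distrib_left sum_negf)
  finally have *: "int n ^ 3 * ?\<sigma> n = int n ^ 2 * ?\<sigma> n - 24 * (\<Sum>k\<le>n. ?\<sigma> k * (int (n - k) ^ 2 * ?\<sigma> (n - k))) + 36 * (\<Sum>k\<le>n. (int k * ?\<sigma> k) * (int (n - k) * ?\<sigma> (n - k)))"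
    by (simp add: power2_eq_square power3_eq_cube algebra_simps)
  have "of_int (int n ^ 3 * ?\<sigma> n) = (of_int (int n ^ 2 * ?\<sigma> n - 24 * (\<Sum>k\<le>n. ?\<sigma> k * (int (n - k) ^ 2 * ?\<sigma> (n - k))) + 36 * (\<Sum>k\<le>n. (int k * ?\<sigma> k) * (int (n - k) * ?\<sigma> (n - k)))) :: 'a)"
    by (simp only: *)
  thus "fps_nth (divisor_fps 1 3 :: 'a fps) n = fps_nth (divisor_fps 1 2 - 24 * (divisor_fps 1 0 * divisor_fps 1 2) + 36 * divisor_fps 1 1 ^ 2) n"
    unfolding power2_eq_square[of "divisor_fps 1 1"] fps_numeral_fps_const fps_mult_left_const_nth fps_add_nth fps_sub_nth
    by (simp add: fps_mult_nth divisor_fps_def atMost_atLeast0 del: of_nat_diff)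
qed

lemma divisor_fps_3:
  "12 * (divisor_fps 1 0 :: 'a::{real_normed_field, banach} fps) ^ 2 = 5 * divisor_fps 3 0 + divisor_fps 1 0 - 6 * divisor_fps 1 1"
proof (rule fps_ext)
  fix n
  have "(of_int (12 * (\<Sum>k\<le>n. int (dsum 1 k) * int (dsum 1 (n - k)))) :: 'a) = of_int (5 * int (dsum 3 n) + (1 - 6 * int n) * int (dsum 1 n))"
    by (simp only: dsum_1_1_convolution)
  thus "fps_nth (12 * (divisor_fps 1 0 :: 'a fps) ^ 2) n = fps_nth (5 * divisor_fps 3 0 + divisor_fps 1 0 - 6 * divisor_fps 1 1) n"
    unfolding power2_eq_square[of "divisor_fps 1 0"] fps_numeral_fps_const fps_mult_left_const_nth fps_add_nth fps_sub_nth
    by (simp add: fps_mult_nth divisor_fps_def atMost_atLeast0 algebra_simps)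
qed

lemma divisor_fps_5:
  "240 * (divisor_fps 1 0 * divisor_fps 3 0 :: 'a::{real_normed_field, banach} fps) =
     21 * divisor_fps 5 0 + 10 * divisor_fps 3 0 - 30 * divisor_fps 3 1 - divisor_fps 1 0"
proof (rule fps_ext)
  fix n
  have "(of_int (240 * (\<Sum>k\<le>n. int (dsum 1 k) * int (dsum 3 (n - k)))) :: 'a) = 
      of_int (21 * int (dsum 5 n) + (10 - 30 * int n) * int (dsum 3 n) - int (dsum 1 n))"
    by (simp only: dsum_1_3_convolution)
  thus "fps_nth (240 * (divisor_fps 1 0 * divisor_fps 3 0 :: 'a fps)) n = 
      fps_nth (21 * divisor_fps 5 0 + 10 * divisor_fps 3 0 - 30 * divisor_fps 3 1 - divisor_fps 1 0) n"
    unfolding fps_numeral_fps_const fps_mult_left_const_nth fps_add_nth fps_sub_nth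
    by (simp add: fps_mult_nth divisor_fps_def atMost_atLeast0 algebra_simps)
qed

context
  fixes z :: "'a::{real_normed_field, banach}"
  assumes z: "norm z < 1"
begin

private lemma conv [simp]: "ereal (norm z) < fps_conv_radius (divisor_fps r i :: 'a fps)"
  by (rule norm_less_conv_radius_divisor_fps[OF z])

lemma divisor_ser_chazy:
  "divisor_ser 1 3 z = divisor_ser 1 2 z - 24 * (divisor_ser 1 0 z * divisor_ser 1 2 z) + 36 * divisor_ser 1 1 z ^ 2"
  using arg_cong[OF divisor_fps_chazy, of "\<lambda>F. eval_fps F z"]
  by (simp add: divisor_ser_def power2_eq_square eval_fps_add eval_fps_diff eval_fps_mult)

lemma divisor_ser_3:
  "12 * divisor_ser 1 0 z ^ 2 = 5 * divisor_ser 3 0 z + divisor_ser 1 0 z - 6 * divisor_ser 1 1 z"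
  using arg_cong[OF divisor_fps_3, of "\<lambda>F. eval_fps F z"]
  by (simp add: divisor_ser_def power2_eq_square eval_fps_add eval_fps_diff eval_fps_mult)

lemma divisor_ser_5:
  "240 * (divisor_ser 1 0 z * divisor_ser 3 0 z) = 21 * divisor_ser 5 0 z + 10 * divisor_ser 3 0 z - 30 * divisor_ser 3 1 z - divisor_ser 1 0 z"
  using arg_cong[OF divisor_fps_5, of "\<lambda>F. eval_fps F z"]
  by (simp add: divisor_ser_def power2_eq_square eval_fps_add eval_fps_diff eval_fps_mult)

end

section \<open>Reduction of all A_k to A_0, A_1, A_2\<close>

definition chazy_poly :: mpoly where
  "chazy_poly = Var 2 - 24 * (Var 0 * Var 2) + 36 * Var 1 ^ 2"

definition chazy_subst :: "nat \<Rightarrow> mpoly" where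
  "chazy_subst k = (if k = 3 then chazy_poly else Var k)"

text \<open>Reducing after every differentiation keeps the polynomial in X_0, X_1, X_2, so X_3 is
  the only variable that ever has to be eliminated.\<close>

primrec red_poly :: "nat \<Rightarrow> mpoly" where
  "red_poly 0 = Var 0"
| "red_poly (Suc k) = mp_subst (mp_D (red_poly k)) chazy_subst"

lemma mp_vars_red_poly: "mp_vars (red_poly k) \<subseteq> {0, 1, 2}"
proof (induction k)
  case (Suc k)
  have "mp_vars (mp_D (red_poly k)) \<subseteq> {0, 1, 2, 3}"
    by (rule mp_vars_D_le) (use Suc in \<open>auto simp: numeral_3_eq_3 numeral_2_eq_2\<close>)
  moreover have "mp_vars chazy_poly \<subseteq> {0, 1, 2}"
    unfolding chazy_poly_def
    by (intro mp_vars_add_le mp_vars_diff_le mp_vars_mult_le mp_vars_power_le) auto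
  ultimately show ?case
    unfolding red_poly.simps by (intro mp_vars_subst_le) (auto simp: chazy_subst_def)
qed simp

lemma c0_chazy_subst [simp]: "c0 (chazy_subst k) = 0"
  by (simp add: chazy_subst_def chazy_poly_def)

lemma c0_red_poly [simp]: "c0 (red_poly k) = 0"
  by (cases k) (simp_all add: c0_subst)

lemma lin_red_poly: "lin l (red_poly k) = (if l = min k 2 then 1 else 0)"
proof (induction k arbitrary: l)
  case (Suc k)
  have "mp_vars (mp_D (red_poly k)) \<subseteq> {0, 1, 2, 3}"
    by (rule mp_vars_D_le) (use mp_vars_red_poly[of k] in \<open>auto simp: numeral_3_eq_3 numeral_2_eq_2\<close>)
  hence "lin l (red_poly (Suc k)) = (\<Sum>j\<in>{0,1,2,3}. lin j (mp_D (red_poly k)) * lin l (chazy_subst j))"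
    unfolding red_poly.simps by (intro lin_subst) auto
  also have "\<dots> = (\<Sum>j\<in>{1,2,3}. lin (j - 1) (red_poly k) * lin l (chazy_subst j))"
    by (simp add: lin_D numeral_2_eq_2 numeral_3_eq_3)
  also have "\<dots> = (if l = min (Suc k) 2 then 1 else 0)"
    by (auto simp: Suc.IH chazy_subst_def chazy_poly_def min_def power2_eq_square)
  finally show ?case .
qed simp

text \<open>A_(k+1) is recovered from A_k by uniqueness of the derivative, so the induction needs
  the identity on the whole interval and not only at one q.\<close>

lemma mp_eval_red_poly:
  assumes "0 < q" "q < 1"
  shows "mp_eval (red_poly k) (\<lambda>i. A i q) = A k q"
  using assms
proof (induction k arbitrary: q)
  case (Suc k)
  have deriv: "(A i has_real_derivative A (Suc i) x / x) (at x)" if "0 < x" "x < 1" for i x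
  proof -
    have "(divisor_ser 1 i has_real_derivative A (Suc i) x / x) (at x)"
      using DERIV_divisor_ser[of x 1 i] that by (simp add: A_eq_divisor_ser)
    thus ?thesis
      by (rule has_field_derivative_transform_within_open[of _ _ _ "{0<..<1}"]) (use that in \<open>auto simp: A_eq_divisor_ser\<close>)
  qed
  have "((\<lambda>q. mp_eval (red_poly k) (\<lambda>i. A i q)) has_real_derivative mp_eval (mp_D (red_poly k)) (\<lambda>i. A i q) / q) (at q)"
    by (rule mp_eval_D) (use deriv Suc.prems in auto)
  hence "(A k has_real_derivative mp_eval (mp_D (red_poly k)) (\<lambda>i. A i q) / q) (at q)"
    by (rule has_field_derivative_transform_within_open[of _ _ _ "{0<..<1}"]) (use Suc in auto)
  hence "A (Suc k) q / q = mp_eval (mp_D (red_poly k)) (\<lambda>i. A i q) / q"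
    using deriv[OF Suc.prems] DERIV_unique by blast
  hence "A (Suc k) q = mp_eval (mp_D (red_poly k)) (\<lambda>i. A i q)" using Suc.prems by simp
  also have "\<dots> = mp_eval (mp_D (red_poly k)) (\<lambda>i. mp_eval (chazy_subst i) (\<lambda>i. A i q))"
    using divisor_ser_chazy[of q] Suc.prems
    by (intro mp_eval_cong) (auto simp: chazy_subst_def chazy_poly_def A_eq_divisor_ser)
  finally show ?case by (simp add: mp_eval_subst)
qed simp

declare bernoulli.simps [simp del]

section \<open>The polynomial \<Phi>_n and its linear part\<close>

definition Phi :: "nat \<Rightarrow> mpoly" where
  "Phi n = mp_subst (Chat n) red_poly"

lemma mp_vars_Phi: "mp_vars (Phi n) \<subseteq> {0, 1, 2}"
  unfolding Phi_def by (rule mp_vars_subst_le) (rule mp_vars_red_poly)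

lemma mp_eval_Phi: "0 < q \<Longrightarrow> q < 1 \<Longrightarrow> mp_eval (Phi n) (\<lambda>k. A k q) = C n q"
  unfolding Phi_def C_def by (simp add: mp_eval_subst mp_eval_red_poly)

lemma c0_Phi: "n \<ge> 1 \<Longrightarrow> c0 (Phi n) = 0"
  by (simp add: Phi_def c0_subst c0_Chat)

text \<open>All X_k with k \<ge> 2 have linear part Y_2, so its coefficient collects every S_i(n)(0)
  with i \<ge> 3. It is found as the total \<Sum> 3 2^i S_i(n)(0) minus the other two
  coefficients.\<close>

lemma lin_Phi:
  assumes n: "n \<ge> 3"
  shows "lin 0 (Phi n) = 6 * c0 (S_poly n 1)" "lin 1 (Phi n) = 12 * c0 (S_poly n 2)"
    "lin 2 (Phi n) = (-1) ^ Suc n - 6 * c0 (S_poly n 1) - 12 * c0 (S_poly n 2)"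
proof -
  define K where "K = mp_vars (Chat n) \<union> {..<n}"
  have K: "finite K" "mp_vars (Chat n) \<subseteq> K" "{..<n} \<subseteq> K" by (auto simp: K_def)
  have lin: "lin l (Phi n) = (\<Sum>k<n. 3 * 2 ^ Suc k * c0 (S_poly n (Suc k)) * (if l = min k 2 then 1 else 0))" for l
  proof -
    have "lin l (Phi n) = (\<Sum>k\<in>K. lin k (Chat n) * lin l (red_poly k))"
      unfolding Phi_def by (rule lin_subst[OF c0_red_poly K(1,2)])
    also have "\<dots> = (\<Sum>k<n. lin k (Chat n) * lin l (red_poly k))"
      by (rule sum.mono_neutral_right) (use K n in \<open>auto simp: lin_Chat\<close>)
    also have "\<dots> = (\<Sum>k<n. 3 * 2 ^ Suc k * c0 (S_poly n (Suc k)) * (if l = min k 2 then 1 else 0))"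
      using n by (intro sum.cong) (auto simp: lin_Chat lin_red_poly)
    finally show ?thesis .
  qed
  have "lin 0 (Phi n) = (\<Sum>k\<in>{0}. 3 * 2 ^ Suc k * c0 (S_poly n (Suc k)))"
    unfolding lin by (rule sum.mono_neutral_cong_right) (use n in auto)
  thus 0: "lin 0 (Phi n) = 6 * c0 (S_poly n 1)" by simp
  have "lin 1 (Phi n) = (\<Sum>k\<in>{1}. 3 * 2 ^ Suc k * c0 (S_poly n (Suc k)))"
    unfolding lin by (rule sum.mono_neutral_cong_right) (use n in \<open>auto simp: min_def split: if_splits\<close>)
  thus 1: "lin 1 (Phi n) = 12 * c0 (S_poly n 2)" by (simp add: numeral_2_eq_2)
  have "lin 0 (Phi n) + lin 1 (Phi n) + lin 2 (Phi n) = (\<Sum>k<n. 3 * 2 ^ Suc k * c0 (S_poly n (Suc k)))"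
    unfolding lin sum.distrib [symmetric] by (intro sum.cong) (auto simp: min_def)
  also have "\<dots> = 3 * (\<Sum>i=1..n. c0 (S_poly n i) * 2 ^ i)"
    unfolding sum_distrib_left
    by (rule sum.reindex_bij_witness[of _ "\<lambda>i. i - 1" Suc]) auto
  also have "\<dots> = (-1) ^ Suc n" by (rule S_poly_consts(3)[OF n])
  finally show "lin 2 (Phi n) = (-1) ^ Suc n - 6 * c0 (S_poly n 1) - 12 * c0 (S_poly n 2)"
    using 0 1 by simp
qed

text \<open>At N = 2 n - 1 \<ge> 3 the number B_N in S_2(N)(0) vanishes, and both S_1 and S_2 are
  multiples of B_(N+1) = B_(2n).\<close>

lemma Phi_coeffs_odd:
  assumes n: "n \<ge> 2"
  shows "c0 (Phi (2 * n - 1)) = 0" "lin 0 (Phi (2 * n - 1)) = 6 * bernoulli (2 * n) / of_nat n"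
    "lin 1 (Phi (2 * n - 1)) = - 36 * bernoulli (2 * n) / of_nat n"
    "lin 2 (Phi (2 * n - 1)) = 1 + 30 * bernoulli (2 * n) / of_nat n"
proof -
  let ?N = "2 * n - 1"
  have N: "?N \<ge> 3" "Suc ?N = 2 * n" "odd ?N" using n by auto
  have b: "bernoulli ?N = 0" by (rule bernoulli_odd_eq_0) (use N in auto)
  have s1: "c0 (S_poly ?N 1) = bernoulli (2 * n) / of_nat n"
    unfolding S_poly_consts(1)[OF N(1)] N(2) by simp
  have s2: "c0 (S_poly ?N 2) = - 3 * bernoulli (2 * n) / of_nat n"
    using S_poly_consts(2)[OF N(1)] unfolding b s1 by simp
  show "c0 (Phi ?N) = 0" by (rule c0_Phi) (use n in auto)
  show "lin 0 (Phi ?N) = 6 * bernoulli (2 * n) / of_nat n"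
    unfolding lin_Phi[OF N(1)] s1 by simp
  show "lin 1 (Phi ?N) = - 36 * bernoulli (2 * n) / of_nat n"
    unfolding lin_Phi[OF N(1)] s2 by simp
  show "lin 2 (Phi ?N) = 1 + 30 * bernoulli (2 * n) / of_nat n"
    unfolding lin_Phi[OF N(1)] s1 s2 N(2) by (simp add: field_simps)
qed

text \<open>At N = 2 n it is B_(N+1) that vanishes. Hence S_1(N)(0) = 0, and with it the coefficient
  of Y_0.\<close>

lemma Phi_coeffs_even:
  assumes n: "n \<ge> 2"
  shows "c0 (Phi (2 * n)) = 0" "lin 0 (Phi (2 * n)) = 0"
    "lin 1 (Phi (2 * n)) = - 6 * bernoulli (2 * n) / of_nat n"
    "lin 2 (Phi (2 * n)) = 6 * bernoulli (2 * n) / of_nat n - 1"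
proof -
  have N: "2 * n \<ge> 3" using n by auto
  have b: "bernoulli (Suc (2 * n)) = 0" by (rule bernoulli_odd_eq_0) (use n in auto)
  have s1: "c0 (S_poly (2 * n) 1) = 0"
    unfolding S_poly_consts(1)[OF N] b by simp
  have s2: "c0 (S_poly (2 * n) 2) = - bernoulli (2 * n) / of_nat (2 * n)"
    unfolding S_poly_consts(2)[OF N] s1 by simp
  show "c0 (Phi (2 * n)) = 0" by (rule c0_Phi) (use n in auto)
  show "lin 0 (Phi (2 * n)) = 0"
    unfolding lin_Phi[OF N] s1 by simp
  show "lin 1 (Phi (2 * n)) = - 6 * bernoulli (2 * n) / of_nat n"
    unfolding lin_Phi[OF N] s2 using n by (simp add: field_simps)
  show "lin 2 (Phi (2 * n)) = 6 * bernoulli (2 * n) / of_nat n - 1"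
    unfolding lin_Phi[OF N] s1 s2 using n by (simp add: field_simps)
qed

section \<open>The Lipschitz formula\<close>


lemma nonint_nonpos:
  assumes "z \<notin> \<int>" shows "z \<notin> \<int>\<^sub>\<le>\<^sub>0" "1 - z \<notin> \<int>\<^sub>\<le>\<^sub>0" "1 - z \<notin> \<int>"
proof -
  show "z \<notin> \<int>\<^sub>\<le>\<^sub>0" using assms by (auto elim: nonpos_Ints_cases)
  show "1 - z \<notin> \<int>" using assms by (metis Ints_1 Ints_diff diff_diff_eq2 add_diff_cancel_left')
  thus "1 - z \<notin> \<int>\<^sub>\<le>\<^sub>0" by (auto elim: nonpos_Ints_cases)
qed

lemma sin_pi_nonint:
  assumes "(z :: complex) \<notin> \<int>" shows "sin (of_real pi * z) \<noteq> 0"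
proof -
  have "rGamma z * rGamma (1 - z) \<noteq> 0"
    using nonint_nonpos[OF assms] by (simp add: rGamma_eq_zero_iff)
  thus ?thesis unfolding rGamma_reflection_complex by auto
qed

text \<open>The logarithmic derivative of the reflection formula, written with the entire function
  \<open>rGamma\<close>.\<close>

lemma Digamma_reflection:
  assumes z: "(z :: complex) \<notin> \<int>"
  shows "Digamma (1 - z) - Digamma z = of_real pi * cos (of_real pi * z) / sin (of_real pi * z)"
proof -
  note nz = nonint_nonpos[OF z]
  have 1: "((\<lambda>z. rGamma (1 - z)) has_field_derivative (- rGamma (1 - z) * Digamma (1 - z)) * (-1)) (at z)"
    by (rule DERIV_chain2[where f = rGamma and g = "\<lambda>z. 1 - z", OF has_field_derivative_rGamma_no_nonpos_int[OF nz(2)]]) (auto intro!: derivative_eq_intros)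
  have "((\<lambda>z. rGamma z * rGamma (1 - z)) has_field_derivative
      (rGamma z * ((- rGamma (1 - z) * Digamma (1 - z)) * (-1)) + (- rGamma z * Digamma z) * rGamma (1 - z))) (at z)"
    using DERIV_mult[OF has_field_derivative_rGamma_no_nonpos_int[OF nz(1)] 1] by (simp add: algebra_simps)
  moreover have "((\<lambda>z. rGamma z * rGamma (1 - z)) has_field_derivative cos (of_real pi * z)) (at z)"
    unfolding rGamma_reflection_complex by (auto intro!: derivative_eq_intros)
  ultimately have "rGamma z * ((- rGamma (1 - z) * Digamma (1 - z)) * (-1)) + (- rGamma z * Digamma z) * rGamma (1 - z) = cos (of_real pi * z)"
    using DERIV_unique by blast
  hence "(rGamma z * rGamma (1 - z)) * (Digamma (1 - z) - Digamma z) = cos (of_real pi * z)"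
    by (simp add: algebra_simps)
  thus ?thesis
    unfolding rGamma_reflection_complex using sin_pi_nonint[OF z] by (simp add: field_simps)
qed

text \<open>\<open>f\<close> stands for any description of the iterated derivatives of \<pi>
  cot(\<pi> z). It is applied to q-series on the upper half-plane and to polynomials in the
  cotangent off the integers.\<close>

lemma Polygamma_reflection:
  fixes f :: "nat \<Rightarrow> complex \<Rightarrow> complex"
  assumes U: "open U" "U \<inter> \<int> = {}"
    and f0: "\<And>z. z \<in> U \<Longrightarrow> f 0 z = of_real pi * cos (of_real pi * z) / sin (of_real pi * z)"
    and fS: "\<And>k z. z \<in> U \<Longrightarrow> (f k has_field_derivative f (Suc k) z) (at z)"
  shows "z \<in> U \<Longrightarrow> f n z = (-1) ^ n * Polygamma n (1 - z) - Polygamma n z"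
proof (induction n arbitrary: z)
  case 0
  have "z \<notin> \<int>" using 0 U(2) by auto
  thus ?case using f0[OF 0] Digamma_reflection[of z] by simp
next
  case (Suc n)
  have z: "z \<notin> \<int>" using Suc.prems U(2) by auto
  note nz = nonint_nonpos[OF z]
  have "((\<lambda>z. (-1) ^ n * Polygamma n (1 - z) - Polygamma n z) has_field_derivative
      (-1) ^ n * (Polygamma (Suc n) (1 - z) * (-1)) - Polygamma (Suc n) z) (at z)"
    by (intro DERIV_diff DERIV_cmult DERIV_chain2[where f = "Polygamma n" and g = "\<lambda>z. 1 - z", OF has_field_derivative_Polygamma[OF nz(2)]] has_field_derivative_Polygamma[OF nz(1)])
       (auto intro!: derivative_eq_intros)
  hence "(f n has_field_derivative (-1) ^ n * (Polygamma (Suc n) (1 - z) * (-1)) - Polygamma (Suc n) z) (at z)"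
    by (rule has_field_derivative_transform_within_open[OF _ U(1) Suc.prems]) (simp add: Suc.IH)
  from DERIV_unique[OF fS[OF Suc.prems] this] show ?case by simp
qed

text \<open>The constant term is set to 0 explicitly because 0^0 = 1 would spoil the case k =
  0.\<close>

definition power_fps :: "nat \<Rightarrow> complex fps" where
  "power_fps k = Abs_fps (\<lambda>r. if r = 0 then 0 else of_nat r ^ k)"

lemma norm_less_conv_radius_power_fps: "norm z < 1 \<Longrightarrow> ereal (norm z) < fps_conv_radius (power_fps k)"
  by (rule norm_less_conv_radius_if_poly_growth[of _ k])
     (auto simp: power_fps_def norm_power intro!: power_mono)

definition power_ser :: "nat \<Rightarrow> complex \<Rightarrow> complex" where
  "power_ser k w = eval_fps (power_fps k) w"

lemma power_fps_deriv: "fps_X * fps_deriv (power_fps k) = power_fps (Suc k)"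
proof (rule fps_ext)
  fix n show "fps_nth (fps_X * fps_deriv (power_fps k)) n = fps_nth (power_fps (Suc k)) n"
    by (cases n) (simp_all add: power_fps_def)
qed

lemma DERIV_power_ser:
  "norm w < 1 \<Longrightarrow> w \<noteq> 0 \<Longrightarrow> (power_ser k has_field_derivative power_ser (Suc k) w / w) (at w)"
  unfolding power_ser_def [abs_def]
  by (rule DERIV_eval_fps_divide[OF norm_less_conv_radius_power_fps power_fps_deriv])

lemma power_ser_0: "norm w < 1 \<Longrightarrow> power_ser 0 w = w / (1 - w)"
proof -
  assume w: "norm w < 1"
  have "(1 - fps_X) * power_fps 0 = fps_X"
  proof (rule fps_ext)
    fix n show "fps_nth ((1 - fps_X) * power_fps 0) n = fps_nth fps_X n"
      by (cases n; cases "n - 1") (simp_all add: power_fps_def left_diff_distrib)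
  qed
  hence 1: "eval_fps ((1 - fps_X) * power_fps 0) w = w" by simp
  have "eval_fps ((1 - fps_X) * power_fps 0) w = (1 - w) * power_ser 0 w"
    using w by (simp add: eval_fps_mult eval_fps_diff norm_less_conv_radius_power_fps power_ser_def)
  with 1 have "(1 - w) * power_ser 0 w = w" by simp
  moreover have "1 - w \<noteq> 0" using w by auto
  ultimately show ?thesis by (simp add: eq_divide_eq mult.commute)
qed

definition qexp :: "complex \<Rightarrow> complex" where
  "qexp \<tau> = exp (2 * of_real pi * \<i> * \<tau>)"

lemma qexp_nonzero [simp]: "qexp \<tau> \<noteq> 0"
  by (simp add: qexp_def)

lemma norm_qexp: "Im \<tau> > 0 \<Longrightarrow> norm (qexp \<tau>) < 1"
  by (simp add: qexp_def)

lemma DERIV_qexp: "(qexp has_field_derivative 2 * of_real pi * \<i> * qexp \<tau>) (at \<tau>)"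
  unfolding qexp_def [abs_def] by (auto intro!: derivative_eq_intros)

lemma qexp_add_int [simp]: "qexp (\<tau> + of_int m) = qexp \<tau>"
proof -
  have "qexp (\<tau> + of_int m) = qexp \<tau> * exp (2 * of_real pi * \<i> * of_int m)"
    by (simp add: qexp_def ring_distribs exp_add)
  also have "exp (2 * of_real pi * \<i> * of_int m) = 1"
    using exp_integer_2pi[of "of_int m"] by (simp add: mult_ac)
  finally show ?thesis by simp
qed

lemma qexp_mult_nat: "qexp (of_nat m * \<tau>) = qexp \<tau> ^ m"
  by (simp add: qexp_def exp_of_nat_mult [symmetric] mult_ac)

lemma cot_qexp:
  assumes z: "Im z > 0"
  shows "of_real pi * cos (of_real pi * z) / sin (of_real pi * z) = - of_real pi * \<i> - 2 * of_real pi * \<i> * power_ser 0 (qexp z)"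
proof -
  define e where "e = exp (\<i> * (of_real pi * z))"
  have e0: "e \<noteq> 0" by (simp add: e_def)
  have w: "qexp z = e ^ 2"
    by (simp add: e_def qexp_def exp_of_nat_mult [symmetric] power2_eq_square exp_add [symmetric] mult_ac)
  have w1: "norm (qexp z) < 1" by (rule norm_qexp[OF z])
  hence w1': "1 - e ^ 2 \<noteq> 0" unfolding w by auto
  have c: "cos (of_real pi * z) = (e + 1 / e) / 2"
    by (simp add: cos_exp_eq e_def exp_minus field_simps)
  have s: "sin (of_real pi * z) = (e - 1 / e) / (2 * \<i>)"
    by (simp add: sin_exp_eq e_def exp_minus field_simps)
  have "e ^ 2 - 1 \<noteq> 0" using w1' by auto
  hence "of_real pi * cos (of_real pi * z) / sin (of_real pi * z) = of_real pi * \<i> * (e^2 + 1) / (e^2 - 1)"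
    unfolding c s using e0 by (simp add: field_simps power2_eq_square)
  also have "\<dots> = - of_real pi * \<i> - 2 * of_real pi * \<i> * (e^2 / (1 - e^2))"
    using w1' \<open>e ^ 2 - 1 \<noteq> 0\<close> by (simp add: divide_simps) (simp add: algebra_simps)
  finally show ?thesis using w1 by (simp add: power_ser_0 w)
qed

text \<open>For odd n the two polygamma terms together form a sum over all integer translates of z,
  and this is the Lipschitz formula.\<close>

lemma Polygamma_qexp:
  assumes z: "Im z > 0" and n: "odd n"
  shows "Polygamma n z + Polygamma n (1 - z) = (2 * of_real pi * \<i>) ^ Suc n * power_ser n (qexp z)"
proof -
  \<comment> \<open>The constant -\<pi> i of the cotangent expansion disappears with the first
    derivative.\<close>
  define f where "f k z = (if k = 0 then - of_real pi * \<i> else 0) - (2 * of_real pi * \<i>) ^ Suc k * power_ser k (qexp z)" for k z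
  have "f n z = (-1) ^ n * Polygamma n (1 - z) - Polygamma n z"
  proof (rule Polygamma_reflection[of "{z. Im z > 0}" f])
    show "{z. Im z > 0} \<inter> \<int> = {}" by (auto elim!: Ints_cases)
    show "f 0 z = of_real pi * cos (of_real pi * z) / sin (of_real pi * z)" if "z \<in> {z. Im z > 0}" for z
      using cot_qexp[of z] that by (simp add: f_def)
    show "(f k has_field_derivative f (Suc k) z) (at z)" if "z \<in> {z. Im z > 0}" for k z
    proof -
      have "((\<lambda>z. power_ser k (qexp z)) has_field_derivative (power_ser (Suc k) (qexp z) / qexp z) * (2 * of_real pi * \<i> * qexp z)) (at z)"
        by (rule DERIV_chain2[OF DERIV_power_ser DERIV_qexp]) (use that norm_qexp in auto)
      from DERIV_diff[OF DERIV_const DERIV_cmult[OF this]]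
      have "(f k has_field_derivative (0 - (2 * of_real pi * \<i>) ^ Suc k * ((power_ser (Suc k) (qexp z) / qexp z) * (2 * of_real pi * \<i> * qexp z)))) (at z)"
        unfolding f_def [abs_def] .
      thus ?thesis by (simp add: f_def mult_ac)
    qed
  qed (use z in \<open>auto simp: open_halfspace_Im_gt\<close>)
  hence "f n z = - (Polygamma n z + Polygamma n (1 - z))" using n by simp
  moreover have "f n z = - ((2 * of_real pi * \<i>) ^ Suc n * power_ser n (qexp z))"
    using odd_pos[OF n] by (simp add: f_def)
  ultimately show ?thesis by (metis neg_equal_iff_equal)
qed

section \<open>Zeta values at 4 and 6\<close>

text \<open>C = \<pi> cot(\<pi> z) satisfies C' = -(\<pi>^2 + C^2), so its derivatives are
  polynomials in C.\<close>

fun cot_poly :: "nat \<Rightarrow> complex poly" where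
  "cot_poly 0 = [:0, 1:]"
| "cot_poly (Suc k) = - [:of_real pi ^ 2, 0, 1:] * pderiv (cot_poly k)"

text \<open>The point 1/2 is fixed by z \<mapsto> 1 - z and is a zero of the cotangent, so only the
  constant term of the polynomial remains.\<close>

lemma Polygamma_one_half:
  assumes n: "odd n"
  shows "2 * Polygamma n (1/2 :: complex) = - poly (cot_poly n) 0"
proof -
  define C where "C z = of_real pi * cos (of_real pi * z) / sin (of_real pi * z)" for z :: complex
  have C': "(C has_field_derivative - (of_real pi ^ 2 + C z ^ 2)) (at z)" if "z \<notin> \<int>" for z
  proof -
    have s: "sin (of_real pi * z) \<noteq> 0" by (rule sin_pi_nonint[OF that])
    have ds: "((\<lambda>z. sin (of_real pi * z)) has_field_derivative cos (of_real pi * z) * of_real pi) (at z)"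
      by (auto intro!: derivative_eq_intros)
    have dc: "((\<lambda>z. of_real pi * cos (of_real pi * z)) has_field_derivative - (of_real pi * sin (of_real pi * z) * of_real pi)) (at z)"
      by (auto intro!: derivative_eq_intros)
    have "(- (of_real pi * sin (of_real pi * z) * of_real pi) * sin (of_real pi * z) - of_real pi * cos (of_real pi * z) * (cos (of_real pi * z) * of_real pi)) /
        (sin (of_real pi * z) * sin (of_real pi * z)) = - (of_real pi ^ 2 + C z ^ 2)"
      unfolding C_def using s by (simp add: field_simps power2_eq_square)
    with DERIV_divide[OF dc ds s] show ?thesis by (simp add: C_def [abs_def])
  qed
  have half: "(1/2 :: complex) \<in> - \<int>"
    using fraction_not_in_Ints[where 'a = complex, of 2 1] by simp
  have "poly (cot_poly n) (C (1/2)) = (-1) ^ n * Polygamma n (1 - 1/2) - Polygamma n (1/2)"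
  proof (rule Polygamma_reflection[of "- \<int>" "\<lambda>k z. poly (cot_poly k) (C z)"])
    show "((\<lambda>z. poly (cot_poly k) (C z)) has_field_derivative poly (cot_poly (Suc k)) (C z)) (at z)" if "z \<in> - \<int>" for k z
    proof -
      have "((\<lambda>z. poly (cot_poly k) (C z)) has_field_derivative poly (pderiv (cot_poly k)) (C z) * (- (of_real pi ^ 2 + C z ^ 2))) (at z)"
        by (rule DERIV_chain2[OF poly_DERIV C']) (use that in auto)
      thus ?thesis by (simp add: power2_eq_square algebra_simps)
    qed
  qed (use half in \<open>auto simp: C_def open_Compl\<close>)
  moreover have "C (1/2) = 0"
    by (simp add: C_def cos_of_real [symmetric] del: cos_of_real)
  ultimately show ?thesis using n by simp
qed

lemma cot_poly_3: "poly (cot_poly 3) 0 = - 2 * of_real pi ^ 4"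
  by (simp add: numeral_3_eq_3 pderiv_pCons pderiv_mult pderiv_minus pderiv_add power_numeral_reduce)

lemma cot_poly_5: "poly (cot_poly 5) 0 = - 16 * of_real pi ^ 6"
proof -
  have "poly (cot_poly (Suc (Suc (Suc (Suc (Suc 0)))))) 0 = - 16 * of_real pi ^ 6"
    by (simp add: pderiv_pCons pderiv_mult pderiv_minus pderiv_add power_numeral_reduce)
  thus ?thesis by (simp add: eval_nat_numeral)
qed

text \<open>Separating odd and even integers relates the zeta value to the polygamma value at 1/2.
  The zeta values are needed for the constant terms of the Eisenstein series.\<close>

lemma suminf_inverse_power_split:
  assumes n: "n \<ge> 1"
  shows "suminf (\<lambda>k. inverse (of_nat (Suc k) ^ Suc n) :: complex) * (2 ^ Suc n - 1) = suminf (\<lambda>k. inverse ((1/2 + of_nat k) ^ Suc n))"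
proof -
  let ?f = "\<lambda>k. inverse (of_nat (Suc k) ^ Suc n) :: complex" and ?g = "\<lambda>k. inverse ((1/2 + of_nat k) ^ Suc n) :: complex"
  have f: "?f sums suminf ?f"
    using Polygamma_converges'[of "1 :: complex" "Suc n"] n by (intro summable_sums) (simp add: add.commute)
  have g: "?g sums suminf ?g"
    using Polygamma_converges'[of "1/2 :: complex" "Suc n"] n by (intro summable_sums) simp
  have "(\<lambda>k. sum ?f {k * 2..<k * 2 + 2}) sums suminf ?f"
    using sums_group[OF f, of 2] by simp
  moreover have "sum ?f {k * 2..<k * 2 + 2} = inverse (2 ^ Suc n) * ?g k + inverse (2 ^ Suc n) * ?f k" for k
  proof -
    have pair: "sum f {k * 2..<k * 2 + 2} = f (2 * k) + f (2 * k + 1)" for f :: "nat \<Rightarrow> complex"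
    proof -
      have "{k * 2..<k * 2 + 2} = {2 * k, 2 * k + 1}" by auto
      thus ?thesis by simp
    qed
    have 1: "of_nat (Suc (2 * k)) = 2 * (1/2 + of_nat k :: complex)" by simp
    have 2: "of_nat (Suc (2 * k + 1)) = 2 * (of_nat (Suc k) :: complex)" by simp
    show ?thesis
      unfolding pair 1 2 by (simp only: power_mult_distrib inverse_mult_distrib)
  qed
  ultimately have "(\<lambda>k. inverse (2 ^ Suc n) * ?g k + inverse (2 ^ Suc n) * ?f k) sums suminf ?f" by simp
  moreover have "(\<lambda>k. inverse (2 ^ Suc n) * ?g k + inverse (2 ^ Suc n) * ?f k) sums (inverse (2 ^ Suc n) * suminf ?g + inverse (2 ^ Suc n) * suminf ?f)"
    by (intro sums_add sums_mult f g)
  ultimately have "suminf ?f = inverse (2 ^ Suc n) * suminf ?g + inverse (2 ^ Suc n) * suminf ?f"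
    using sums_unique2 by blast
  hence "2 ^ Suc n * suminf ?f = suminf ?g + suminf ?f" by (simp add: field_simps)
  thus ?thesis by (simp add: algebra_simps)
qed

lemma suminf_inverse_power_cot_poly:
  assumes n: "odd n"
  shows "2 * fact n * (2 ^ Suc n - 1) * suminf (\<lambda>k. inverse (of_nat (Suc k) ^ Suc n) :: complex) = - poly (cot_poly n) 0"
proof -
  have n1: "n \<ge> 1" using n by (cases n) auto
  define S T :: complex where "S = suminf (\<lambda>k. inverse (of_nat (Suc k) ^ Suc n))" and "T = suminf (\<lambda>k. inverse ((1/2 + of_nat k) ^ Suc n))"
  have "Polygamma n (1/2 :: complex) = fact n * T"
    using n n1 by (simp add: Polygamma_def T_def del: power_Suc)
  hence "2 * (fact n * T) = - poly (cot_poly n) 0" using Polygamma_one_half[OF n] by simp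
  moreover have "S * (2 ^ Suc n - 1) = T" unfolding S_def T_def by (rule suminf_inverse_power_split[OF n1])
  ultimately have "2 * (fact n * (S * (2 ^ Suc n - 1))) = - poly (cot_poly n) 0" by (simp only:)
  thus ?thesis unfolding S_def [symmetric] by (simp only: mult_ac)
qed

lemma suminf_inverse_power_4: "suminf (\<lambda>k. inverse (of_nat (Suc k) ^ 4) :: complex) = of_real pi ^ 4 / 90"
proof -
  have e: "Suc 3 = (4::nat)" by simp
  have f: "2 * fact 3 * (2 ^ 4 - 1) = (180 :: complex)" by (simp add: fact_numeral)
  have "180 * suminf (\<lambda>k. inverse (of_nat (Suc k) ^ 4) :: complex) = 2 * of_real pi ^ 4"
    using suminf_inverse_power_cot_poly[of 3] unfolding cot_poly_3 e f by simp
  thus ?thesis by (simp only: eq_divide_eq) (simp add: mult.commute)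
qed

lemma suminf_inverse_power_6: "suminf (\<lambda>k. inverse (of_nat (Suc k) ^ 6) :: complex) = of_real pi ^ 6 / 945"
proof -
  have e: "Suc 5 = (6::nat)" by simp
  have f: "2 * fact 5 * (2 ^ 6 - 1) = (15120 :: complex)" by (simp add: fact_numeral)
  have "15120 * suminf (\<lambda>k. inverse (of_nat (Suc k) ^ 6) :: complex) = 16 * of_real pi ^ 6"
    using suminf_inverse_power_cot_poly[of 5] unfolding cot_poly_5 e f by simp
  thus ?thesis by (simp only: eq_divide_eq) (simp add: mult.commute)
qed

section \<open>Eisenstein series\<close>


lemma infsum_nat_eq_suminf: "f summable_on (UNIV :: nat set) \<Longrightarrow> infsum f UNIV = suminf (f :: nat \<Rightarrow> complex)"
  by (metis has_sum_imp_sums has_sum_infsum sums_unique)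

lemma UNIV_int_split: "(UNIV :: int set) = range int \<union> range (\<lambda>n. - int n - 1)"
proof -
  have "x \<in> range int \<union> range (\<lambda>n. - int n - 1)" for x
  proof (cases "x \<ge> 0")
    case True
    hence "x = int (nat x)" by simp
    thus ?thesis by blast
  next
    case False
    hence "x = - int (nat (- x - 1)) - 1" by simp
    thus ?thesis by blast
  qed
  thus ?thesis by blast
qed

lemma inj_neg_int: "inj (\<lambda>n. - int n - 1)"
  by (rule injI) simp

lemma summable_on_int_iff:
  fixes f :: "int \<Rightarrow> 'a::banach"
  shows "f summable_on UNIV \<longleftrightarrow> (\<lambda>n. f (int n)) summable_on UNIV \<and> (\<lambda>n. f (- int n - 1)) summable_on UNIV"
proof -
  have "f summable_on UNIV \<longleftrightarrow> f summable_on range int \<and> f summable_on range (\<lambda>n. - int n - 1)"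
  proof
    assume "f summable_on UNIV"
    thus "f summable_on range int \<and> f summable_on range (\<lambda>n. - int n - 1)"
      by (auto intro: summable_on_subset_banach)
  next
    assume "f summable_on range int \<and> f summable_on range (\<lambda>n. - int n - 1)"
    thus "f summable_on UNIV" unfolding UNIV_int_split by (intro summable_on_Un_disjoint) auto
  qed
  thus ?thesis by (simp add: summable_on_reindex inj_neg_int o_def)
qed

lemma infsum_int_split:
  fixes f :: "int \<Rightarrow> complex"
  assumes "f summable_on UNIV"
  shows "infsum f UNIV = suminf (\<lambda>n. f (int n)) + suminf (\<lambda>n. f (- int n - 1))"
    "(\<lambda>n. f (int n)) summable_on UNIV" "(\<lambda>n. f (- int n - 1)) summable_on UNIV"
proof -
  show s: "(\<lambda>n. f (int n)) summable_on UNIV" "(\<lambda>n. f (- int n - 1)) summable_on UNIV"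
    using assms summable_on_int_iff by blast+
  have "infsum f UNIV = infsum f (range int) + infsum f (range (\<lambda>n. - int n - 1))"
    unfolding UNIV_int_split
    by (intro infsum_Un_disjoint) (use s in \<open>auto simp: summable_on_reindex inj_neg_int o_def\<close>)
  also have "\<dots> = infsum (\<lambda>n. f (int n)) UNIV + infsum (\<lambda>n. f (- int n - 1)) UNIV"
    by (simp add: infsum_reindex inj_neg_int o_def)
  finally show "infsum f UNIV = suminf (\<lambda>n. f (int n)) + suminf (\<lambda>n. f (- int n - 1))"
    using s by (simp add: infsum_nat_eq_suminf)
qed

lemma summable_on_int_inverse_square: "(\<lambda>n::int. inverse (1 + of_int n ^ 2) :: real) summable_on UNIV"
proof -
  have "summable (\<lambda>n. inverse (of_nat n ^ 2) :: real)" by (rule inverse_power_summable) simp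
  hence 1: "summable (\<lambda>n. inverse (of_nat (Suc n) ^ 2) :: real)" by (subst summable_Suc_iff)
  have "(\<lambda>n::nat. inverse (1 + of_int (int n) ^ 2) :: real) summable_on UNIV"
  proof (rule norm_summable_imp_summable_on, rule summable_comparison_test')
    show "summable (\<lambda>n. 4 * inverse (of_nat (Suc n) ^ 2) :: real)" by (rule summable_mult[OF 1])
    fix n :: nat assume "n \<ge> 0"
    have "0 \<le> (real n - 1)^2 + 2 * real n ^ 2 + 2" by simp
    hence *: "(real (Suc n))^2 \<le> 4 * (1 + real n ^ 2)"
      by (simp add: power2_eq_square algebra_simps)
    have pos: "1 + real n ^ 2 > 0" by (intro add_pos_nonneg) auto
    have "inverse (4 * (1 + real n ^ 2)) \<le> inverse (real (Suc n) ^ 2)"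
      using * by (intro le_imp_inverse_le) auto
    hence "inverse (1 + real n ^ 2) \<le> 4 * inverse (real (Suc n) ^ 2)"
    proof -
      have "inverse x \<le> 4 * y" if "inverse (4 * x) \<le> y" for x y :: real
        using that by (simp add: inverse_mult_distrib)
      thus "inverse (4 * (1 + real n ^ 2)) \<le> inverse (real (Suc n) ^ 2) \<Longrightarrow> ?thesis" .
    qed
    thus "norm (norm (inverse (1 + of_int (int n) ^ 2) :: real)) \<le> 4 * inverse (of_nat (Suc n) ^ 2)"
      using pos by (simp only: of_int_of_nat_eq real_norm_def abs_abs abs_inverse abs_of_pos)
  qed
  moreover have "(\<lambda>n::nat. inverse (1 + of_int (- int n - 1) ^ 2) :: real) summable_on UNIV"
  proof (rule norm_summable_imp_summable_on, rule summable_comparison_test'[OF 1])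
    fix n :: nat assume "n \<ge> 0"
    have "(real_of_int (- int n - 1))^2 = of_nat (Suc n) ^ 2" by (simp add: power2_eq_square algebra_simps)
    thus "norm (norm (inverse (1 + of_int (- int n - 1) ^ 2) :: real)) \<le> inverse (of_nat (Suc n) ^ 2)"
      by (simp del: of_nat_Suc add: le_imp_inverse_le add_pos_nonneg)
  qed
  ultimately show ?thesis using summable_on_int_iff by blast
qed

section \<open>Absolutely convergent lattice sums\<close>

text \<open>The origin need not be excluded: \<open>inverse 0 = 0\<close> makes its term vanish for
  k > 0, and shears act bijectively on the full index set.\<close>

definition lattice_term :: "nat \<Rightarrow> complex \<Rightarrow> int \<times> int \<Rightarrow> complex" where
  "lattice_term k \<tau> = (\<lambda>(m, n). inverse ((of_int m * \<tau> + of_int n) ^ k))"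

lemma lattice_norm_bound:
  assumes y: "Im \<tau> > 0"
  obtains K where "K > 0" "\<And>m n :: int. of_int m ^ 2 + of_int n ^ 2 \<le> K * norm (of_int m * \<tau> + of_int n) ^ 2"
proof
  \<comment> \<open>From n^2 \<le> 2 (m x + n)^2 + 2 (m x)^2 with x = Re \<tau>; the terms in m^2
    are absorbed into (m Im \<tau>)^2.\<close>
  define K where "K = 2 + (2 * Re \<tau> ^ 2 + 1) / Im \<tau> ^ 2"
  show "K > 0" unfolding K_def by (intro add_pos_nonneg divide_nonneg_nonneg) auto
  fix m n :: int
  let ?x = "of_int m * Re \<tau> + of_int n" and ?y = "of_int m * Im \<tau>"
  have N: "norm (of_int m * \<tau> + of_int n) ^ 2 = ?x ^ 2 + ?y ^ 2"
    by (simp add: cmod_power2)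
  have "of_int n ^ 2 \<le> 2 * ?x ^ 2 + 2 * (of_int m * Re \<tau>) ^ 2"
  proof -
    have "0 \<le> (?x + of_int m * Re \<tau>) ^ 2" by simp
    thus ?thesis by (simp add: power2_eq_square algebra_simps)
  qed
  hence "of_int m ^ 2 + of_int n ^ 2 \<le> 2 * ?x ^ 2 + (2 * Re \<tau> ^ 2 + 1) * of_int m ^ 2"
    by (simp add: power_mult_distrib algebra_simps)
  also have "(2 * Re \<tau> ^ 2 + 1) * of_int m ^ 2 = ((2 * Re \<tau> ^ 2 + 1) / Im \<tau> ^ 2) * ?y ^ 2"
    using y by (simp add: power_mult_distrib)
  also have "2 * ?x ^ 2 + ((2 * Re \<tau> ^ 2 + 1) / Im \<tau> ^ 2) * ?y ^ 2 \<le> K * ?x ^ 2 + K * ?y ^ 2"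
    unfolding K_def by (intro add_mono mult_right_mono) auto
  finally show "of_int m ^ 2 + of_int n ^ 2 \<le> K * norm (of_int m * \<tau> + of_int n) ^ 2"
    unfolding N by (simp add: algebra_simps)
qed

text \<open>The majorant is a product, which reduces summability to one variable. Since (1 + m^2) (1
  + n^2) has order (m^2 + n^2)^2, this requires weight at least 4.\<close>

lemma lattice_term_bound:
  assumes y: "Im \<tau> > 0" and l: "l \<ge> 2"
  obtains C where "\<And>m n. norm (lattice_term (2 * l) \<tau> (m, n)) \<le> C * (inverse (1 + of_int m ^ 2) * inverse (1 + of_int n ^ 2))"
proof -
  obtain K where K: "K > 0" "\<And>m n :: int. of_int m ^ 2 + of_int n ^ 2 \<le> K * norm (of_int m * \<tau> + of_int n) ^ 2"
    using lattice_norm_bound[OF y] by blast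
  have "norm (lattice_term (2 * l) \<tau> (m, n)) \<le> 3 * K ^ l * (inverse (1 + of_int m ^ 2) * inverse (1 + of_int n ^ 2))" for m n
  proof (cases "m = 0 \<and> n = 0")
    case True
    thus ?thesis using K(1) l by (simp add: lattice_term_def zero_power)
  next
    case False
    define s :: real where "s = of_int m ^ 2 + of_int n ^ 2"
    have "m ^ 2 + n ^ 2 \<ge> 1"
    proof -
      have "m ^ 2 + n ^ 2 \<noteq> 0" using False by (simp add: sum_power2_eq_zero_iff)
      moreover have "m ^ 2 + n ^ 2 \<ge> 0" by simp
      ultimately show ?thesis by linarith
    qed
    hence "real_of_int (m ^ 2 + n ^ 2) \<ge> 1" by linarith
    hence s1: "s \<ge> 1" by (simp add: s_def)
    have mn: "of_int m ^ 2 * of_int n ^ 2 \<le> s ^ 2"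
    proof -
      have "0 \<le> real_of_int m ^ 2 * of_int n ^ 2 + (of_int m ^ 2) ^ 2 + (of_int n ^ 2) ^ 2" by (intro add_nonneg_nonneg) auto
      thus ?thesis unfolding s_def by (simp add: power2_eq_square algebra_simps)
    qed
    have "(1 + of_int m ^ 2) * (1 + of_int n ^ 2) = 1 + s + of_int m ^ 2 * of_int n ^ 2"
      by (simp add: s_def algebra_simps)
    also have "\<dots> \<le> s ^ 2 + s ^ 2 + s ^ 2"
      using s1 mn self_le_power[of s 2] one_le_power[of s 2] by (intro add_mono) auto
    also have "\<dots> = 3 * s ^ 2" by simp
    also have "\<dots> \<le> 3 * s ^ l" using s1 l by (intro mult_left_mono power_increasing) auto
    also have "\<dots> \<le> 3 * (K * norm (of_int m * \<tau> + of_int n) ^ 2) ^ l"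
      using s1 K(2)[of m n] by (intro mult_left_mono power_mono) (auto simp: s_def)
    finally have *: "(1 + of_int m ^ 2) * (1 + of_int n ^ 2) \<le> 3 * K ^ l * norm (of_int m * \<tau> + of_int n) ^ (2 * l)"
      by (simp add: power_mult_distrib power_mult)
    define N where "N = norm (of_int m * \<tau> + of_int n) ^ (2 * l)"
    define M :: real where "M = (1 + of_int m ^ 2) * (1 + of_int n ^ 2)"
    have M: "M > 0" unfolding M_def by (intro mult_pos_pos add_pos_nonneg) auto
    have "M \<le> 3 * K ^ l * N" using * by (simp add: M_def N_def)
    moreover have "N \<ge> 0" by (simp add: N_def)
    ultimately have "N > 0" using M K(1) by (metis less_eq_real_def mult_zero_right not_less)
    have "inverse N \<le> 3 * K ^ l * inverse M"
      using \<open>M \<le> 3 * K ^ l * N\<close> M \<open>N > 0\<close> by (simp add: field_simps)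
    thus ?thesis
      by (simp add: lattice_term_def norm_inverse norm_power N_def M_def inverse_mult_distrib)
  qed
  thus ?thesis by (rule that)
qed

lemma lattice_summable:
  assumes y: "Im \<tau> > 0" and l: "l \<ge> 2"
  shows "lattice_term (2 * l) \<tau> summable_on UNIV \<times> UNIV"
proof -
  obtain C where C: "\<And>m n. norm (lattice_term (2 * l) \<tau> (m, n)) \<le> C * (inverse (1 + of_int m ^ 2) * inverse (1 + of_int n ^ 2))"
    using lattice_term_bound[OF assms] by blast
  define g :: "int \<Rightarrow> real" where "g n = inverse (1 + of_int n ^ 2)" for n
  have g0: "g n \<ge> 0" for n by (simp add: g_def)
  have sg: "g summable_on UNIV" unfolding g_def [abs_def] by (rule summable_on_int_inverse_square)
  define S where "S = infsum g UNIV"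
  have S0: "S \<ge> 0" unfolding S_def by (rule infsum_nonneg) (rule g0)
  define F where "F p = \<bar>C\<bar> * (g (fst p) * g (snd p))" for p
  have nF: "norm (F p) = F p" for p by (simp add: F_def g0 abs_mult)
  have "(\<lambda>p. norm (F p)) summable_on UNIV \<times> UNIV"
    unfolding Infinite_Sum.abs_summable_on_Sigma_iff
  proof (intro conjI ballI)
    fix m :: int
    show "(\<lambda>n. norm (F (m, n))) summable_on UNIV"
      unfolding nF unfolding F_def fst_conv snd_conv by (intro summable_on_cmult_right sg)
  next
    have "infsum (\<lambda>n. norm (F (m, n))) UNIV = \<bar>C\<bar> * (g m * S)" for m
      unfolding nF unfolding F_def fst_conv snd_conv S_def by (simp only: infsum_cmult_right')
    hence "norm (infsum (\<lambda>n. norm (F (m, n))) UNIV) = \<bar>C\<bar> * (g m * S)" for m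
      using g0[of m] S0 by (simp add: abs_mult)
    moreover have "(\<lambda>m. \<bar>C\<bar> * (g m * S)) summable_on UNIV"
      by (intro summable_on_cmult_right summable_on_cmult_left sg)
    ultimately show "(\<lambda>m. norm (infsum (\<lambda>n. norm (F (m, n))) UNIV)) summable_on UNIV" by (simp only:)
  qed
  hence "(\<lambda>p. norm (lattice_term (2 * l) \<tau> p)) summable_on UNIV \<times> UNIV"
  proof (rule Infinite_Sum.abs_summable_on_comparison_test)
    fix p :: "int \<times> int"
    have "norm (lattice_term (2 * l) \<tau> p) \<le> C * (g (fst p) * g (snd p))" using C[of "fst p" "snd p"] by (simp add: g_def)
    also have "\<dots> \<le> F p" unfolding F_def by (intro mult_right_mono mult_nonneg_nonneg g0) auto
    finally show "norm (lattice_term (2 * l) \<tau> p) \<le> norm (F p)" by (simp only: nF)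
  qed
  thus ?thesis by (rule abs_summable_summable)
qed

definition eisenstein :: "nat \<Rightarrow> complex \<Rightarrow> complex" where
  "eisenstein k \<tau> = infsum (lattice_term k \<tau>) (UNIV \<times> UNIV)"

lemma lattice_row_summable:
  assumes "Im \<tau> > 0" "l \<ge> 2"
  shows "(\<lambda>n. lattice_term (2 * l) \<tau> (m, n)) summable_on UNIV"
proof -
  have "lattice_term (2 * l) \<tau> summable_on (Pair m ` UNIV)"
    using lattice_summable[OF assms] by (rule summable_on_subset_banach) auto
  thus ?thesis by (subst (asm) summable_on_reindex) (auto simp: o_def inj_on_def)
qed

section \<open>q-expansions of the lattice sums\<close>

text \<open>Nonnegative i give z + i, and negative i give 1 - z + i up to a sign that the even
  exponent removes, so the row is a sum of two polygamma values.\<close>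

lemma lattice_row:
  assumes z: "Im z > 0" and k: "Suc n = 2 * l" "l \<ge> 2"
  shows "infsum (\<lambda>i. lattice_term (Suc n) z (1, i)) UNIV = (2 * of_real pi * \<i>) ^ Suc n / fact n * power_ser n (qexp z)"
proof -
  have n: "odd n" "n \<noteq> 0" using k by presburger+
  have "infsum (\<lambda>i. lattice_term (Suc n) z (1, i)) UNIV = 
     suminf (\<lambda>i. lattice_term (Suc n) z (1, int i)) + suminf (\<lambda>i. lattice_term (Suc n) z (1, - int i - 1))"
    using lattice_row_summable[OF z k(2), of 1] unfolding k by (rule infsum_int_split)
  also have "(\<lambda>i. lattice_term (Suc n) z (1, int i)) = (\<lambda>i. inverse ((z + of_nat i) ^ Suc n))"
    by (simp add: lattice_term_def)
  also have "(\<lambda>i. lattice_term (Suc n) z (1, - int i - 1)) = (\<lambda>i. inverse ((1 - z + of_nat i) ^ Suc n))"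
  proof
    fix i
    have "z + of_int (- int i - 1) = - (1 - z + of_nat i)" by simp
    moreover have "even (Suc n)" using n by simp
    ultimately have "(z + of_int (- int i - 1)) ^ Suc n = (1 - z + of_nat i) ^ Suc n"
      by (simp only: power_minus_even)
    thus "lattice_term (Suc n) z (1, - int i - 1) = inverse ((1 - z + of_nat i) ^ Suc n)"
      by (simp only: lattice_term_def prod.case of_int_1 mult_1)
  qed
  also have "suminf (\<lambda>i. inverse ((z + of_nat i) ^ Suc n)) + suminf (\<lambda>i. inverse ((1 - z + of_nat i) ^ Suc n)) = 
      (Polygamma n z + Polygamma n (1 - z)) / fact n"
    using n by (simp add: Polygamma_def add_divide_distrib del: power_Suc)
  finally show ?thesis unfolding Polygamma_qexp[OF z n(1)] by simp
qed

lemma infsum_from_1: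
  fixes f :: "nat \<Rightarrow> complex"
  assumes "f summable_on {1..}"
  shows "(\<lambda>n. f (Suc n)) sums infsum f {1..}"
proof -
  have "{1..} = range Suc" by (auto simp: image_iff Suc_le_eq gr0_conv_Suc)
  hence "(f has_sum infsum f {1..}) (range Suc)" using has_sum_infsum[OF assms] by simp
  hence "((\<lambda>n. f (Suc n)) has_sum infsum f {1..}) UNIV"
    by (subst (asm) has_sum_reindex) (auto simp: o_def)
  thus ?thesis by (rule has_sum_imp_sums)
qed

text \<open>The double series of r^n q^(m r) is summed by rows and along N = m r, where r runs
  through the divisors of N; absolute convergence justifies the exchange.\<close>

lemma lambert_power_ser:
  assumes q: "norm q < 1"
  shows "(\<lambda>m. power_ser n (q ^ Suc m)) sums divisor_ser n 0 q"
proof -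
  define D where "D = Sigma {1::nat..} (\<lambda>N. {d. d dvd N})"
  define f where "f = (\<lambda>(N, d). of_nat d ^ n * q ^ N :: complex)"
  have fin: "finite {d. d dvd N}" if "N \<in> {1::nat..}" for N using that by auto
  have suml: "summable (\<lambda>N. norm (fps_nth (divisor_fps n 0 :: complex fps) N * q ^ N))"
    by (rule norm_summable_fps) (rule norm_less_conv_radius_divisor_fps[OF q])
  have "(\<lambda>p. norm (f p)) summable_on D"
    unfolding D_def Infinite_Sum.abs_summable_on_Sigma_iff
  proof (intro conjI ballI)
    fix N :: nat assume "N \<in> {1..}"
    thus "(\<lambda>d. norm (f (N, d))) summable_on {d. d dvd N}" using fin by (intro summable_on_finite) auto
  next
    have "(\<lambda>N. norm (fps_nth (divisor_fps n 0 :: complex fps) N * q ^ N)) summable_on UNIV"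
      using suml by (intro norm_summable_imp_summable_on) simp
    hence "(\<lambda>N. norm (fps_nth (divisor_fps n 0 :: complex fps) N * q ^ N)) summable_on {1..}"
      by (rule summable_on_subset_banach) auto
    moreover have "norm (fps_nth (divisor_fps n 0 :: complex fps) N * q ^ N) = norm (infsum (\<lambda>d. norm (f (N, d))) {d. d dvd N})" if "N \<in> {1..}" for N
    proof -
      have "infsum (\<lambda>d. norm (f (N, d))) {d. d dvd N} = (\<Sum>d\<in>{d. d dvd N}. real d ^ n * norm q ^ N)"
        using fin[OF that] by (simp add: f_def norm_mult norm_power)
      also have "\<dots> = real (dsum n N) * norm q ^ N" by (simp add: dsum_def sum_distrib_right)
      finally show ?thesis by (simp add: divisor_fps_def norm_mult norm_power)
    qed
    ultimately show "(\<lambda>N. norm (infsum (\<lambda>d. norm (f (N, d))) {d. d dvd N})) summable_on {1..}"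
      by (subst (asm) summable_on_cong) auto
  qed
  hence sD: "f summable_on D" by (rule abs_summable_summable)
  define g where "g = (\<lambda>(m, r). of_nat r ^ n * q ^ (m * r) :: complex)"
  have bij: "bij_betw (\<lambda>(m, r). (m * r, r)) ({1..} \<times> {1..}) D"
    by (rule bij_betwI[where g = "\<lambda>(N, d). (N div d, d)"])
       (auto simp: D_def Suc_le_eq elim!: dvdE)
  have gf: "g p = f ((\<lambda>(m, r). (m * r, r)) p)" for p by (simp add: g_def f_def case_prod_beta)
  have sG: "g summable_on {1..} \<times> {1..}"
    using summable_on_reindex_bij_betw[OF bij, of f] sD unfolding gf by simp
  have eq: "infsum g ({1..} \<times> {1..}) = infsum f D"
    using infsum_reindex_bij_betw[OF bij, of f] unfolding gf by simp
  have "infsum f D = infsum (\<lambda>N. infsum (\<lambda>d. f (N, d)) {d. d dvd N}) {1..}"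
    using sD unfolding D_def by (rule infsum_Sigma_banach [symmetric])
  also have "\<dots> = infsum (\<lambda>N. of_nat (dsum n N) * q ^ N) {1..}"
    by (intro infsum_cong) (use fin in \<open>simp add: f_def dsum_def sum_distrib_right\<close>)
  also have "\<dots> = divisor_ser n 0 q"
  proof -
    have "(\<lambda>N. fps_nth (divisor_fps n 0) N * q ^ N) summable_on UNIV"
      using suml by (rule norm_summable_imp_summable_on)
    hence "(\<lambda>N. of_nat (dsum n N) * q ^ N) summable_on {1..}"
      by (rule summable_on_subset_banach[of _ UNIV, THEN summable_on_cong[THEN iffD1, rotated]]) (auto simp: divisor_fps_def)
    hence 1: "(\<lambda>N. of_nat (dsum n (Suc N)) * q ^ Suc N) sums infsum (\<lambda>N. of_nat (dsum n N) * q ^ N) {1..}"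
      by (rule infsum_from_1)
    have "(\<lambda>N. fps_nth (divisor_fps n 0) (Suc N) * q ^ Suc N) sums (divisor_ser n 0 q - fps_nth (divisor_fps n 0) 0 * q ^ 0)"
      using sums_divisor_ser[OF q] by (subst sums_Suc_iff) auto
    thus ?thesis using sums_unique2[OF 1] by (simp add: divisor_fps_def)
  qed
  finally have val: "infsum g ({1..} \<times> {1..}) = divisor_ser n 0 q" using eq by simp
  have inner: "infsum (\<lambda>r. g (m, r)) {1..} = power_ser n (q ^ m)" if m: "m \<ge> 1" for m
  proof -
    have qm: "norm (q ^ m) < 1" using q m by (simp add: norm_power power_less_one_iff)
    have "(\<lambda>r. fps_nth (power_fps n) r * (q ^ m) ^ r) sums power_ser n (q ^ m)"
      unfolding power_ser_def by (intro sums_eval_fps norm_less_conv_radius_power_fps qm)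
    hence "(\<lambda>r. fps_nth (power_fps n) (Suc r) * (q ^ m) ^ Suc r) sums (power_ser n (q ^ m) - fps_nth (power_fps n) 0 * (q ^ m) ^ 0)"
      by (subst sums_Suc_iff) auto
    hence 1: "(\<lambda>r. g (m, Suc r)) sums power_ser n (q ^ m)"
      by (simp add: power_fps_def g_def power_mult)
    have "g summable_on (Pair m ` {1..})"
      using sG by (rule summable_on_subset_banach) (use m in auto)
    hence "(\<lambda>r. g (m, r)) summable_on {1..}"
      by (subst (asm) summable_on_reindex) (auto simp: o_def inj_on_def)
    from infsum_from_1[OF this] 1 show ?thesis using sums_unique2 by blast
  qed
  have "infsum (\<lambda>m. infsum (\<lambda>r. g (m, r)) {1..}) {1..} = divisor_ser n 0 q"
    unfolding val [symmetric] using sG by (rule infsum_Sigma_banach)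
  moreover have "(\<lambda>m. infsum (\<lambda>r. g (m, r)) {1..}) summable_on {1..}"
    using sG by (intro summable_on_Sigma_banach) (simp add: case_prod_beta')
  hence "(\<lambda>m. infsum (\<lambda>r. g (Suc m, r)) {1..}) sums infsum (\<lambda>m. infsum (\<lambda>r. g (m, r)) {1..}) {1..}"
    by (rule infsum_from_1)
  ultimately have "(\<lambda>m. infsum (\<lambda>r. g (Suc m, r)) {1..}) sums divisor_ser n 0 q"
    by (simp only:)
  moreover have "infsum (\<lambda>r. g (Suc m, r)) {1..} = power_ser n (q ^ Suc m)" for m by (rule inner) simp
  ultimately show ?thesis by (simp only:)
qed

text \<open>For m > 0 the row m is the row 1 at m \<tau>, the rows m and -m agree because the weight
  is even, and the row 0 gives twice the zeta value.\<close>

lemma eisenstein_qexp: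
  assumes z: "Im \<tau> > 0" and k: "Suc n = 2 * l" "l \<ge> 2"
  shows "eisenstein (Suc n) \<tau> = 2 * suminf (\<lambda>k. inverse (of_nat (Suc k) ^ Suc n)) + 
    2 * ((2 * of_real pi * \<i>) ^ Suc n / fact n) * divisor_ser n 0 (qexp \<tau>)"
proof -
  define row where "row m = infsum (\<lambda>i. lattice_term (Suc n) \<tau> (m, i)) UNIV" for m
  have n: "odd n" using k by presburger
  have sL: "lattice_term (Suc n) \<tau> summable_on UNIV \<times> UNIV"
    using lattice_summable[OF z k(2)] k(1) by simp
  have eis: "eisenstein (Suc n) \<tau> = infsum row UNIV"
    unfolding eisenstein_def row_def using sL by (rule infsum_Sigma_banach [symmetric])
  have srow: "row summable_on UNIV"
    unfolding row_def using sL by (intro summable_on_Sigma_banach) (simp add: case_prod_beta')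
  have neg: "lattice_term (Suc n) \<tau> (- m, - i) = lattice_term (Suc n) \<tau> (m, i)" for m i
  proof -
    have "of_int (- m) * \<tau> + of_int (- i) = - (of_int m * \<tau> + of_int i)" by simp
    moreover have "even (Suc n)" using n by simp
    ultimately show ?thesis unfolding lattice_term_def prod.case by (simp only: power_minus_even)
  qed
  have row_neg: "row (- m) = row m" for m
  proof -
    have "row m = infsum (\<lambda>i. lattice_term (Suc n) \<tau> (- m, - i)) UNIV" by (simp add: row_def neg)
    also have "\<dots> = row (- m)"
      unfolding row_def by (rule infsum_reindex_bij_betw) (auto intro!: bij_betwI[of _ _ _ uminus])
    finally show ?thesis ..
  qed
  have row_pos: "row (int (Suc m)) = (2 * of_real pi * \<i>) ^ Suc n / fact n * power_ser n (qexp \<tau> ^ Suc m)" for m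
  proof -
    have "Im (of_nat (Suc m) * \<tau>) > 0" using z by simp
    from lattice_row[OF this k] show ?thesis
      unfolding qexp_mult_nat by (simp add: row_def lattice_term_def del: power_Suc)
  qed
  have sums: "(\<lambda>m. row (int (Suc m))) sums ((2 * of_real pi * \<i>) ^ Suc n / fact n * divisor_ser n 0 (qexp \<tau>))"
    unfolding row_pos by (intro sums_mult lambert_power_ser norm_qexp z)
  have row0: "row 0 = 2 * suminf (\<lambda>k. inverse (of_nat (Suc k) ^ Suc n))"
  proof -
    have s0: "(\<lambda>i. lattice_term (Suc n) \<tau> (0, i)) summable_on UNIV"
      using lattice_row_summable[OF z k(2), of 0] k(1) by simp
    have pos: "(\<lambda>i. lattice_term (Suc n) \<tau> (0, int (Suc i))) = (\<lambda>i. inverse (of_nat (Suc i) ^ Suc n))"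
      by (simp add: lattice_term_def)
    have "(\<lambda>i. lattice_term (Suc n) \<tau> (0, - int i - 1)) = (\<lambda>i. lattice_term (Suc n) \<tau> (0, int (Suc i)))"
    proof
      fix i show "lattice_term (Suc n) \<tau> (0, - int i - 1) = lattice_term (Suc n) \<tau> (0, int (Suc i))"
      proof -
        have "- int i - 1 = - int (Suc i)" by simp
        thus ?thesis using neg[of 0 "int (Suc i)"] by (simp only: minus_zero)
      qed
    qed
    hence neg': "(\<lambda>i. lattice_term (Suc n) \<tau> (0, - int i - 1)) = (\<lambda>i. inverse (of_nat (Suc i) ^ Suc n))"
      unfolding pos .
    have "summable (\<lambda>i. lattice_term (Suc n) \<tau> (0, int i))"
      using infsum_int_split(2)[OF s0] by (rule summable_on_imp_summable)
    from suminf_split_head[OF this] have "suminf (\<lambda>i. lattice_term (Suc n) \<tau> (0, int i)) = suminf (\<lambda>k. inverse (of_nat (Suc k) ^ Suc n))"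
      unfolding pos by (simp add: lattice_term_def)
    thus ?thesis unfolding row_def infsum_int_split(1)[OF s0] neg' by simp
  qed
  have "summable (\<lambda>m. row (int m))"
    using infsum_int_split(2)[OF srow] by (rule summable_on_imp_summable)
  from suminf_split_head[OF this] have "suminf (\<lambda>m. row (int m)) = row 0 + suminf (\<lambda>m. row (int (Suc m)))" by simp
  moreover have "(\<lambda>m. row (- int m - 1)) = (\<lambda>m. row (int (Suc m)))"
  proof
    fix m show "row (- int m - 1) = row (int (Suc m))"
    proof -
      have "- int m - 1 = - int (Suc m)" by simp
      thus ?thesis using row_neg[of "int (Suc m)"] by (simp only:)
    qed
  qed
  ultimately have "eisenstein (Suc n) \<tau> = row 0 + 2 * suminf (\<lambda>m. row (int (Suc m)))"
    unfolding eis infsum_int_split(1)[OF srow] by simp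
  thus ?thesis unfolding sums_unique[OF sums, symmetric] row0 by (simp only: mult.assoc)
qed

section \<open>Transformation laws\<close>

text \<open>The new lattice is the old one divided by c \<tau> + 1, up to the shear (m, n) \<mapsto>
  (m + c n, n) of the index set.\<close>

lemma eisenstein_transform:
  assumes j: "of_int c * \<tau> + 1 \<noteq> 0"
  shows "eisenstein k (\<tau> / (of_int c * \<tau> + 1)) = (of_int c * \<tau> + 1) ^ k * eisenstein k \<tau>"
proof -
  let ?j = "of_int c * \<tau> + 1"
  have bij: "bij_betw (\<lambda>(m::int, n::int). (m + c * n, n)) (UNIV \<times> UNIV) (UNIV \<times> UNIV)"
    by (rule bij_betwI[where g = "\<lambda>(m, n). (m - c * n, n)"]) auto
  have tr: "lattice_term k (\<tau> / ?j) p = ?j ^ k * lattice_term k \<tau> ((\<lambda>(m, n). (m + c * n, n)) p)" for p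
  proof -
    obtain m n where p: "p = (m, n)" by (cases p)
    have eq: "of_int m * (\<tau> / ?j) + of_int n = (of_int (m + c * n) * \<tau> + of_int n) / ?j"
      using j by (simp add: field_simps)
    show ?thesis unfolding p lattice_term_def prod.case eq
      by (simp only: power_divide inverse_divide) (simp only: divide_inverse)
  qed
  have "eisenstein k (\<tau> / ?j) = infsum (\<lambda>p. ?j ^ k * lattice_term k \<tau> ((\<lambda>(m, n). (m + c * n, n)) p)) (UNIV \<times> UNIV)"
    unfolding eisenstein_def by (rule infsum_cong) (rule tr)
  also have "\<dots> = ?j ^ k * infsum (\<lambda>p. lattice_term k \<tau> ((\<lambda>(m, n). (m + c * n, n)) p)) (UNIV \<times> UNIV)"
    by (rule infsum_cmult_right')
  also have "infsum (\<lambda>p. lattice_term k \<tau> ((\<lambda>(m, n). (m + c * n, n)) p)) (UNIV \<times> UNIV) = eisenstein k \<tau>"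
    unfolding eisenstein_def by (rule infsum_reindex_bij_betw[OF bij])
  finally show ?thesis .
qed

definition ser_P :: "complex \<Rightarrow> complex" where "ser_P q = 1 - 24 * divisor_ser 1 0 q"
definition ser_Q :: "complex \<Rightarrow> complex" where "ser_Q q = 1 + 240 * divisor_ser 3 0 q"
definition ser_R :: "complex \<Rightarrow> complex" where "ser_R q = 1 - 504 * divisor_ser 5 0 q"

lemma eisenstein_4:
  assumes "Im \<tau> > 0"
  shows "eisenstein 4 \<tau> = of_real pi ^ 4 / 45 * ser_Q (qexp \<tau>)"
proof -
  have e: "Suc 3 = (4::nat)" by simp
  have "eisenstein 4 \<tau> = 2 * (of_real pi ^ 4 / 90) + 2 * ((2 * of_real pi * \<i>) ^ 4 / fact 3) * divisor_ser 3 0 (qexp \<tau>)"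
    using eisenstein_qexp[of \<tau> 3 2] assms unfolding e suminf_inverse_power_4 by simp
  thus ?thesis by (simp add: ser_Q_def power_mult_distrib fact_numeral field_simps)
qed

lemma eisenstein_6:
  assumes "Im \<tau> > 0"
  shows "eisenstein 6 \<tau> = 2 * of_real pi ^ 6 / 945 * ser_R (qexp \<tau>)"
proof -
  have e: "Suc 5 = (6::nat)" by simp
  have i: "\<i> ^ 6 = -1" by (simp add: eval_nat_numeral)
  have "eisenstein 6 \<tau> = 2 * (of_real pi ^ 6 / 945) + 2 * ((2 * of_real pi * \<i>) ^ 6 / fact 5) * divisor_ser 5 0 (qexp \<tau>)"
    using eisenstein_qexp[of \<tau> 5 3] assms unfolding e suminf_inverse_power_6 by simp
  thus ?thesis by (simp add: ser_R_def power_mult_distrib fact_numeral i field_simps)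
qed

lemma upper_half_transform:
  assumes "Im \<tau> > 0"
  shows "of_int c * \<tau> + 1 \<noteq> 0" "Im (\<tau> / (of_int c * \<tau> + 1)) > 0"
proof -
  show nz: "of_int c * \<tau> + 1 \<noteq> 0"
  proof
    assume 0: "of_int c * \<tau> + 1 = 0"
    hence "Im (of_int c * \<tau> + 1) = 0" "Re (of_int c * \<tau> + 1) = 0" by simp_all
    thus False using assms by auto
  qed
  have "Im (\<tau> / (of_int c * \<tau> + 1)) = Im \<tau> / (cmod (of_int c * \<tau> + 1))\<^sup>2"
    unfolding Im_divide cmod_power2 by (simp add: algebra_simps)
  thus "Im (\<tau> / (of_int c * \<tau> + 1)) > 0" using assms nz by simp
qed

lemma ser_Q_transform:
  assumes "Im \<tau> > 0"
  shows "ser_Q (qexp (\<tau> / (of_int c * \<tau> + 1))) = (of_int c * \<tau> + 1) ^ 4 * ser_Q (qexp \<tau>)"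
  using eisenstein_transform[where c = c and k = 4, OF upper_half_transform(1)[OF assms]] upper_half_transform(2)[OF assms, of c] assms
  by (simp add: eisenstein_4)

lemma ser_R_transform:
  assumes "Im \<tau> > 0"
  shows "ser_R (qexp (\<tau> / (of_int c * \<tau> + 1))) = (of_int c * \<tau> + 1) ^ 6 * ser_R (qexp \<tau>)"
  using eisenstein_transform[where c = c and k = 6, OF upper_half_transform(1)[OF assms]] upper_half_transform(2)[OF assms, of c] assms
  by (simp add: eisenstein_6)

text \<open>Ramanujan's relation 3 \<theta> Q = P Q - R, as \<open>240 * divisor_ser 3 1 q\<close>
  is \<theta> Q.\<close>

lemma ser_PQ:
  assumes "norm q < 1"
  shows "ser_P q * ser_Q q = 720 * divisor_ser 3 1 q + ser_R q"
  using divisor_ser_5[OF assms] unfolding ser_P_def ser_Q_def ser_R_def by algebra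

text \<open>Differentiating the law of Q in \<tau>, the factor j^4 creates the inhomogeneous term.
  Ramanujan's relation at both points then brings in P, which is isolated by dividing by Q.\<close>

lemma ser_P_transform:
  assumes \<tau>: "Im \<tau> > 0" and Q0: "ser_Q (qexp \<tau>) \<noteq> 0"
  shows "ser_P (qexp (\<tau> / (of_int c * \<tau> + 1))) = (of_int c * \<tau> + 1) ^ 2 * ser_P (qexp \<tau>) + 6 / (of_real pi * \<i>) * of_int c * (of_int c * \<tau> + 1)"
proof -
  define j where "j = of_int c * \<tau> + 1"
  define T where "T = (\<lambda>\<tau> :: complex. \<tau> / (of_int c * \<tau> + 1))"
  have j: "j \<noteq> 0" and T: "Im (T \<tau>) > 0"
    using upper_half_transform[OF \<tau>, of c] by (simp_all add: j_def T_def)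
  have dQ: "((\<lambda>\<tau>. ser_Q (qexp \<tau>)) has_field_derivative 2 * of_real pi * \<i> * (240 * divisor_ser 3 1 (qexp \<tau>))) (at \<tau>)"
    if "Im \<tau> > 0" for \<tau>
  proof -
    have "((\<lambda>\<tau>. divisor_ser 3 0 (qexp \<tau>)) has_field_derivative (divisor_ser 3 (Suc 0) (qexp \<tau>) / qexp \<tau>) * (2 * of_real pi * \<i> * qexp \<tau>)) (at \<tau>)"
      by (rule DERIV_chain2[OF DERIV_divisor_ser DERIV_qexp]) (use that norm_qexp in auto)
    from DERIV_add[OF DERIV_const[of 1] DERIV_cmult[OF this, of 240]] show ?thesis
      unfolding ser_Q_def by (simp add: mult_ac)
  qed
  have dT: "(T has_field_derivative 1 / j ^ 2) (at \<tau>)"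
    unfolding T_def j_def by (rule derivative_eq_intros refl | use j in \<open>simp add: j_def field_simps power2_eq_square\<close>)+
  have "((\<lambda>\<tau>. ser_Q (qexp (T \<tau>))) has_field_derivative 2 * of_real pi * \<i> * (240 * divisor_ser 3 1 (qexp (T \<tau>))) * (1 / j ^ 2)) (at \<tau>)"
    by (rule DERIV_chain2[OF dQ[OF T] dT])
  moreover have "((\<lambda>\<tau>. ser_Q (qexp (T \<tau>))) has_field_derivative
      (4 * of_int c * j ^ 3 * ser_Q (qexp \<tau>) + j ^ 4 * (2 * of_real pi * \<i> * (240 * divisor_ser 3 1 (qexp \<tau>))))) (at \<tau>)"
  proof (rule has_field_derivative_transform_within_open[of "\<lambda>\<tau>. (of_int c * \<tau> + 1) ^ 4 * ser_Q (qexp \<tau>)" _ _ "{\<tau>. Im \<tau> > 0}"])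
    have "((\<lambda>\<tau>. (of_int c * \<tau> + 1) ^ 4) has_field_derivative 4 * of_int c * j ^ 3) (at \<tau>)"
      unfolding j_def by (auto intro!: derivative_eq_intros)
    from DERIV_mult[OF this dQ[OF \<tau>]]
    show "((\<lambda>\<tau>. (of_int c * \<tau> + 1) ^ 4 * ser_Q (qexp \<tau>)) has_field_derivative
       (4 * of_int c * j ^ 3 * ser_Q (qexp \<tau>) + j ^ 4 * (2 * of_real pi * \<i> * (240 * divisor_ser 3 1 (qexp \<tau>))))) (at \<tau>)"
      by (simp add: j_def algebra_simps)
  qed (use \<tau> in \<open>auto simp: open_halfspace_Im_gt T_def ser_Q_transform\<close>)
  ultimately have eq: "2 * of_real pi * \<i> * (240 * divisor_ser 3 1 (qexp (T \<tau>))) * (1 / j ^ 2) =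
      4 * of_int c * j ^ 3 * ser_Q (qexp \<tau>) + j ^ 4 * (2 * of_real pi * \<i> * (240 * divisor_ser 3 1 (qexp \<tau>)))"
    using DERIV_unique by blast
  define S S' Q R where "S = divisor_ser 3 1 (qexp \<tau>)" and "S' = divisor_ser 3 1 (qexp (T \<tau>))"
    and "Q = ser_Q (qexp \<tau>)" and "R = ser_R (qexp \<tau>)"
  define u where "u = inverse (of_real pi * \<i>)"
  have u: "6 / (of_real pi * \<i>) = 6 * u" by (simp add: u_def divide_inverse)
  have h: "480 * S' = u * (4 * of_int c * j ^ 5 * Q) + j ^ 6 * (480 * S)"
    using eq j unfolding S_def S'_def Q_def u_def by (simp add: field_simps power_numeral_reduce)
  have "2 * (720 * S') = 3 * (480 * S')" by simp
  also have "\<dots> = 2 * (6 / (of_real pi * \<i>) * of_int c * j ^ 5 * Q + j ^ 6 * (720 * S))"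
    unfolding h u by (simp add: algebra_simps)
  finally have S': "720 * S' = 6 / (of_real pi * \<i>) * of_int c * j ^ 5 * Q + j ^ 6 * (720 * S)"
    by (simp only: mult_cancel_left) simp
  have "ser_P (qexp (T \<tau>)) * (j ^ 4 * Q) = 720 * S' + j ^ 6 * R"
    using ser_PQ[OF norm_qexp[OF T]] ser_Q_transform[OF \<tau>, of c] ser_R_transform[OF \<tau>, of c]
    by (simp add: S'_def Q_def R_def T_def j_def)
  also have "\<dots> = 6 / (of_real pi * \<i>) * of_int c * j ^ 5 * Q + j ^ 6 * (720 * S + R)"
    unfolding S' by (simp add: algebra_simps)
  also have "720 * S + R = ser_P (qexp \<tau>) * Q"
    using ser_PQ[OF norm_qexp[OF \<tau>]] by (simp add: S_def Q_def R_def)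
  also have "6 / (of_real pi * \<i>) * of_int c * j ^ 5 * Q + j ^ 6 * (ser_P (qexp \<tau>) * Q) =
      (j ^ 2 * ser_P (qexp \<tau>) + 6 / (of_real pi * \<i>) * of_int c * j) * (j ^ 4 * Q)"
    unfolding u by (simp add: distrib_right distrib_left power_numeral_reduce mult_ac)
  finally show ?thesis using j Q0 by (simp add: Q_def T_def j_def)
qed

section \<open>Algebraic independence\<close>


text \<open>Serves to pass from infinitely many values of a parameter to all complex ones: the class
  is closed under the operations that build the transported relation.\<close>

definition polyfun :: "(complex \<Rightarrow> complex) \<Rightarrow> bool" where
  "polyfun g \<longleftrightarrow> (\<exists>p. g = poly p)"

lemma polyfun_const [simp]: "polyfun (\<lambda>t. c)"
  unfolding polyfun_def by (rule exI[of _ "[:c:]"]) auto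

lemma polyfun_id [simp]: "polyfun (\<lambda>t. t)"
  unfolding polyfun_def by (rule exI[of _ "[:0, 1:]"]) auto

lemma polyfun_add [simp]: "polyfun f \<Longrightarrow> polyfun g \<Longrightarrow> polyfun (\<lambda>t. f t + g t)"
proof -
  assume "polyfun f" "polyfun g"
  then obtain p q where "f = poly p" "g = poly q" unfolding polyfun_def by blast
  thus ?thesis unfolding polyfun_def by (intro exI[of _ "p + q"]) (simp add: fun_eq_iff)
qed

lemma polyfun_mult [simp]: "polyfun f \<Longrightarrow> polyfun g \<Longrightarrow> polyfun (\<lambda>t. f t * g t)"
proof -
  assume "polyfun f" "polyfun g"
  then obtain p q where "f = poly p" "g = poly q" unfolding polyfun_def by blast
  thus ?thesis unfolding polyfun_def by (intro exI[of _ "p * q"]) (simp add: fun_eq_iff)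
qed

lemma polyfun_diff [simp]: "polyfun f \<Longrightarrow> polyfun g \<Longrightarrow> polyfun (\<lambda>t. f t - g t)"
proof -
  assume "polyfun f" "polyfun g"
  then obtain p q where "f = poly p" "g = poly q" unfolding polyfun_def by blast
  thus ?thesis unfolding polyfun_def by (intro exI[of _ "p - q"]) (simp add: fun_eq_iff)
qed

lemma polyfun_divide [simp]: "polyfun f \<Longrightarrow> polyfun (\<lambda>t. f t / c)"
  using polyfun_mult[of f "\<lambda>_. inverse c"] by (simp add: divide_inverse)

lemma polyfun_power [simp]: "polyfun f \<Longrightarrow> polyfun (\<lambda>t. f t ^ n)"
  by (induction n) auto

lemma polyfun_sum: "(\<And>i. i \<in> I \<Longrightarrow> polyfun (f i)) \<Longrightarrow> polyfun (\<lambda>t. \<Sum>i\<in>I. f i t)"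
  by (induction I rule: infinite_finite_induct) auto

lemma polyfun_prod: "(\<And>i. i \<in> I \<Longrightarrow> polyfun (f i)) \<Longrightarrow> polyfun (\<lambda>t. \<Prod>i\<in>I. f i t)"
  by (induction I rule: infinite_finite_induct) auto

lemma polyfun_mp_eval: "(\<And>k. polyfun (\<lambda>t. x t k)) \<Longrightarrow> polyfun (\<lambda>t. mp_eval p (x t))"
  unfolding mp_eval_def by (intro polyfun_sum polyfun_mult polyfun_prod polyfun_power polyfun_const)

lemma polyfun_eq_0:
  assumes "polyfun g" "infinite U" "\<And>t. t \<in> U \<Longrightarrow> g t = 0"
  shows "g t = 0"
proof -
  obtain p where p: "g = poly p" using assms(1) unfolding polyfun_def by blast
  have "p = 0"
  proof (rule ccontr)
    assume "p \<noteq> 0"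
    hence "finite {x. poly p x = 0}" by (rule poly_roots_finite)
    moreover have "U \<subseteq> {x. poly p x = 0}" using assms(3) p by auto
    ultimately show False using assms(2) finite_subset by blast
  qed
  thus ?thesis by (simp add: p)
qed

lemma mp_eval_holomorphic:
  assumes "\<And>k. k \<in> mp_vars p \<Longrightarrow> f k holomorphic_on U"
  shows "(\<lambda>z. mp_eval p (\<lambda>k. f k z)) holomorphic_on U"
  unfolding mp_eval_def
  by (intro holomorphic_intros assms) (auto intro: mp_varsI)

lemma mp_eval_of_real: "mp_eval p (\<lambda>k. complex_of_real (x k)) = complex_of_real (mp_eval p x)"
proof -
  have "complex_of_real (real_of_rat r) = of_rat r" for r
    by (induction r) (simp add: of_rat_rat)
  thus ?thesis unfolding mp_eval_def by simp
qed

lemma divisor_ser_of_real: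
  assumes "norm q < 1"
  shows "divisor_ser r i (complex_of_real q) = complex_of_real (divisor_ser r i q)"
proof -
  have "(\<lambda>n. complex_of_real (fps_nth (divisor_fps r i) n * q ^ n)) sums complex_of_real (divisor_ser r i q)"
    using sums_divisor_ser[OF assms] by (subst sums_of_real_iff)
  hence "(\<lambda>n. fps_nth (divisor_fps r i) n * complex_of_real q ^ n) sums complex_of_real (divisor_ser r i q)"
    by (simp add: divisor_fps_def)
  moreover have "(\<lambda>n. fps_nth (divisor_fps r i) n * complex_of_real q ^ n) sums divisor_ser r i (complex_of_real q)"
    by (rule sums_divisor_ser) (use assms in simp)
  ultimately show ?thesis using sums_unique2 by blast
qed

lemma divisor_ser_holomorphic: "divisor_ser r i holomorphic_on ball 0 1"
  unfolding divisor_ser_def [abs_def]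
  by (intro holomorphic_on_eval_fps holomorphic_intros) (auto intro: norm_less_conv_radius_divisor_fps)

text \<open>The change of coordinates expressing \<open>(A\<^sub>0, A\<^sub>1, A\<^sub>2)\<close> through \<open>(P, Q, R)\<close>.\<close>
definition pqr_coord :: "complex \<Rightarrow> complex \<Rightarrow> complex \<Rightarrow> nat \<Rightarrow> complex" where
  "pqr_coord X Y Z k = (if k = 0 then (1 - X) / 24 else if k = 1 then (Y - X ^ 2) / 288
     else if k = 2 then (X * Y - Z) / 864 + (Y - X ^ 2) * X / 1728 else 0)"

text \<open>A_1 comes from 12 \<theta> P = P^2 - Q, and A_2 from applying \<theta> to that relation
  with \<theta> Q replaced by (P Q - R) / 3.\<close>

lemma divisor_ser_pqr:
  assumes q: "norm q < 1" and k: "k \<in> {0, 1, 2}"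
  shows "divisor_ser 1 k q = pqr_coord (ser_P q) (ser_Q q) (ser_R q) k"
proof -
  have a1: "288 * divisor_ser 1 1 q = ser_Q q - ser_P q ^ 2"
    using divisor_ser_3[OF q] unfolding ser_P_def ser_Q_def by algebra
  have fps: "24 * (divisor_fps 1 0 * divisor_fps 1 1) = 5 * divisor_fps 3 1 + divisor_fps 1 1 - 6 * (divisor_fps 1 2 :: complex fps)"
  proof -
    have "fps_X * fps_deriv (12 * (divisor_fps 1 0 :: complex fps) ^ 2) = fps_X * fps_deriv (5 * divisor_fps 3 0 + divisor_fps 1 0 - 6 * divisor_fps 1 1)"
      by (simp only: divisor_fps_3)
    moreover have "fps_X * fps_deriv (12 * (divisor_fps 1 0 :: complex fps) ^ 2) = 24 * (divisor_fps 1 0 * (fps_X * fps_deriv (divisor_fps 1 0)))"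
      by (simp add: power2_eq_square algebra_simps)
    moreover have "fps_X * fps_deriv (5 * divisor_fps 3 0 + divisor_fps 1 0 - 6 * divisor_fps 1 1 :: complex fps) =
      5 * (fps_X * fps_deriv (divisor_fps 3 0)) + fps_X * fps_deriv (divisor_fps 1 0) - 6 * (fps_X * fps_deriv (divisor_fps 1 1))"
      by (simp add: algebra_simps)
    ultimately show ?thesis unfolding divisor_fps_deriv by (simp add: numeral_2_eq_2)
  qed
  note c = norm_less_conv_radius_divisor_fps[OF q]
  have a2: "24 * (divisor_ser 1 0 q * divisor_ser 1 1 q) = 5 * divisor_ser 3 1 q + divisor_ser 1 1 q - 6 * divisor_ser 1 2 q"
    using arg_cong[OF fps, of "\<lambda>F. eval_fps F q"]
    by (simp add: divisor_ser_def eval_fps_add eval_fps_diff eval_fps_mult c)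
  have s3: "720 * divisor_ser 3 1 q = ser_P q * ser_Q q - ser_R q" using ser_PQ[OF q] by simp
  have a0: "24 * divisor_ser 1 0 q = 1 - ser_P q" by (simp add: ser_P_def)
  have "1728 * divisor_ser 1 2 q = 2 * (ser_P q * ser_Q q - ser_R q) + (ser_Q q - ser_P q ^ 2) * ser_P q"
    using a2 s3 a0 a1 by algebra
  hence "divisor_ser 1 2 q = (2 * (ser_P q * ser_Q q - ser_R q) + (ser_Q q - ser_P q ^ 2) * ser_P q) / 1728"
    by (metis nonzero_mult_div_cancel_left zero_neq_numeral)
  hence a2': "divisor_ser 1 2 q = (ser_P q * ser_Q q - ser_R q) / 864 + (ser_Q q - ser_P q ^ 2) * ser_P q / 1728"
    by (simp add: add_divide_distrib)
  have a0': "divisor_ser 1 0 q = (1 - ser_P q) / 24" and a1': "divisor_ser 1 1 q = (ser_Q q - ser_P q ^ 2) / 288"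
    using a0 a1 by (simp_all add: field_simps)
  show ?thesis using k a0' a1' a2' by (auto simp: pqr_coord_def)
qed

definition fps_Q :: "complex fps" where "fps_Q = 1 + 240 * divisor_fps 3 0"
definition fps_R :: "complex fps" where "fps_R = 1 - 504 * divisor_fps 5 0"

lemma fps_Q_R_nth: "fps_nth fps_Q 0 = 1" "fps_nth fps_Q 1 = 240" "fps_nth fps_R 0 = 1" "fps_nth fps_R 1 = -504"
  by (simp_all add: fps_Q_def fps_R_def divisor_fps_def fps_numeral_fps_const dsum_def)

lemma eval_fps_Q:
  "norm q < 1 \<Longrightarrow> ereal (norm q) < fps_conv_radius fps_Q" "norm q < 1 \<Longrightarrow> eval_fps fps_Q q = ser_Q q"
  by (simp_all add: fps_Q_def ser_Q_def eval_fps_add eval_fps_mult norm_less_conv_radius_divisor_fps divisor_ser_def)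

lemma eval_fps_R:
  "norm q < 1 \<Longrightarrow> ereal (norm q) < fps_conv_radius fps_R" "norm q < 1 \<Longrightarrow> eval_fps fps_R q = ser_R q"
  by (simp_all add: fps_R_def ser_R_def eval_fps_diff eval_fps_mult norm_less_conv_radius_divisor_fps divisor_ser_def)

section \<open>The modular invariant and the independence of P, Q, R\<close>

text \<open>In terms of the modular invariant j the quotient is j / (j - 1728); it is unchanged
  under (Q, R) \<mapsto> (t^4 Q, t^6 R). The point q = 0 is left out since it is not a value of
  \<open>qexp\<close>.\<close>

definition j_values :: "complex set" where
  "j_values = {ser_Q q ^ 3 / ser_R q ^ 2 | q. norm q < 1 \<and> q \<noteq> 0 \<and> ser_Q q \<noteq> 0 \<and> ser_R q \<noteq> 0}"

text \<open>If \<open>Q\<^sup>3 / R\<^sup>2\<close> took only finitely many values, a finite product of power series would vanish;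
  but no factor does, as the coefficients of \<open>q\<close> in \<open>Q\<^sup>3\<close> and \<open>R\<^sup>2\<close> differ.\<close>
lemma infinite_j_values: "infinite j_values"
proof
  assume fin: "finite j_values"
  \<comment> \<open>The factors \<open>fps_X\<close>, \<open>fps_Q\<close> and \<open>fps_R\<close>
    vanish at the points excluded from \<open>j_values\<close>, so the product vanishes on the whole
    disc.\<close>
  define F where "F = fps_X * fps_Q * fps_R * (\<Prod>v\<in>j_values. (fps_Q ^ 3 - fps_const v * fps_R ^ 2))"
  have conv: "ereal (norm q) < fps_conv_radius (\<Prod>v\<in>V. (fps_Q ^ 3 - fps_const v * fps_R ^ 2)) \<and>
      eval_fps (\<Prod>v\<in>V. (fps_Q ^ 3 - fps_const v * fps_R ^ 2)) q = (\<Prod>v\<in>V. (ser_Q q ^ 3 - v * ser_R q ^ 2))"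
    if q: "norm q < 1" "finite V" for q V
    using q(2) by (induction V rule: finite_induct)
      (simp_all add: eval_fps_mult eval_fps_diff eval_fps_power eval_fps_Q[OF q(1)] eval_fps_R[OF q(1)])
  have F: "ereal (norm q) < fps_conv_radius F \<and> eval_fps F q = 0" if q: "norm q < 1" for q
  proof -
    have "ereal (norm q) < fps_conv_radius F"
      unfolding F_def using conv[OF q fin] by (simp add: eval_fps_Q[OF q] eval_fps_R[OF q])
    moreover have "eval_fps F q = q * ser_Q q * ser_R q * (\<Prod>v\<in>j_values. (ser_Q q ^ 3 - v * ser_R q ^ 2))"
      unfolding F_def using conv[OF q fin] by (simp add: eval_fps_mult eval_fps_Q[OF q] eval_fps_R[OF q])
    moreover have "q * ser_Q q * ser_R q * (\<Prod>v\<in>j_values. (ser_Q q ^ 3 - v * ser_R q ^ 2)) = 0"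
    proof (cases "q = 0 \<or> ser_Q q = 0 \<or> ser_R q = 0")
      case False
      define v where "v = ser_Q q ^ 3 / ser_R q ^ 2"
      have "v \<in> j_values" using False q unfolding v_def j_values_def by blast
      moreover have "ser_Q q ^ 3 - v * ser_R q ^ 2 = 0" using False by (simp add: v_def)
      ultimately show ?thesis using fin by (auto simp: prod_zero_iff)
    qed auto
    ultimately show ?thesis by simp
  qed
  have "F = 0"
  proof (rule eval_fps_eqD)
    show "fps_conv_radius F > 0" using F[of 0] by (simp add: zero_ereal_def)
    have "eventually (\<lambda>z. z \<in> ball 0 1) (nhds (0::complex))" by (rule eventually_nhds_in_open) auto
    thus "eventually (\<lambda>z. eval_fps F z = eval_fps 0 z) (nhds 0)"
      by eventually_elim (use F in auto)
  qed simp
  moreover have "fps_Q \<noteq> 0" "fps_R \<noteq> 0" using fps_Q_R_nth by auto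
  ultimately obtain v where "fps_Q ^ 3 - fps_const v * fps_R ^ 2 = 0"
    using fin unfolding F_def by (auto simp: prod_zero_iff)
  hence v: "fps_nth (fps_Q ^ 3) n = v * fps_nth (fps_R ^ 2) n" for n
    by (metis eq_iff_diff_eq_0 fps_mult_left_const_nth)
  have "fps_nth (fps_Q ^ 3) 0 = 1" "fps_nth (fps_R ^ 2) 0 = 1" by (simp_all add: fps_Q_R_nth fps_nth_power_0)
  hence "v = 1" using v[of 0] by simp
  moreover have "fps_nth (fps_Q ^ 3) 1 = 720" "fps_nth (fps_R ^ 2) 1 = -1008"
    using fps_Q_R_nth by (simp_all add: power3_eq_cube power2_eq_square fps_mult_nth)
  ultimately show False using v[of 1] by simp
qed

lemma ex_qexp:
  assumes "q \<noteq> 0" "norm q < 1"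
  obtains \<tau> where "Im \<tau> > 0" "qexp \<tau> = q"
proof
  define \<tau> where "\<tau> = Ln q / (2 * of_real pi * \<i>)"
  show "qexp \<tau> = q" using assms(1) by (simp add: qexp_def \<tau>_def)
  have "norm (qexp \<tau>) < 1" using \<open>qexp \<tau> = q\<close> assms by simp
  thus "Im \<tau> > 0" by (simp add: qexp_def zero_less_mult_iff)
qed

theorem A_algebraically_independent:
  assumes vars: "mp_vars \<Phi> \<subseteq> {0, 1, 2}"
    and zero: "\<And>q::real. 0 < q \<Longrightarrow> q < 1 \<Longrightarrow> mp_eval \<Phi> (\<lambda>k. A k q) = 0"
  shows "\<Phi> = 0"
proof -
  define G where "G X Y Z = mp_eval \<Phi> (pqr_coord X Y Z)" for X Y Z
  have polyG: "polyfun (\<lambda>t. G (X t) (Y t) (Z t))" if "polyfun X" "polyfun Y" "polyfun Z" for X Y Z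
    unfolding G_def
  proof (rule polyfun_mp_eval)
    fix k :: nat
    consider "k = 0" | "k = 1" | "k = 2" | "k \<notin> {0, 1, 2}" by blast
    thus "polyfun (\<lambda>t. pqr_coord (X t) (Y t) (Z t) k)"
      using that by cases (simp_all add: pqr_coord_def)
  qed
  \<comment> \<open>Identity theorem: the real segment accumulates at 0, an interior point of the
    disc where the series are holomorphic.\<close>
  have disc: "mp_eval \<Phi> (\<lambda>k. divisor_ser 1 k z) = 0" if z: "norm z < 1" for z :: complex
  proof (rule analytic_continuation[of "\<lambda>z. mp_eval \<Phi> (\<lambda>k. divisor_ser 1 k z)" "ball 0 1" "of_real ` {0<..<1/2}" 0])
    show "(\<lambda>z. mp_eval \<Phi> (\<lambda>k. divisor_ser 1 k z)) holomorphic_on ball 0 1"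
      by (intro mp_eval_holomorphic divisor_ser_holomorphic)
    show "complex_of_real ` {0<..<1/2} \<subseteq> ball 0 1" by auto
    show "0 islimpt complex_of_real ` {0<..<1/2}"
      unfolding islimpt_approachable
    proof (intro allI impI)
      fix e :: real assume "e > 0"
      define x where "x = min e (1/3) / 2"
      have x: "x \<in> {0<..<1/2}" "x < e" using \<open>e > 0\<close> by (auto simp: x_def min_def)
      thus "\<exists>x'\<in>complex_of_real ` {0<..<1/2}. x' \<noteq> 0 \<and> dist x' 0 < e"
        by (intro bexI[of _ "of_real x"] imageI) auto
    qed
    show "mp_eval \<Phi> (\<lambda>k. divisor_ser 1 k z) = 0" if "z \<in> complex_of_real ` {0<..<1/2}" for z
    proof -
      from that obtain q where "z = of_real q" "q \<in> {0<..<1/2}" by (rule imageE)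
      hence q: "z = of_real q" "0 < q" "q < 1/2" by auto
      have "mp_eval \<Phi> (\<lambda>k. divisor_ser 1 k z) = complex_of_real (mp_eval \<Phi> (\<lambda>k. A k q))"
        using q by (simp add: mp_eval_of_real [symmetric] divisor_ser_of_real A_eq_divisor_ser)
      thus ?thesis using zero[of q] q by simp
    qed
  qed (use z in auto)
  have G0: "G (ser_P q) (ser_Q q) (ser_R q) = 0" if q: "norm q < 1" for q
    using disc[OF q] unfolding G_def
    by (subst mp_eval_cong[of _ _ "\<lambda>k. divisor_ser 1 k q"]) (use vars divisor_ser_pqr[OF q] in auto)
  define \<kappa> :: complex where "\<kappa> = 6 / (of_real pi * \<i>)"
  have \<kappa>: "\<kappa> \<noteq> 0" by (simp add: \<kappa>_def)
  have G1: "G X (j ^ 4 * ser_Q (qexp \<tau>)) (j ^ 6 * ser_R (qexp \<tau>)) = 0"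
    if \<tau>: "Im \<tau> > 0" and Q: "ser_Q (qexp \<tau>) \<noteq> 0" and j: "j \<noteq> 0" for X j \<tau>
  proof -
    let ?P = "ser_P (qexp \<tau>)" and ?Q = "ser_Q (qexp \<tau>)" and ?R = "ser_R (qexp \<tau>)"
    have step1: "G (j ^ 2 * ?P + \<kappa> * of_nat c * j) (j ^ 4 * ?Q) (j ^ 6 * ?R) = 0" if c: "c \<ge> 1" for c :: nat and j
    proof -
      \<comment> \<open>For a natural number t the translation by t leaves q unchanged, so the
        relation at (\<tau> + t) / J(t) becomes one at \<tau>. It is polynomial in t and therefore
        holds for all complex t.\<close>
      define J where "J t = of_nat c * (\<tau> + t) + 1" for t
      have "G (J t ^ 2 * ?P + \<kappa> * of_nat c * J t) (J t ^ 4 * ?Q) (J t ^ 6 * ?R) = 0" for t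
      proof (rule polyfun_eq_0[of "\<lambda>t. G (J t ^ 2 * ?P + \<kappa> * of_nat c * J t) (J t ^ 4 * ?Q) (J t ^ 6 * ?R)" "range of_nat"])
        show "polyfun (\<lambda>t. G (J t ^ 2 * ?P + \<kappa> * of_nat c * J t) (J t ^ 4 * ?Q) (J t ^ 6 * ?R))"
          unfolding J_def by (intro polyG) simp_all
        show "infinite (range of_nat :: complex set)" by (simp add: finite_image_iff inj_on_def)
        fix t :: complex assume "t \<in> range of_nat"
        then obtain m :: nat where t: "t = of_int (int m)" by auto
        have \<tau>t: "Im (\<tau> + t) > 0" using \<tau> t by simp
        have qt: "qexp (\<tau> + t) = qexp \<tau>" unfolding t by (rule qexp_add_int)
        have J: "of_int (int c) * (\<tau> + t) + 1 = J t" by (simp add: J_def)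
        have "norm (qexp ((\<tau> + t) / J t)) < 1"
          using upper_half_transform(2)[OF \<tau>t, of "int c"] unfolding J by (rule norm_qexp)
        from G0[OF this] show "G (J t ^ 2 * ?P + \<kappa> * of_nat c * J t) (J t ^ 4 * ?Q) (J t ^ 6 * ?R) = 0"
          using ser_P_transform[OF \<tau>t, of "int c"] ser_Q_transform[OF \<tau>t, of "int c"] ser_R_transform[OF \<tau>t, of "int c"] Q
          unfolding J qt \<kappa>_def by simp
      qed
      \<comment> \<open>This t solves J t = j.\<close>
      from this[of "(j - 1) / of_nat c - \<tau>"] show ?thesis using c by (simp add: J_def)
    qed
    have step2: "G (j ^ 2 * ?P + \<kappa> * c * j) (j ^ 4 * ?Q) (j ^ 6 * ?R) = 0" for c
    proof (rule polyfun_eq_0[of "\<lambda>c. G (j ^ 2 * ?P + \<kappa> * c * j) (j ^ 4 * ?Q) (j ^ 6 * ?R)" "of_nat ` {1..}"])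
      show "polyfun (\<lambda>c. G (j ^ 2 * ?P + \<kappa> * c * j) (j ^ 4 * ?Q) (j ^ 6 * ?R))" by (intro polyG) simp_all
      show "infinite (of_nat ` {1..} :: complex set)" by (simp add: finite_image_iff inj_on_def infinite_Ici)
    qed (use step1 in auto)
    \<comment> \<open>With this c the inhomogeneous term supplies exactly X - j^2 P, so the first
      coordinate becomes free.\<close>
    from step2[of "(X - j ^ 2 * ?P) / (\<kappa> * j)"] show ?thesis using j \<kappa> by simp
  qed
  \<comment> \<open>The point (Y, Z) is parametrized by \<mu> = Z / Y and u = Y^3 / Z^2; in these
    coordinates the relation is known for u in the infinite set \<open>j_values\<close>.\<close>
  have G2: "G X (\<mu> ^ 2 * u) (\<mu> ^ 3 * u) = 0" if \<mu>: "\<mu> \<noteq> 0" for X \<mu> u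
  proof (rule polyfun_eq_0[of "\<lambda>u. G X (\<mu> ^ 2 * u) (\<mu> ^ 3 * u)" j_values])
    show "polyfun (\<lambda>u. G X (\<mu> ^ 2 * u) (\<mu> ^ 3 * u))" by (intro polyG) simp_all
    fix u assume "u \<in> j_values"
    then obtain q where q: "u = ser_Q q ^ 3 / ser_R q ^ 2" "norm q < 1" "q \<noteq> 0" "ser_Q q \<noteq> 0" "ser_R q \<noteq> 0"
      unfolding j_values_def by blast
    obtain \<tau> where \<tau>: "Im \<tau> > 0" "qexp \<tau> = q" using ex_qexp[OF q(3,2)] .
    \<comment> \<open>With j^2 = \<mu> Q / R both j^4 Q = \<mu>^2 u and j^6 R = \<mu>^3 u hold for u
      = Q^3 / R^2.\<close>
    define j where "j = csqrt (\<mu> * ser_Q q / ser_R q)"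
    have j2: "j ^ 2 = \<mu> * ser_Q q / ser_R q" by (simp add: j_def)
    have j: "j \<noteq> 0" using \<mu> q by (simp add: j_def)
    have "j ^ 4 = (j ^ 2) ^ 2" "j ^ 6 = (j ^ 2) ^ 3" by (simp_all flip: power_mult)
    hence "j ^ 4 * ser_Q q = \<mu> ^ 2 * u" "j ^ 6 * ser_R q = \<mu> ^ 3 * u"
      unfolding j2 q(1) using q(5) by (simp_all add: field_simps power2_eq_square power3_eq_cube)
    thus "G X (\<mu> ^ 2 * u) (\<mu> ^ 3 * u) = 0"
      using G1[of \<tau> j X] \<tau> q j by simp
  qed (rule infinite_j_values)
  have G3: "G X Y Z = 0" if "Y \<noteq> 0" "Z \<noteq> 0" for X Y Z
  proof -
    have "(Z / Y) ^ 2 * (Y ^ 3 / Z ^ 2) = Y" "(Z / Y) ^ 3 * (Y ^ 3 / Z ^ 2) = Z"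
      using that by (simp_all add: field_simps power2_eq_square power3_eq_cube)
    thus ?thesis using G2[of "Z / Y" X "Y ^ 3 / Z ^ 2"] that by simp
  qed
  have inf: "infinite (- {0 :: complex})"
    using infinite_UNIV_char_0[where 'a = complex] by (simp add: Compl_eq_Diff_UNIV)
  have G4: "G X Y Z = 0" if "Y \<noteq> 0" for X Y Z
    by (rule polyfun_eq_0[of "\<lambda>Z. G X Y Z", OF polyG inf]) (use that G3 in auto)
  have G5: "G X Y Z = 0" for X Y Z
    by (rule polyfun_eq_0[of "\<lambda>Y. G X Y Z", OF polyG inf]) (use G4 in auto)
  show ?thesis
  proof (rule mp_eval_eq_0_imp_eq_0)
    fix x :: "nat \<Rightarrow> complex"
    \<comment> \<open>The inverse of \<open>pqr_coord\<close>, so that every point (x 0, x 1, x 2)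
      is reached.\<close>
    define X Y where "X = 1 - 24 * x 0" and "Y = 288 * x 1 + X ^ 2"
    define Z where "Z = X * Y + (Y - X ^ 2) * X / 2 - 864 * x 2"
    have "mp_eval \<Phi> x = G X Y Z"
      unfolding G_def
    proof (rule mp_eval_cong)
      fix k assume "k \<in> mp_vars \<Phi>"
      hence "k \<in> {0, 1, 2}" using vars by blast
      thus "x k = pqr_coord X Y Z k"
        by (auto simp: pqr_coord_def X_def Y_def Z_def field_simps)
    qed
    thus "mp_eval \<Phi> x = 0" by (simp add: G5)
  qed
qed

theorem theorem1p2:
  shows "(\<forall>n::nat. n \<ge> 1 \<longrightarrow>
           (\<exists>!\<Phi>::mpoly. mp_vars \<Phi> \<subseteq> {0, 1, 2} \<and>
               (\<forall>q::real. 0 < q \<and> q < 1 \<longrightarrow> C n q = mp_eval \<Phi> (\<lambda>k. A k q))))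
    \<and> (\<forall>n::nat. n \<ge> 2 \<longrightarrow> (\<forall>\<Phi>::mpoly.
           mp_vars \<Phi> \<subseteq> {0, 1, 2} \<and>
           (\<forall>q::real. 0 < q \<and> q < 1 \<longrightarrow> C (2 * n - 1) q = mp_eval \<Phi> (\<lambda>k. A k q)) \<longrightarrow>
             Poly_Mapping.lookup \<Phi> 0 = 0 \<and>
             Poly_Mapping.lookup \<Phi> (Poly_Mapping.single 0 1) = 6 * bernoulli (2 * n) / of_nat n \<and>
             Poly_Mapping.lookup \<Phi> (Poly_Mapping.single 1 1) = - 36 * bernoulli (2 * n) / of_nat n \<and>
             Poly_Mapping.lookup \<Phi> (Poly_Mapping.single 2 1) = 1 + 30 * bernoulli (2 * n) / of_nat n))
    \<and> (\<forall>n::nat. n \<ge> 2 \<longrightarrow> (\<forall>\<Phi>::mpoly.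
           mp_vars \<Phi> \<subseteq> {0, 1, 2} \<and>
           (\<forall>q::real. 0 < q \<and> q < 1 \<longrightarrow> C (2 * n) q = mp_eval \<Phi> (\<lambda>k. A k q)) \<longrightarrow>
             Poly_Mapping.lookup \<Phi> 0 = 0 \<and>
             Poly_Mapping.lookup \<Phi> (Poly_Mapping.single 0 1) = 0 \<and>
             Poly_Mapping.lookup \<Phi> (Poly_Mapping.single 1 1) = - 6 * bernoulli (2 * n) / of_nat n \<and>
             Poly_Mapping.lookup \<Phi> (Poly_Mapping.single 2 1) = 6 * bernoulli (2 * n) / of_nat n - 1))"
proof -
  have unique: "\<Phi> = Phi n" if "mp_vars \<Phi> \<subseteq> {0, 1, 2}"
    "\<forall>q::real. 0 < q \<and> q < 1 \<longrightarrow> C n q = mp_eval \<Phi> (\<lambda>k. A k q)" for \<Phi> n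
  proof -
    have "\<Phi> - Phi n = 0"
      by (rule A_algebraically_independent[OF mp_vars_diff_le[OF that(1) mp_vars_Phi]])
         (use that(2) mp_eval_Phi in auto)
    thus ?thesis by simp
  qed
  have part1: "\<exists>!\<Phi>. mp_vars \<Phi> \<subseteq> {0, 1, 2} \<and> (\<forall>q::real. 0 < q \<and> q < 1 \<longrightarrow> C n q = mp_eval \<Phi> (\<lambda>k. A k q))" for n
    by (rule ex1I[of _ "Phi n"]) (use mp_vars_Phi mp_eval_Phi unique in auto)
  show ?thesis
  proof (intro conjI allI impI)
    fix n :: nat assume "n \<ge> 1"
    show "\<exists>!\<Phi>. mp_vars \<Phi> \<subseteq> {0, 1, 2} \<and> (\<forall>q::real. 0 < q \<and> q < 1 \<longrightarrow> C n q = mp_eval \<Phi> (\<lambda>k. A k q))"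
      by (rule part1)
  next
    fix n \<Phi>
    assume n: "n \<ge> 2" and "mp_vars \<Phi> \<subseteq> {0, 1, 2} \<and> (\<forall>q::real. 0 < q \<and> q < 1 \<longrightarrow> C (2 * n - 1) q = mp_eval \<Phi> (\<lambda>k. A k q))"
    hence \<Phi>: "\<Phi> = Phi (2 * n - 1)" using unique by blast
    note coeffs = Phi_coeffs_odd[OF n, unfolded c0_def lin_def]
    show "Poly_Mapping.lookup \<Phi> 0 = 0" unfolding \<Phi> by (rule coeffs(1))
    show "Poly_Mapping.lookup \<Phi> (Poly_Mapping.single 0 1) = 6 * bernoulli (2 * n) / of_nat n" unfolding \<Phi> by (rule coeffs(2))
    show "Poly_Mapping.lookup \<Phi> (Poly_Mapping.single 1 1) = - 36 * bernoulli (2 * n) / of_nat n" unfolding \<Phi> by (rule coeffs(3))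
    show "Poly_Mapping.lookup \<Phi> (Poly_Mapping.single 2 1) = 1 + 30 * bernoulli (2 * n) / of_nat n" unfolding \<Phi> by (rule coeffs(4))
  next
    fix n \<Phi>
    assume n: "n \<ge> 2" and "mp_vars \<Phi> \<subseteq> {0, 1, 2} \<and> (\<forall>q::real. 0 < q \<and> q < 1 \<longrightarrow> C (2 * n) q = mp_eval \<Phi> (\<lambda>k. A k q))"
    hence \<Phi>: "\<Phi> = Phi (2 * n)" using unique by blast
    note coeffs = Phi_coeffs_even[OF n, unfolded c0_def lin_def]
    show "Poly_Mapping.lookup \<Phi> 0 = 0" unfolding \<Phi> by (rule coeffs(1))
    show "Poly_Mapping.lookup \<Phi> (Poly_Mapping.single 0 1) = 0" unfolding \<Phi> by (rule coeffs(2))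
    show "Poly_Mapping.lookup \<Phi> (Poly_Mapping.single 1 1) = - 6 * bernoulli (2 * n) / of_nat n" unfolding \<Phi> by (rule coeffs(3))
    show "Poly_Mapping.lookup \<Phi> (Poly_Mapping.single 2 1) = 6 * bernoulli (2 * n) / of_nat n - 1" unfolding \<Phi> by (rule coeffs(4))
  qed
qed

end
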